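(* Let $\boldsymbol{X}=(X_t)_{t\in T}$ be a continuous max-id process with vertex $h_{\boldsymbol{X}}=\boldsymbol{0}$ and exponent measure $\mu$, and let $\boldsymbol{t}=(t_1,\ldots,t_d)\in T^d$. Then Algorithm 1 (described in the context), run with input $\mu$ and $t_1,\ldots,t_d$, stops after finitely many steps with probability one, and its output $\hat{\boldsymbol{X}}=(\hat X_t)_{t\in T}$ satisfies $$(\hat X_{t_1},\ldots,\hat X_{t_d})\sim (X_{t_1},\ldots,X_{t_d}),$$ where $\sim$ denotes equality in distribution.
   Context: $T$ is a locally compact metric space. $C(T)$ is the space of continuous functions $f:T\to\mathbb{R}$ with the Borel $\sigma$-algebra of the topology of uniform convergence on compact sets, and $C_0(T):=\{f\in C(T): f\ge 0,\ f\neq \boldsymbol 0\}$, where $\boldsymbol 0$ is the zero function. Maxima of functions are pointwise, and the maximum over the empty set is $\boldsymbol 0$. PRM means Poisson random measure (Poisson point process). For a point measure $N$, "$f\in N$" means that $f$ is an atom of $N$, and $N$ is also regarded as the collection of its atoms. A stochastic process $\boldsymbol X=(X_t)_{t\in T}$ is max-id if for every $n\in\mathbb N$ there are iid processes $\boldsymbol X^{(1,n)},\ldots,\boldsymbol X^{(n,n)}$ with $\boldsymbol X\sim\max_{1\le i\le n}\boldsymbol X^{(i,n)}$. It is continuous if $t\mapsto X_t(\omega)$ is continuous for every $\omega$. Its vertex is $h_{\boldsymbol X}(t)=\sup\{x\in\mathbb R: \mathbb P(X_t>x)=1\}$. Known fact defining the exponent measure: a continuous max-id process with vertex $\boldsymbol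 0$ satisfies $\boldsymbol X\sim\max_{f\in N}f$, where $N$ is a PRM on $C_0(T)$ whose locally finite intensity measure $\mu$ (the exponent measure of $\boldsymbol X$) satisfies $\mu(\{f\in C_0(T):\sup_{k\in K}f(k)>\epsilon\})<\infty$ for all compact $K\subset T$ and $\epsilon>0$. Let $J_0:=\{j\in\{1,\ldots,d\}:\mathbb P(X_{t_j}=0)>0\}$. Algorithm 1. All simulated PRMs are drawn with fresh independent randomness, given the parameters of their intensity at that moment. 1. For $j\in J_0$ set $\mu_j(\cdot)=\mu(\cdot\cap\{f\in C_0(T): f(t_j)>0,\ f(t_k)=0 \text{ for all } k<j,\ k\in J_0\})$. Set $\tilde\mu(\cdot)=\mu(\cdot\cap\{f\in C_0(T): f(t_j)=0\text{ for all }j\in J_0\})$. 2. For each $j\in J_0$: simulate a (finite) PRM $N_j$ with intensity $\mu_j$ and set $\hat{\boldsymbol X}_j=\max_{f\in N_j}f$. 3. Set $\tilde{\boldsymbol X}=\boldsymbol 0$. For $i=1,\ldots,d$ with $i\notin J_0$, successively do: (a) If $\tilde X_{t_i}=0$: set $\tilde N^+=\emptyset$, $c_u=\infty$ and $c_l=c$ for some $c>0$. While $\tilde N^+=\emptyset$: simulate a finite PRM $\tilde N^+$ with intensity $\mathbf 1_{\{c_u>f(t_i)\ge c_l\}}\,\mathrm d\tilde\mu(f)$; remove from $\tilde N^+$ every $f$ with $f(t_k)\ge\tilde X_{t_k}$ for some $k<i$, $k\notin J_0$; then set $c_u=c_l$ and afterwards $c_l=c_l/2$. (b) Otherwise (if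 $\tilde X_{t_i}>0$): simulate a finite PRM $\tilde N^+$ with intensity $\mathbf 1_{\{f(t_i)\ge\tilde X_{t_i}\}}\,\mathrm d\tilde\mu(f)$ and remove from $\tilde N^+$ every $f$ with $f(t_k)\ge\tilde X_{t_k}$ for some $k<i$, $k\notin J_0$. (c) Set $\tilde N^+_{t_i}=\{f\in\tilde N^+: f(t_i)\ge\tilde f(t_i)\text{ for all }\tilde f\in\tilde N^+\}$ and replace $\tilde{\boldsymbol X}$ by $\max\{\max_{f\in\tilde N^+_{t_i}}f,\ \tilde{\boldsymbol X}\}$. 4. Return $\hat{\boldsymbol X}=\max\{\max_{j\in J_0}\hat{\boldsymbol X}_j,\ \tilde{\boldsymbol X}\}$. *)

theory Defs
  imports "HOL-Probability.Probability"
begin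

section \<open>Continuous functions and stochastic processes\<close>

definition CT :: "('a::metric_space \<Rightarrow> real) set" where
  "CT = {f. continuous_on UNIV f}"

definition ucc_topology :: "('a::metric_space \<Rightarrow> real) topology" where
  "ucc_topology = topology_generated_by
     {{g \<in> CT. \<forall>x\<in>K. dist (g x) (f x) < e} |f K e. f \<in> CT \<and> compact K \<and> 0 < e}"

definition CT_borel :: "('a::metric_space \<Rightarrow> real) measure" where
  "CT_borel = sigma CT {U. openin ucc_topology U}"

definition C0 :: "('a::metric_space \<Rightarrow> real) set" where
  "C0 = {f \<in> CT. (\<forall>x. 0 \<le> f x) \<and> f \<noteq> (\<lambda>_. 0)}"

definition C0_borel :: "('a::metric_space \<Rightarrow> real) measure" where
  "C0_borel = restrict_space CT_borel C0"

text \<open>The supremum is a maximum for finite sets. It is also one (almost surely) at every point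
  where it is positive when the set consists of the atoms of the Poisson random measure that
  represents a max-id process, since only finitely many atoms then exceed a given positive level.\<close>

definition pmax :: "('a \<Rightarrow> real) set \<Rightarrow> 'a \<Rightarrow> real" where
  "pmax A = (\<lambda>x. if A = {} then 0 else (SUP f\<in>A. f x))"

definition same_law :: "'w measure \<Rightarrow> 'v measure \<Rightarrow> 'b measure \<Rightarrow> ('w \<Rightarrow> 'b) \<Rightarrow> ('v \<Rightarrow> 'b) \<Rightarrow> bool" where
  "same_law M Q S X Y \<longleftrightarrow> X \<in> measurable M S \<and> Y \<in> measurable Q S \<and> distr M S X = distr Q S Y"

text \<open>The law of a stochastic process is its law on the product \<open>\<sigma>\<close>-algebra, i.e. it is given by the
  finite-dimensional distributions.\<close>

definition paths :: "('a \<Rightarrow> real) measure" where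
  "paths = (\<Pi>\<^sub>M x\<in>UNIV. borel)"

definition continuous_process :: "'w measure \<Rightarrow> ('w \<Rightarrow> 'a::metric_space \<Rightarrow> real) \<Rightarrow> bool" where
  "continuous_process M X \<longleftrightarrow>
     (\<forall>x. (\<lambda>\<omega>. X \<omega> x) \<in> borel_measurable M) \<and> (\<forall>\<omega>\<in>space M. continuous_on UNIV (X \<omega>))"

text \<open>The sample space of the iid processes may be taken to be the sequence space of paths, because
  the condition only depends on their joint law.\<close>

definition max_id :: "'w measure \<Rightarrow> ('w \<Rightarrow> 'a \<Rightarrow> real) \<Rightarrow> bool" where
  "max_id M X \<longleftrightarrow> (\<forall>n\<ge>1::nat. \<exists>(Q :: (nat \<Rightarrow> 'a \<Rightarrow> real) measure) Y.
     prob_space Q \<and>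
     prob_space.indep_vars Q (\<lambda>_. paths) Y {1..n} \<and>
     (\<forall>i\<in>{1..n}. \<forall>j\<in>{1..n}. same_law Q Q paths (Y i) (Y j)) \<and>
     same_law M Q paths X (\<lambda>\<omega> x. MAX i\<in>{1..n}. Y i \<omega> x))"

definition vertex :: "'w measure \<Rightarrow> ('w \<Rightarrow> 'a \<Rightarrow> real) \<Rightarrow> 'a \<Rightarrow> ereal" where
  "vertex M X x = Sup (ereal ` {r. measure M {\<omega> \<in> space M. X \<omega> x > r} = 1})"


section \<open>Poisson random measures\<close>

definition is_point_measure :: "'b measure \<Rightarrow> 'b measure \<Rightarrow> bool" where
  "is_point_measure S N \<longleftrightarrow> sets N = sets S \<and>
     (\<forall>f\<in>space S. emeasure N {f} \<in> \<nat>) \<and>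
     (\<forall>A\<in>sets S. emeasure N A = (\<integral>\<^sup>+ f. emeasure N {f} \<partial>count_space A))"

definition atoms :: "'b measure \<Rightarrow> 'b set" where
  "atoms N = {f. emeasure N {f} > 0}"

text \<open>The probability of the value \<open>k\<close> under the Poisson distribution with mean \<open>r\<close>;
  mean zero gives the constant zero and infinite mean the constant \<open>\<infinity>\<close>.\<close>

definition poisson_prob :: "ennreal \<Rightarrow> nat \<Rightarrow> ennreal" where
  "poisson_prob r k =
     (if r = \<infinity> then 0 else ennreal (enn2real r ^ k / fact k * exp (- enn2real r)))"

text \<open>Conditionally on the \<open>\<sigma>\<close>-algebra \<open>F\<close>, the random point measure \<open>N\<close> on \<open>S\<close> is a Poisson random
  measure with the (random, \<open>F\<close>-dependent) intensity \<open>\<nu>\<close>. Only finite counts need to be prescribed: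
  if \<open>\<nu> \<omega> (A l)\<close> is infinite, all of them get probability zero, so the count is almost surely
  infinite. A Poisson random measure with finite intensity has almost surely finitely many points;
  the last condition excludes the exceptional null set, so that such a random measure is finite
  everywhere.\<close>

definition prm_given ::
    "'w measure \<Rightarrow> 'w measure \<Rightarrow> 'b measure \<Rightarrow> ('w \<Rightarrow> 'b measure) \<Rightarrow> ('w \<Rightarrow> 'b measure) \<Rightarrow> bool" where
  "prm_given P F S N \<nu> \<longleftrightarrow>
     (\<forall>\<omega>\<in>space P. is_point_measure S (N \<omega>)) \<and>
     (\<forall>A\<in>sets S. (\<lambda>\<omega>. emeasure (N \<omega>) A) \<in> borel_measurable P) \<and>
     (\<forall>H\<in>sets F. \<forall>(k::nat) A n. (\<forall>l<k. A l \<in> sets S) \<longrightarrow> disjoint_family_on A {..<k} \<longrightarrow>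
        emeasure P {\<omega> \<in> H. \<forall>l<k. emeasure (N \<omega>) (A l) = of_nat (n l)} =
        (\<integral>\<^sup>+ \<omega>\<in>H. (\<Prod>l<k. poisson_prob (emeasure (\<nu> \<omega>) (A l)) (n l)) \<partial>P)) \<and>
     (\<forall>\<omega>\<in>space P. emeasure (\<nu> \<omega>) (space S) < \<infinity> \<longrightarrow> emeasure (N \<omega>) (space S) < \<infinity>)"

definition prm :: "'w measure \<Rightarrow> 'b measure \<Rightarrow> ('w \<Rightarrow> 'b measure) \<Rightarrow> 'b measure \<Rightarrow> bool" where
  "prm P S N \<mu> \<longleftrightarrow> prm_given P (sigma (space P) {}) S N (\<lambda>_. \<mu>)"

text \<open>The sample space of the Poisson random measure may be taken to be a set of measures, because
  the condition only depends on its law.\<close>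

definition exponent_measure ::
    "'w measure \<Rightarrow> ('w \<Rightarrow> 'a::metric_space \<Rightarrow> real) \<Rightarrow> ('a \<Rightarrow> real) measure \<Rightarrow> bool" where
  "exponent_measure M X \<mu> \<longleftrightarrow>
     sets \<mu> = sets C0_borel \<and>
     (\<forall>K e. compact K \<longrightarrow> K \<noteq> {} \<longrightarrow> 0 < e \<longrightarrow> emeasure \<mu> {f \<in> C0. (SUP x\<in>K. f x) > e} < \<infinity>) \<and>
     (\<exists>(Q :: ('a \<Rightarrow> real) measure measure) N.
        prob_space Q \<and> prm Q C0_borel N \<mu> \<and>
        same_law M Q paths X (\<lambda>\<omega>. pmax (atoms (N \<omega>))))"


section \<open>The simulation algorithm\<close>

text \<open>The functions below have the parameters \<open>\<mu>\<close> (exponent measure), \<open>J\<close> (the index set \<open>J0\<close>),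
  \<open>d\<close> and \<open>t\<close> (the points \<open>t 1, \<dots>, t d\<close>) and \<open>c\<close> (\<open>c i\<close> is the initial lower level of the
  while loop for index \<open>i\<close>).\<close>

definition J0 :: "'w measure \<Rightarrow> ('w \<Rightarrow> 'a \<Rightarrow> real) \<Rightarrow> nat \<Rightarrow> (nat \<Rightarrow> 'a) \<Rightarrow> nat set" where
  "J0 M X d t = {j \<in> {1..d}. measure M {\<omega> \<in> space M. X \<omega> (t j) = 0} > 0}"

definition mu_J ::
    "('a::metric_space \<Rightarrow> real) measure \<Rightarrow> nat set \<Rightarrow> (nat \<Rightarrow> 'a) \<Rightarrow> nat \<Rightarrow> ('a \<Rightarrow> real) measure" where
  "mu_J \<mu> J t j =
     density \<mu> (indicator {f \<in> C0. f (t j) > 0 \<and> (\<forall>k\<in>J. k < j \<longrightarrow> f (t k) = 0)})"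

definition mu_tilde ::
    "('a::metric_space \<Rightarrow> real) measure \<Rightarrow> nat set \<Rightarrow> (nat \<Rightarrow> 'a) \<Rightarrow> ('a \<Rightarrow> real) measure" where
  "mu_tilde \<mu> J t = density \<mu> (indicator {f \<in> C0. \<forall>j\<in>J. f (t j) = 0})"

text \<open>Configurations of the algorithm:
  \<^item> \<open>Zeros j Xh\<close>: index \<open>j\<close> of step 2 is next, \<open>Xh k\<close> is the function computed for \<open>k < j\<close>;
  \<^item> \<open>Outer i Xh Xt\<close>: index \<open>i\<close> of step 3 is next, \<open>Xt\<close> is the current maximum;
  \<^item> \<open>Search i Xh Xt cu cl\<close>: in the while loop of step 3(a), no admissible function found so far;
  \<^item> \<open>Stopped Xhat\<close>: the algorithm has returned \<open>Xhat\<close>.\<close>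

datatype 'a config =
    Zeros nat "nat \<Rightarrow> 'a \<Rightarrow> real"
  | Outer nat "nat \<Rightarrow> 'a \<Rightarrow> real" "'a \<Rightarrow> real"
  | Search nat "nat \<Rightarrow> 'a \<Rightarrow> real" "'a \<Rightarrow> real" ereal real
  | is_Stopped: Stopped (result: "'a \<Rightarrow> real")

text \<open>The removal part of steps 3(a) and 3(b).\<close>

definition admissible ::
    "nat set \<Rightarrow> (nat \<Rightarrow> 'a) \<Rightarrow> nat \<Rightarrow> ('a \<Rightarrow> real) \<Rightarrow> ('a \<Rightarrow> real) measure \<Rightarrow> ('a \<Rightarrow> real) set" where
  "admissible J t i Xt N =
     atoms N - {f. \<exists>k. 1 \<le> k \<and> k < i \<and> k \<notin> J \<and> f (t k) \<ge> Xt (t k)}"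

text \<open>Step 3(c).\<close>

definition update :: "(nat \<Rightarrow> 'a) \<Rightarrow> nat \<Rightarrow> ('a \<Rightarrow> real) set \<Rightarrow> ('a \<Rightarrow> real) \<Rightarrow> ('a \<Rightarrow> real)" where
  "update t i A Xt =
     (\<lambda>x. max (pmax {f \<in> A. \<forall>g\<in>A. f (t i) \<ge> g (t i)} x) (Xt x))"

text \<open>The intensity of the Poisson random measure simulated in a configuration. It is the null
  measure where the algorithm simulates nothing; \<open>step\<close> ignores the simulated measure there.\<close>

fun intensity ::
    "('a::metric_space \<Rightarrow> real) measure \<Rightarrow> nat set \<Rightarrow> nat \<Rightarrow> (nat \<Rightarrow> 'a) \<Rightarrow> 'a config
      \<Rightarrow> ('a \<Rightarrow> real) measure" where
  "intensity \<mu> J d t (Zeros j Xh) =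
     (if j \<le> d \<and> j \<in> J then mu_J \<mu> J t j else null_measure C0_borel)"
| "intensity \<mu> J d t (Outer i Xh Xt) =
     (if i \<le> d \<and> i \<notin> J \<and> Xt (t i) \<noteq> 0
      then density (mu_tilde \<mu> J t) (indicator {f \<in> C0. f (t i) \<ge> Xt (t i)})
      else null_measure C0_borel)"
| "intensity \<mu> J d t (Search i Xh Xt cu cl) =
     density (mu_tilde \<mu> J t) (indicator {f \<in> C0. cu > ereal (f (t i)) \<and> f (t i) \<ge> cl})"
| "intensity \<mu> J d t (Stopped Xhat) = null_measure C0_borel"

fun step ::
    "nat set \<Rightarrow> nat \<Rightarrow> (nat \<Rightarrow> 'a) \<Rightarrow> (nat \<Rightarrow> real) \<Rightarrow> 'a config \<Rightarrow> ('a \<Rightarrow> real) measure \<Rightarrow> 'a config"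
    where
  "step J d t c (Zeros j Xh) N =
     (if j > d then Outer 1 Xh (\<lambda>_. 0)
      else if j \<in> J then Zeros (j + 1) (Xh(j := pmax (atoms N)))
      else Zeros (j + 1) Xh)"
| "step J d t c (Outer i Xh Xt) N =
     (if i > d then Stopped (\<lambda>x. max (pmax (Xh ` J) x) (Xt x))
      else if i \<in> J then Outer (i + 1) Xh Xt
      else if Xt (t i) = 0 then Search i Xh Xt \<infinity> (c i)
      else Outer (i + 1) Xh (update t i (admissible J t i Xt N) Xt))"
| "step J d t c (Search i Xh Xt cu cl) N =
     (if admissible J t i Xt N = {} then Search i Xh Xt (ereal cl) (cl / 2)
      else Outer (i + 1) Xh (update t i (admissible J t i Xt N) Xt))"
| "step J d t c (Stopped Xhat) N = Stopped Xhat"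

text \<open>The configuration after \<open>n\<close> steps if \<open>N m\<close> is the point measure simulated in configuration
  number \<open>m\<close>.\<close>

primrec config_at ::
    "nat set \<Rightarrow> nat \<Rightarrow> (nat \<Rightarrow> 'a) \<Rightarrow> (nat \<Rightarrow> real) \<Rightarrow> (nat \<Rightarrow> ('a \<Rightarrow> real) measure) \<Rightarrow> nat
      \<Rightarrow> 'a config" where
  "config_at J d t c N 0 = Zeros 1 (\<lambda>_ _. 0)"
| "config_at J d t c N (Suc n) = step J d t c (config_at J d t c N n) (N n)"

definition stops ::
    "nat set \<Rightarrow> nat \<Rightarrow> (nat \<Rightarrow> 'a) \<Rightarrow> (nat \<Rightarrow> real) \<Rightarrow> (nat \<Rightarrow> ('a \<Rightarrow> real) measure) \<Rightarrow> bool" where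
  "stops J d t c N \<longleftrightarrow> (\<exists>n. is_Stopped (config_at J d t c N n))"

text \<open>The value for runs that do not stop is an arbitrary convention.\<close>

definition returned ::
    "nat set \<Rightarrow> nat \<Rightarrow> (nat \<Rightarrow> 'a) \<Rightarrow> (nat \<Rightarrow> real) \<Rightarrow> (nat \<Rightarrow> ('a \<Rightarrow> real) measure) \<Rightarrow> 'a \<Rightarrow> real" where
  "returned J d t c N =
     (if stops J d t c N
      then result (config_at J d t c N (LEAST n. is_Stopped (config_at J d t c N n)))
      else (\<lambda>_. 0))"

definition history ::
    "'w measure \<Rightarrow> 'b measure \<Rightarrow> (nat \<Rightarrow> 'w \<Rightarrow> 'b measure) \<Rightarrow> nat \<Rightarrow> 'w measure" where
  "history P S N n = sigma (space P)
     {{\<omega> \<in> space P. emeasure (N m \<omega>) A \<in> B} |m A B. m < n \<and> A \<in> sets S \<and> B \<in> sets borel}"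

text \<open>On the probability space \<open>P\<close> the point measures \<open>N 0, N 1, \<dots>\<close> are the simulations of a run:
  given everything simulated before, \<open>N n\<close> is a Poisson random measure whose intensity is the one
  that the current configuration asks for.\<close>

definition is_run ::
    "'w measure \<Rightarrow> ('a::metric_space \<Rightarrow> real) measure \<Rightarrow> nat set \<Rightarrow> nat \<Rightarrow> (nat \<Rightarrow> 'a) \<Rightarrow> (nat \<Rightarrow> real)
      \<Rightarrow> (nat \<Rightarrow> 'w \<Rightarrow> ('a \<Rightarrow> real) measure) \<Rightarrow> bool" where
  "is_run P \<mu> J d t c N \<longleftrightarrow> prob_space P \<and>
     (\<forall>n. prm_given P (history P C0_borel N n) C0_borel (N n)
            (\<lambda>\<omega>. intensity \<mu> J d t (config_at J d t c (\<lambda>m. N m \<omega>) n)))"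

end

theory Submission
  imports Defs
begin

text \<open>Fix thresholds \<open>x l > 0\<close>, let \<open>B\<close> be the set of functions exceeding some \<open>x l\<close> at \<open>t l\<close>, and write
  \<open>\<mu>~\<close> for the restriction of \<open>\<mu>\<close> used in step 3. In a configuration of step 3 with current maximum
  \<open>h\<close> and next index \<open>i\<close>, the functions not yet simulated should form a Poisson process with intensity
  \<open>\<mu>~\<close> restricted to \<open>{f. f (t k) < h (t k) for k < i}\<close>. So the conditional probability that the final
  result is bounded by \<open>x\<close> should be \<open>exp (- \<mu>~ (B \<inter> {f. f (t k) < h (t k) for k < i}))\<close> if the functions
  found so far are bounded by \<open>x\<close>, and zero otherwise. In step 2, every measure \<open>\<mu>_j\<close> still to be
  simulated contributes a factor \<open>exp (- \<mu>_j B)\<close>. This potential has constant expectation along the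
  run. The key point is that the highest level reached by the simulated functions outside \<open>B\<close> is
  independent of those in \<open>B\<close>. Initially the potential is \<open>exp (- \<mu> B)\<close>, which is the value of the
  distribution function of the process at \<open>x\<close>, and finally it is the indicator of the event that the
  result is bounded by \<open>x\<close>. Termination follows from the same identity: a run that searches forever at
  index \<open>i\<close> would keep the potential away from zero, whereas its expectation vanishes as \<open>x i\<close> tends to
  zero.\<close>

section \<open>Monotone classes\<close>

text \<open>The obstacle is that intensities depend on the past, and so do the sets to be avoided:
  they involve the current maximum and, within one step, the random level of the functions outside
  \<open>B\<close>. Only the probabilities of avoiding fixed sets are given. They extend to random
  sets by monotone limits, since a finite point set eventually cannot distinguish a set from the
  monotone sequence approaching it; complements and disjoint unions would not preserve such
  statements, hence monotone classes. Independence is never assumed as such: avoiding two disjoint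
  sets means avoiding their union, and \<open>exp\<close> turns the sum of the masses into a
  product. The potential has two families of thresholds, \<open>y\<close> for step 2 and
  \<open>z\<close> for step 3. For termination \<open>z\<close> must be small at the searched point
  while \<open>y\<close> stays large, because functions from step 2 may be large there and would
  make a potential with common thresholds vanish. Conservation then weakens to a decrease, as the
  final result is compared with both families at once; this is enough for termination.\<close>

inductive_set monotone_class :: "'a set set \<Rightarrow> 'a set set" for A :: "'a set set" where
  base: "a \<in> A \<Longrightarrow> a \<in> monotone_class A"
| inc: "incseq E \<Longrightarrow> (\<And>n::nat. E n \<in> monotone_class A) \<Longrightarrow> (\<Union>n. E n) \<in> monotone_class A"
| dec: "decseq E \<Longrightarrow> (\<And>n::nat. E n \<in> monotone_class A) \<Longrightarrow> (\<Inter>n. E n) \<in> monotone_class A"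

lemma monotone_class_compl:
  assumes "algebra \<Omega> A" "D \<in> monotone_class A"
  shows "\<Omega> - D \<in> monotone_class A"
  using assms(2)
proof induction
  case (base a)
  then show ?case by (meson assms(1) algebra.compl_sets monotone_class.base)
next
  case (inc E)
  have "(\<Inter>n. \<Omega> - E n) \<in> monotone_class A"
    using inc by (intro monotone_class.dec) (auto simp: decseq_def incseq_def)
  then show ?case by simp
next
  case (dec E)
  have "(\<Union>n. \<Omega> - E n) \<in> monotone_class A"
    using dec by (intro monotone_class.inc) (auto simp: decseq_def incseq_def)
  moreover have "(\<Union>n. \<Omega> - E n) = \<Omega> - (\<Inter>n. E n)" by auto
  ultimately show ?case by simp
qed

text \<open>For fixed \<open>B\<close> the sets \<open>D\<close> with \<open>D \<inter> B\<close> in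
  the class are closed under monotone limits, so it is enough to let \<open>D\<close> range over
  \<open>A\<close>. The first round takes \<open>B\<close> in \<open>A\<close>, the second an
  arbitrary \<open>B\<close>, whose intersections with members of \<open>A\<close> are known from
  the first.\<close>

lemma monotone_class_Int:
  assumes "algebra \<Omega> A" "D \<in> monotone_class A" "B \<in> monotone_class A"
  shows "D \<inter> B \<in> monotone_class A"
proof -
  have step: "D \<inter> B \<in> monotone_class A"
    if "D \<in> monotone_class A" "\<And>a. a \<in> A \<Longrightarrow> a \<inter> B \<in> monotone_class A" for D B
    using that(1)
  proof induction
    case (base a)
    then show ?case by (rule that(2))
  next
    case (inc E)
    have "(\<Union>n. E n \<inter> B) \<in> monotone_class A"
      using inc by (intro monotone_class.inc) (auto simp: incseq_def)
    then show ?case by (simp add: Int_UN_distrib2)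
  next
    case (dec E)
    have "(\<Inter>n. E n \<inter> B) \<in> monotone_class A"
      using dec by (intro monotone_class.dec) (auto simp: decseq_def)
    then show ?case by simp
  qed
  have "a \<inter> B \<in> monotone_class A" if "a \<in> A" for a
  proof -
    have "B \<inter> a \<in> monotone_class A"
      using assms(3)
    proof (rule step)
      fix b assume "b \<in> A"
      then show "b \<inter> a \<in> monotone_class A"
        by (meson that assms(1) algebra_iff_Int monotone_class.base)
    qed
    then show ?thesis by (simp add: Int_commute)
  qed
  with assms(2) show ?thesis by (rule step)
qed

lemma sigma_sets_subset_monotone_class:
  assumes A: "algebra \<Omega> A"
  shows "sigma_sets \<Omega> A \<subseteq> monotone_class A"
proof
  fix D assume "D \<in> sigma_sets \<Omega> A"
  then show "D \<in> monotone_class A"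
  proof induction
    case (Basic a)
    then show ?case by (rule monotone_class.base)
  next
    case Empty
    then show ?case using A by (auto simp: algebra_iff_Int intro: monotone_class.base)
  next
    case (Compl a)
    then show ?case by (simp add: monotone_class_compl[OF A])
  next
    case (Union a)
    have sub: "a i \<subseteq> \<Omega>" for i
      using sigma_sets_into_sp[OF _ Union.hyps[of i]] A by (simp add: algebra_iff_Int)
    have fin: "(\<Union>i\<le>n. a i) \<in> monotone_class A" for n :: nat
    proof (induction n)
      case 0
      then show ?case using Union.IH by simp
    next
      case (Suc n)
      have "\<Omega> - ((\<Omega> - (\<Union>i\<le>n. a i)) \<inter> (\<Omega> - a (Suc n))) \<in> monotone_class A"
        using Suc Union.IH by (intro monotone_class_compl[OF A] monotone_class_Int[OF A])
      also have "\<Omega> - ((\<Omega> - (\<Union>i\<le>n. a i)) \<inter> (\<Omega> - a (Suc n))) = (\<Union>i\<le>Suc n. a i)"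
        using sub by (auto simp: atMost_Suc)
      finally show ?case .
    qed
    have "(\<Union>n. \<Union>i\<le>n. a i) \<in> monotone_class A"
      by (intro monotone_class.inc fin) (fastforce simp: incseq_def)
    also have "(\<Union>n. \<Union>i\<le>n. a i) = (\<Union>i. a i)"
      by auto
    finally show ?case .
  qed
qed

text \<open>Finite unions of rectangles would be the usual algebra. Letting an observable natural
  number select the section makes the algebra property a pointwise computation, and avoidance
  transfers from fixed sets by splitting according to the value of \<open>Y\<close>.\<close>

definition countable_sections :: "'w measure \<Rightarrow> 'b measure \<Rightarrow> ('w \<times> 'b) set set" where
  "countable_sections F S = {{(w, f). w \<in> space F \<and> f \<in> A (Y w)} |A Y.
     Y \<in> measurable F (count_space UNIV) \<and> (\<forall>n::nat. A n \<in> sets S)}"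

lemma countable_sections_measurable:
  assumes "Y \<in> measurable F (count_space UNIV)" "\<And>n::nat. A n \<in> sets S"
  shows "{(w, f). w \<in> space F \<and> f \<in> A (Y w)} \<in> sets (F \<Otimes>\<^sub>M S)"
proof -
  have "(\<Union>n. (Y -` {n} \<inter> space F) \<times> A n) \<in> sets (F \<Otimes>\<^sub>M S)"
    using assms by (intro sets.countable_UN) (auto intro!: pair_measureI measurable_sets)
  also have "(\<Union>n. (Y -` {n} \<inter> space F) \<times> A n) = {(w, f). w \<in> space F \<and> f \<in> A (Y w)}"
    by auto
  finally show ?thesis .
qed

lemma algebra_countable_sections: "algebra (space F \<times> space S) (countable_sections F S)"
  unfolding algebra_iff_Int
proof (intro conjI ballI)
  show "countable_sections F S \<subseteq> Pow (space F \<times> space S)"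
    by (fastforce simp: countable_sections_def dest: sets.sets_into_space)
  show "{} \<in> countable_sections F S"
    unfolding countable_sections_def
    by (intro CollectI exI[of _ "\<lambda>_. {}"] exI[of _ "\<lambda>_. 0"]) auto
next
  fix a assume "a \<in> countable_sections F S"
  then obtain A Y where a: "a = {(w, f). w \<in> space F \<and> f \<in> A (Y w)}"
    and Y: "Y \<in> measurable F (count_space UNIV)" and A: "\<And>n::nat. A n \<in> sets S"
    by (auto simp: countable_sections_def)
  show "space F \<times> space S - a \<in> countable_sections F S"
    unfolding countable_sections_def a using Y A
    by (intro CollectI exI[of _ "\<lambda>n. space S - A n"] exI[of _ Y]) auto
next
  fix a b assume "a \<in> countable_sections F S" "b \<in> countable_sections F S"
  then obtain A Y B Z where a: "a = {(w, f). w \<in> space F \<and> f \<in> A (Y w)}"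
    and b: "b = {(w, f). w \<in> space F \<and> f \<in> B (Z w)}"
    and Y: "Y \<in> measurable F (count_space UNIV)" and A: "\<And>n::nat. A n \<in> sets S"
    and Z: "Z \<in> measurable F (count_space UNIV)" and B: "\<And>n::nat. B n \<in> sets S"
    by (auto simp: countable_sections_def)
  note [measurable] = Y Z
  have "(\<lambda>w. prod_encode (Y w, Z w)) \<in> measurable F (count_space UNIV)"
    by measurable
  then show "a \<inter> b \<in> countable_sections F S"
    unfolding countable_sections_def a b using A B
    by (intro CollectI exI[of _ "\<lambda>n. A (fst (prod_decode n)) \<inter> B (snd (prod_decode n))"]
        exI[of _ "\<lambda>w. prod_encode (Y w, Z w)"]) auto
qed

text \<open>Unlike in \<pi>-\<lambda> induction there is no case for complements or disjoint unions,
  as avoiding a set says nothing about avoiding its complement. The price is the richer base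
  case.\<close>

lemma sets_pair_monotone_induct [consumes 1, case_names countable inc dec]:
  assumes D: "D \<in> sets (F \<Otimes>\<^sub>M S)"
    and countable: "\<And>A Y. Y \<in> measurable F (count_space UNIV) \<Longrightarrow> (\<And>n::nat. A n \<in> sets S) \<Longrightarrow>
      Q {(w, f). w \<in> space F \<and> f \<in> A (Y w)}"
    and inc: "\<And>E. incseq E \<Longrightarrow> (\<And>n::nat. E n \<in> sets (F \<Otimes>\<^sub>M S)) \<Longrightarrow> (\<And>n. Q (E n)) \<Longrightarrow> Q (\<Union>n. E n)"
    and dec: "\<And>E. decseq E \<Longrightarrow> (\<And>n::nat. E n \<in> sets (F \<Otimes>\<^sub>M S)) \<Longrightarrow> (\<And>n. Q (E n)) \<Longrightarrow> Q (\<Inter>n. E n)"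
  shows "Q D"
proof -
  have "{a \<times> b |a b. a \<in> sets F \<and> b \<in> sets S} \<subseteq> countable_sections F S"
  proof safe
    fix a b assume ab: "a \<in> sets F" "b \<in> sets S"
    define Y :: "_ \<Rightarrow> nat" where "Y w = (if w \<in> a then 0 else 1)" for w
    have "Y \<in> measurable F (count_space UNIV)"
      unfolding Y_def using ab(1) by (intro measurable_If_set) (auto simp: sets.Int_space_eq2)
    moreover have "a \<times> b = {(w, f). w \<in> space F \<and> f \<in> (if Y w = 0 then b else {})}"
      using sets.sets_into_space[OF ab(1)] by (auto simp: Y_def split: if_splits)
    ultimately show "a \<times> b \<in> countable_sections F S"
      unfolding countable_sections_def using ab(2)
      by (intro CollectI exI[of _ "\<lambda>n. if n = 0 then b else {}"] exI[of _ Y]) auto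
  qed
  then have "sets (F \<Otimes>\<^sub>M S) \<subseteq> sigma_sets (space F \<times> space S) (countable_sections F S)"
    unfolding sets_pair_measure by (rule sigma_sets_mono')
  with D have "D \<in> monotone_class (countable_sections F S)"
    using sigma_sets_subset_monotone_class[OF algebra_countable_sections] by blast
  then have "D \<in> sets (F \<Otimes>\<^sub>M S) \<and> Q D"
  proof induction
    case (base a)
    then show ?case
      by (auto simp: countable_sections_def intro: countable countable_sections_measurable)
  next
    case (inc E)
    then show ?case using assms(3)[of E] by auto
  next
    case (dec E)
    then show ?case using assms(4)[of E] by auto
  qed
  then show ?thesis ..
qed

section \<open>Random finite sets\<close>

text \<open>No \<sigma>-algebra on finite sets is introduced: the events of missing a fixed
  measurable set carry all measurability. Finiteness holds at every sample point, so that limits can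
  be taken pointwise.\<close>

locale random_finite_set =
  fixes F :: "'w measure" and S :: "'b measure" and Z :: "'w \<Rightarrow> 'b set"
  assumes finite_points: "w \<in> space F \<Longrightarrow> finite (Z w)"
    and points_in_space: "w \<in> space F \<Longrightarrow> Z w \<subseteq> space S"
    and avoid_fixed: "A \<in> sets S \<Longrightarrow> {w \<in> space F. Z w \<inter> A = {}} \<in> sets F"
begin

lemma eventually_avoid_incseq:
  assumes "w \<in> space F" "incseq E"
  shows "\<forall>\<^sub>F n :: nat in sequentially. (\<forall>f\<in>Z w. (w, f) \<notin> E n) \<longleftrightarrow> (\<forall>f\<in>Z w. (w, f) \<notin> (\<Union>n. E n))"
proof -
  have "\<forall>\<^sub>F n in sequentially. (w, f) \<in> E n \<longleftrightarrow> (w, f) \<in> (\<Union>n. E n)" for f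
  proof (cases "(w, f) \<in> (\<Union>n. E n)")
    case True
    then obtain n where "(w, f) \<in> E n" by blast
    then show ?thesis
      using assms(2) True by (auto simp: eventually_sequentially incseq_def intro!: exI[of _ n])
  qed auto
  then have "\<forall>\<^sub>F n in sequentially. \<forall>f\<in>Z w. (w, f) \<in> E n \<longleftrightarrow> (w, f) \<in> (\<Union>n. E n)"
    using finite_points[OF assms(1)] by (simp add: eventually_ball_finite)
  then show ?thesis by (rule eventually_mono) blast
qed

text \<open>A point outside the intersection has left the decreasing sets from some index on, and
  finitely many points have a common such index. Infinitely many points could leave one by one
  without any of the sets being avoided.\<close>

lemma eventually_avoid_decseq:
  assumes "w \<in> space F" "decseq E"
  shows "\<forall>\<^sub>F n :: nat in sequentially. (\<forall>f\<in>Z w. (w, f) \<notin> E n) \<longleftrightarrow> (\<forall>f\<in>Z w. (w, f) \<notin> (\<Inter>n. E n))"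
proof -
  have "\<forall>\<^sub>F n in sequentially. (w, f) \<in> E n \<longleftrightarrow> (w, f) \<in> (\<Inter>n. E n)" for f
  proof (cases "(w, f) \<in> (\<Inter>n. E n)")
    case False
    then obtain n where "(w, f) \<notin> E n" by blast
    then show ?thesis
      using assms(2) False by (auto simp: eventually_sequentially decseq_def intro!: exI[of _ n])
  qed auto
  then have "\<forall>\<^sub>F n in sequentially. \<forall>f\<in>Z w. (w, f) \<in> E n \<longleftrightarrow> (w, f) \<in> (\<Inter>n. E n)"
    using finite_points[OF assms(1)] by (simp add: eventually_ball_finite)
  then show ?thesis by (rule eventually_mono) blast
qed

text \<open>The set to be missed may now depend on the sample point. Increasing sets lead to a
  countable intersection of avoidance events, decreasing ones, by finiteness of the point set, to a
  countable union.\<close>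

lemma sets_avoid:
  assumes "D \<in> sets (F \<Otimes>\<^sub>M S)"
  shows "{w \<in> space F. \<forall>f\<in>Z w. (w, f) \<notin> D} \<in> sets F"
  using assms
proof (induction rule: sets_pair_monotone_induct)
  case (countable A Y)
  have "(\<Union>n. Y -` {n} \<inter> space F \<inter> {w \<in> space F. Z w \<inter> A n = {}}) \<in> sets F"
    using measurable_sets[OF countable(1)] avoid_fixed[OF countable(2)]
    by (intro sets.countable_UN image_subsetI sets.Int[of "Y -` _ \<inter> space F"]) auto
  also have "(\<Union>n. Y -` {n} \<inter> space F \<inter> {w \<in> space F. Z w \<inter> A n = {}}) =
      {w \<in> space F. \<forall>f\<in>Z w. (w, f) \<notin> {(w, f). w \<in> space F \<and> f \<in> A (Y w)}}"
    by auto
  finally show ?case .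
next
  case (inc E)
  have "(\<Inter>n. {w \<in> space F. \<forall>f\<in>Z w. (w, f) \<notin> E n}) \<in> sets F"
    using inc by (intro sets.countable_INT) auto
  also have "(\<Inter>n. {w \<in> space F. \<forall>f\<in>Z w. (w, f) \<notin> E n}) = {w \<in> space F. \<forall>f\<in>Z w. (w, f) \<notin> (\<Union>n. E n)}"
    by auto
  finally show ?case .
next
  case (dec E)
  have "(\<Union>n. {w \<in> space F. \<forall>f\<in>Z w. (w, f) \<notin> E n}) \<in> sets F"
    using dec by (intro sets.countable_UN) auto
  also have "(\<Union>n. {w \<in> space F. \<forall>f\<in>Z w. (w, f) \<notin> E n}) = {w \<in> space F. \<forall>f\<in>Z w. (w, f) \<notin> (\<Inter>n. E n)}"
  proof safe
    fix w assume "w \<in> space F" "\<forall>f\<in>Z w. (w, f) \<notin> (\<Inter>n. E n)"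
    then obtain n where "\<forall>f\<in>Z w. (w, f) \<notin> E n"
      using eventually_avoid_decseq[OF _ dec(1), of w] by (auto simp: eventually_sequentially)
    then show "w \<in> (\<Union>n. {w \<in> space F. \<forall>f\<in>Z w. (w, f) \<notin> E n})"
      using \<open>w \<in> space F\<close> by auto
  qed auto
  finally show ?case .
qed

lemma pred_avoid:
  assumes "Measurable.pred (F \<Otimes>\<^sub>M S) (\<lambda>p. D (fst p) (snd p))"
  shows "Measurable.pred F (\<lambda>w. \<forall>f\<in>Z w. \<not> D w f)"
proof -
  have "{w \<in> space F. \<forall>f\<in>Z w. (w, f) \<notin> {p \<in> space (F \<Otimes>\<^sub>M S). D (fst p) (snd p)}} \<in> sets F"
    using assms by (intro sets_avoid) measurable
  also have "{w \<in> space F. \<forall>f\<in>Z w. (w, f) \<notin> {p \<in> space (F \<Otimes>\<^sub>M S). D (fst p) (snd p)}} =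
      {w \<in> space F. \<forall>f\<in>Z w. \<not> D w f}"
    using points_in_space by (auto simp: space_pair_measure)
  finally show ?thesis by (simp add: pred_def)
qed

text \<open>The maximum is below \<open>a\<close> iff the base value is and no point reaches
  \<open>a\<close>, which is the avoidance of a set depending on \<open>w\<close>. The base value
  keeps the maximum defined when no point qualifies.\<close>

lemma borel_measurable_Max:
  fixes g :: "'b \<Rightarrow> real"
  assumes b[measurable]: "b \<in> borel_measurable F" and g[measurable]: "g \<in> borel_measurable S"
    and D[measurable]: "Measurable.pred (F \<Otimes>\<^sub>M S) (\<lambda>p. D (fst p) (snd p))"
  shows "(\<lambda>w. Max (insert (b w) (g ` {f \<in> Z w. D w f}))) \<in> borel_measurable F"
  unfolding borel_measurable_iff_less
proof
  fix a
  have *: "Measurable.pred F (\<lambda>w. \<forall>f\<in>Z w. \<not> (D w f \<and> a \<le> g f))"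
    by (rule pred_avoid) measurable
  have "{w \<in> space F. b w < a \<and> (\<forall>f\<in>Z w. \<not> (D w f \<and> a \<le> g f))} \<in> sets F"
    using * by measurable
  also have "{w \<in> space F. b w < a \<and> (\<forall>f\<in>Z w. \<not> (D w f \<and> a \<le> g f))} =
      {w \<in> space F. Max (insert (b w) (g ` {f \<in> Z w. D w f})) < a}"
    using finite_points by (intro Collect_cong conj_cong refl) (auto simp: not_le)
  finally show "{w \<in> space F. Max (insert (b w) (g ` {f \<in> Z w. D w f})) < a} \<in> sets F" .
qed

end

section \<open>Sections of product sets under random measures\<close>

lemma tendsto_measure_section_incseq:
  assumes "finite_measure M" and M: "sets M = sets S"
    and E: "incseq E" "\<And>n::nat. E n \<in> sets (F \<Otimes>\<^sub>M S)"
  shows "(\<lambda>n. measure M (Pair w -` E n)) \<longlonglongrightarrow> measure M (Pair w -` (\<Union>n. E n))"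
proof -
  have "range (\<lambda>n. Pair w -` E n) \<subseteq> sets M"
    unfolding M using sets_Pair1[OF E(2)] by blast
  moreover have "incseq (\<lambda>n. Pair w -` E n)"
    using E(1) unfolding incseq_def by blast
  ultimately have "(\<lambda>n. measure M (Pair w -` E n)) \<longlonglongrightarrow> measure M (\<Union>n. Pair w -` E n)"
    by (rule finite_measure.finite_Lim_measure_incseq[OF assms(1)])
  then show ?thesis unfolding vimage_UN .
qed

lemma tendsto_measure_section_decseq:
  assumes "finite_measure M" and M: "sets M = sets S"
    and E: "decseq E" "\<And>n::nat. E n \<in> sets (F \<Otimes>\<^sub>M S)"
  shows "(\<lambda>n. measure M (Pair w -` E n)) \<longlonglongrightarrow> measure M (Pair w -` (\<Inter>n. E n))"
proof -
  have "range (\<lambda>n. Pair w -` E n) \<subseteq> sets M"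
    unfolding M using sets_Pair1[OF E(2)] by blast
  moreover have "decseq (\<lambda>n. Pair w -` E n)"
    using E(1) unfolding decseq_def by blast
  ultimately have "(\<lambda>n. measure M (Pair w -` E n)) \<longlonglongrightarrow> measure M (\<Inter>n. Pair w -` E n)"
    by (rule finite_measure.finite_Lim_measure_decseq[OF assms(1)])
  moreover have "(\<Inter>n. Pair w -` E n) = Pair w -` (\<Inter>n. E n)" by blast
  ultimately show ?thesis by simp
qed

text \<open>Measurability of the random measure is only given on fixed sets. For sections selected
  by a countable index it follows by composition, and continuity of finite measures along monotone
  sequences does the rest.\<close>

lemma borel_measurable_measure_kernel:
  assumes D: "D \<in> sets (F \<Otimes>\<^sub>M S)"
    and fin: "\<And>w. w \<in> space F \<Longrightarrow> finite_measure (\<nu> w)"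
    and sets: "\<And>w. w \<in> space F \<Longrightarrow> sets (\<nu> w) = sets S"
    and meas: "\<And>A. A \<in> sets S \<Longrightarrow> (\<lambda>w. measure (\<nu> w) A) \<in> borel_measurable F"
  shows "(\<lambda>w. measure (\<nu> w) (Pair w -` D)) \<in> borel_measurable F"
  using D
proof (induction rule: sets_pair_monotone_induct)
  case (countable A Y)
  have "(\<lambda>w. measure (\<nu> w) (A (Y w))) \<in> borel_measurable F"
    using meas[OF countable(2)] countable(1) by (rule measurable_compose_countable)
  moreover have "measure (\<nu> w) (A (Y w)) = measure (\<nu> w) (Pair w -` {(w, f). w \<in> space F \<and> f \<in> A (Y w)})"
    if "w \<in> space F" for w
    using that by (intro arg_cong2[where f = measure]) auto
  ultimately show ?case by (rule measurable_cong[THEN iffD1, rotated])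
next
  case (inc E)
  show ?case
  proof (rule borel_measurable_LIMSEQ_real)
    fix w assume w: "w \<in> space F"
    show "(\<lambda>n. measure (\<nu> w) (Pair w -` E n)) \<longlonglongrightarrow> measure (\<nu> w) (Pair w -` (\<Union>n. E n))"
      by (rule tendsto_measure_section_incseq[OF fin[OF w] sets[OF w] inc(1,2)])
  qed (rule inc(3))
next
  case (dec E)
  show ?case
  proof (rule borel_measurable_LIMSEQ_real)
    fix w assume w: "w \<in> space F"
    show "(\<lambda>n. measure (\<nu> w) (Pair w -` E n)) \<longlonglongrightarrow> measure (\<nu> w) (Pair w -` (\<Inter>n. E n))"
      by (rule tendsto_measure_section_decseq[OF fin[OF w] sets[OF w] dec(1,2)])
  qed (rule dec(3))
qed

text \<open>Conditionally on the sub-\<open>\<sigma>\<close>-algebra \<open>F\<close> and on the event \<open>H\<close>, the random set \<open>Z\<close> has the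
  avoidance probabilities of a Poisson process with intensity \<open>\<nu>\<close>. Since two disjoint sets are avoided
  iff their union is, this already contains all the independence that is needed.\<close>

locale poisson_avoidance = prob_space P + random_finite_set P S Z
  for P :: "'w measure" and S :: "'b measure" and Z +
  fixes F :: "'w measure" and H :: "'w set" and \<nu> :: "'w \<Rightarrow> 'b measure"
  assumes sub: "subalgebra P F" and H: "H \<in> sets F"
    and intensity_finite: "w \<in> space P \<Longrightarrow> finite_measure (\<nu> w)"
    and sets_intensity: "w \<in> space P \<Longrightarrow> sets (\<nu> w) = sets S"
    and intensity_measurable: "A \<in> sets S \<Longrightarrow> (\<lambda>w. measure (\<nu> w) A) \<in> borel_measurable F"
    and avoidance: "A \<in> sets S \<Longrightarrow> K \<in> sets F \<Longrightarrow> K \<subseteq> H \<Longrightarrow>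
      emeasure P {w \<in> K. Z w \<inter> A = {}} = (\<integral>\<^sup>+w\<in>K. ennreal (exp (- measure (\<nu> w) A)) \<partial>P)"
begin

lemma space_F: "space F = space P"
  using sub by (simp add: subalgebra_def)

lemma sets_F: "K \<in> sets F \<Longrightarrow> K \<in> sets P"
  using sub by (auto simp: subalgebra_def)

lemma measurable_F: "f \<in> measurable F N \<Longrightarrow> f \<in> measurable P N"
  using sub by (rule measurable_from_subalg)

lemma sets_pair_F: "D \<in> sets (F \<Otimes>\<^sub>M S) \<Longrightarrow> D \<in> sets (P \<Otimes>\<^sub>M S)"
proof -
  have "sets (F \<Otimes>\<^sub>M S) \<subseteq> sets (P \<Otimes>\<^sub>M S)"
    unfolding sets_pair_measure space_F
    by (rule sigma_sets_mono') (auto dest: sets_F)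
  then show "D \<in> sets (F \<Otimes>\<^sub>M S) \<Longrightarrow> D \<in> sets (P \<Otimes>\<^sub>M S)" by blast
qed

lemma section_measurable:
  "D \<in> sets (F \<Otimes>\<^sub>M S) \<Longrightarrow> (\<lambda>w. measure (\<nu> w) (Pair w -` D)) \<in> borel_measurable F"
  by (rule borel_measurable_measure_kernel[OF _ intensity_finite sets_intensity intensity_measurable])
    (simp_all add: space_F)

lemma avoidance_limit:
  fixes E :: "nat \<Rightarrow> ('w \<times> 'b) set"
  assumes K: "K \<in> sets F" and E: "\<And>n. E n \<in> sets (F \<Otimes>\<^sub>M S)" and D: "D \<in> sets (F \<Otimes>\<^sub>M S)"
    and avoid: "\<And>n. emeasure P {w \<in> K. \<forall>f\<in>Z w. (w, f) \<notin> E n} =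
      (\<integral>\<^sup>+w\<in>K. ennreal (exp (- measure (\<nu> w) (Pair w -` E n))) \<partial>P)"
    and lim_set: "\<And>w. w \<in> space P \<Longrightarrow>
      \<forall>\<^sub>F n in sequentially. (\<forall>f\<in>Z w. (w, f) \<notin> E n) \<longleftrightarrow> (\<forall>f\<in>Z w. (w, f) \<notin> D)"
    and lim_measure: "\<And>w. w \<in> space P \<Longrightarrow>
      (\<lambda>n. measure (\<nu> w) (Pair w -` E n)) \<longlonglongrightarrow> measure (\<nu> w) (Pair w -` D)"
  shows "emeasure P {w \<in> K. \<forall>f\<in>Z w. (w, f) \<notin> D} =
      (\<integral>\<^sup>+w\<in>K. ennreal (exp (- measure (\<nu> w) (Pair w -` D))) \<partial>P)"
proof -
  have KP: "K \<in> sets P" using K by (rule sets_F)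
  define V where "V D = {w \<in> K. \<forall>f\<in>Z w. (w, f) \<notin> D}" for D :: "('w \<times> 'b) set"
  have V_sets: "V D \<in> sets P" if "D \<in> sets (F \<Otimes>\<^sub>M S)" for D
  proof -
    have "V D = K \<inter> {w \<in> space P. \<forall>f\<in>Z w. (w, f) \<notin> D}"
      using sets.sets_into_space[OF KP] by (auto simp: V_def)
    then show ?thesis using KP sets_avoid[OF sets_pair_F[OF that]] by simp
  qed
  have "(\<lambda>n. \<integral>\<^sup>+w. indicator (V (E n)) w \<partial>P) \<longlonglongrightarrow> (\<integral>\<^sup>+w. indicator (V D) w \<partial>P)"
  proof (rule nn_integral_dominated_convergence[where w = "\<lambda>_. 1"])
    show "AE w in P. (\<lambda>n. indicator (V (E n)) w :: ennreal) \<longlonglongrightarrow> indicator (V D) w"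
    proof (rule AE_I2)
      fix w assume "w \<in> space P"
      show "(\<lambda>n. indicator (V (E n)) w :: ennreal) \<longlonglongrightarrow> indicator (V D) w"
        using lim_set[OF \<open>w \<in> space P\<close>]
        by (intro tendsto_eventually) (auto elim!: eventually_mono simp: V_def indicator_def)
    qed
  qed (auto simp: emeasure_space_1 intro!: borel_measurable_indicator V_sets E D split: split_indicator)
  moreover have "(\<lambda>n. \<integral>\<^sup>+w\<in>K. ennreal (exp (- measure (\<nu> w) (Pair w -` E n))) \<partial>P) \<longlonglongrightarrow>
      (\<integral>\<^sup>+w\<in>K. ennreal (exp (- measure (\<nu> w) (Pair w -` D))) \<partial>P)"
  proof (rule nn_integral_dominated_convergence[where w = "\<lambda>_. 1"])
    have *: "(\<lambda>w. ennreal (exp (- measure (\<nu> w) (Pair w -` D)))) \<in> borel_measurable P"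
      if "D \<in> sets (F \<Otimes>\<^sub>M S)" for D
      using measurable_F[OF section_measurable[OF that]] by measurable
    show "(\<lambda>w. ennreal (exp (- measure (\<nu> w) (Pair w -` E n))) * indicator K w) \<in> borel_measurable P" for n
      using *[OF E] KP by measurable
    show "(\<lambda>w. ennreal (exp (- measure (\<nu> w) (Pair w -` D))) * indicator K w) \<in> borel_measurable P"
      using *[OF D] KP by measurable
    show "AE w in P. (\<lambda>n. ennreal (exp (- measure (\<nu> w) (Pair w -` E n))) * indicator K w) \<longlonglongrightarrow>
        ennreal (exp (- measure (\<nu> w) (Pair w -` D))) * indicator K w"
    proof (rule AE_I2)
      fix w assume "w \<in> space P"
      then have "(\<lambda>n. ennreal (exp (- measure (\<nu> w) (Pair w -` E n)))) \<longlonglongrightarrow>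
          ennreal (exp (- measure (\<nu> w) (Pair w -` D)))"
        by (intro tendsto_ennrealI tendsto_exp tendsto_minus lim_measure)
      then show "(\<lambda>n. ennreal (exp (- measure (\<nu> w) (Pair w -` E n))) * indicator K w) \<longlonglongrightarrow>
          ennreal (exp (- measure (\<nu> w) (Pair w -` D))) * indicator K w"
        by (cases "w \<in> K") simp_all
    qed
    show "(\<integral>\<^sup>+w. 1 \<partial>P) < \<infinity>" by (simp add: emeasure_space_1)
  qed (auto split: split_indicator)
  moreover have "(\<integral>\<^sup>+w. indicator (V (E n)) w \<partial>P) =
      (\<integral>\<^sup>+w\<in>K. ennreal (exp (- measure (\<nu> w) (Pair w -` E n))) \<partial>P)" for n
    using avoid[of n] V_sets[OF E] by (simp add: V_def)
  ultimately have "(\<integral>\<^sup>+w. indicator (V D) w \<partial>P) =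
      (\<integral>\<^sup>+w\<in>K. ennreal (exp (- measure (\<nu> w) (Pair w -` D))) \<partial>P)"
    by (auto intro: LIMSEQ_unique)
  then show ?thesis
    using V_sets[OF D] by (simp add: V_def)
qed

text \<open>Here it matters that the avoidance probabilities are given on every \<open>K\<close>
  below \<open>H\<close>: if the section takes countably many values, \<open>K\<close> is cut into
  the pieces on which it is constant, and each piece only sees a fixed set.\<close>

lemma avoidance_section:
  assumes D: "D \<in> sets (F \<Otimes>\<^sub>M S)" and K: "K \<in> sets F" "K \<subseteq> H"
  shows "emeasure P {w \<in> K. \<forall>f\<in>Z w. (w, f) \<notin> D} =
      (\<integral>\<^sup>+w\<in>K. ennreal (exp (- measure (\<nu> w) (Pair w -` D))) \<partial>P)"
  using D
proof (induction rule: sets_pair_monotone_induct)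
  case (countable A Y)
  let ?D = "{(w, f). w \<in> space F \<and> f \<in> A (Y w)}"
  have Ksp: "K \<subseteq> space P" using K(1) sets.sets_into_space space_F by blast
  define Kn where "Kn n = K \<inter> (Y -` {n} \<inter> space F)" for n
  have Kn: "Kn n \<in> sets F" for n
    unfolding Kn_def using K countable(1) by (intro sets.Int measurable_sets) auto
  have UKn: "(\<Union>n. Kn n) = K" using Ksp by (auto simp: Kn_def space_F)
  have dis: "disjoint_family Kn" by (auto simp: disjoint_family_on_def Kn_def)
  then have dis2: "disjoint_family (\<lambda>n. {w \<in> Kn n. Z w \<inter> A n = {}})"
    unfolding disjoint_family_on_def by blast
  have sets: "{w \<in> Kn n. Z w \<inter> A n = {}} \<in> sets P" for n
  proof -
    have "{w \<in> Kn n. Z w \<inter> A n = {}} = Kn n \<inter> {w \<in> space P. Z w \<inter> A n = {}}"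
      using Ksp by (auto simp: Kn_def)
    then show ?thesis using avoid_fixed[OF countable(2)] sets_F[OF Kn] by simp
  qed
  have "{w \<in> K. \<forall>f\<in>Z w. (w, f) \<notin> ?D} = (\<Union>n. {w \<in> Kn n. Z w \<inter> A n = {}})"
    using Ksp by (auto simp: Kn_def space_F)
  then have "emeasure P {w \<in> K. \<forall>f\<in>Z w. (w, f) \<notin> ?D} = (\<Sum>n. emeasure P {w \<in> Kn n. Z w \<inter> A n = {}})"
    using sets dis2 by (subst suminf_emeasure) auto
  also have "\<dots> = (\<Sum>n. \<integral>\<^sup>+w\<in>Kn n. ennreal (exp (- measure (\<nu> w) (Pair w -` ?D))) \<partial>P)"
  proof (rule suminf_cong)
    fix n
    have "emeasure P {w \<in> Kn n. Z w \<inter> A n = {}} = (\<integral>\<^sup>+w\<in>Kn n. ennreal (exp (- measure (\<nu> w) (A n))) \<partial>P)"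
      using countable(2) Kn K(2) by (intro avoidance) (auto simp: Kn_def)
    also have "\<dots> = (\<integral>\<^sup>+w\<in>Kn n. ennreal (exp (- measure (\<nu> w) (Pair w -` ?D))) \<partial>P)"
      by (intro nn_integral_cong)
        (auto simp: Kn_def vimage_def split: split_indicator intro!: arg_cong2[where f = measure])
    finally show "emeasure P {w \<in> Kn n. Z w \<inter> A n = {}} =
      (\<integral>\<^sup>+w\<in>Kn n. ennreal (exp (- measure (\<nu> w) (Pair w -` ?D))) \<partial>P)" .
  qed
  also have "\<dots> = (\<integral>\<^sup>+w\<in>(\<Union>n. Kn n). ennreal (exp (- measure (\<nu> w) (Pair w -` ?D))) \<partial>P)"
  proof (rule nn_integral_disjoint_family[symmetric])
    show "(\<lambda>w. ennreal (exp (- measure (\<nu> w) (Pair w -` ?D)))) \<in> borel_measurable P"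
      using measurable_F[OF section_measurable[OF countable_sections_measurable[OF countable]]]
      by measurable
  qed (use Kn sets_F dis in auto)
  finally show ?case unfolding UKn .
next
  case (inc E)
  show ?case
  proof (rule avoidance_limit[OF K(1) inc(2) _ inc(3)])
    fix w assume w: "w \<in> space P"
    show "(\<lambda>n. measure (\<nu> w) (Pair w -` E n)) \<longlonglongrightarrow> measure (\<nu> w) (Pair w -` (\<Union>n. E n))"
      by (rule tendsto_measure_section_incseq[OF intensity_finite[OF w] sets_intensity[OF w] inc(1,2)])
  qed (use inc eventually_avoid_incseq in auto)
next
  case (dec E)
  show ?case
  proof (rule avoidance_limit[OF K(1) dec(2) _ dec(3)])
    fix w assume w: "w \<in> space P"
    show "(\<lambda>n. measure (\<nu> w) (Pair w -` E n)) \<longlonglongrightarrow> measure (\<nu> w) (Pair w -` (\<Inter>n. E n))"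
      by (rule tendsto_measure_section_decseq[OF intensity_finite[OF w] sets_intensity[OF w] dec(1,2)])
  qed (use dec eventually_avoid_decseq in auto)
qed

end

text \<open>In effect \<open>p\<close> and \<open>q\<close> have the same conditional expectation
  given \<open>F\<close> on \<open>H\<close>, so an \<open>F\<close>-measurable weight may be pulled
  out. Comparing the measures with these densities on \<open>F\<close> avoids conditional
  expectations and integrability conditions.\<close>

lemma nn_integral_weight_subalgebra:
  fixes p q g :: "'w \<Rightarrow> ennreal"
  assumes sub: "subalgebra P F" and H: "H \<in> sets F"
    and p[measurable]: "p \<in> borel_measurable P" and q[measurable]: "q \<in> borel_measurable P"
    and eq: "\<And>K. K \<in> sets F \<Longrightarrow> K \<subseteq> H \<Longrightarrow> (\<integral>\<^sup>+w\<in>K. q w \<partial>P) = (\<integral>\<^sup>+w\<in>K. p w \<partial>P)"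
    and g: "g \<in> borel_measurable F"
  shows "(\<integral>\<^sup>+w\<in>H. (g w * q w) \<partial>P) = (\<integral>\<^sup>+w\<in>H. (g w * p w) \<partial>P)"
proof -
  have HP[measurable]: "H \<in> sets P" and FP: "\<And>K. K \<in> sets F \<Longrightarrow> K \<in> sets P"
    using H sub by (auto simp: subalgebra_def)
  have gP[measurable]: "g \<in> borel_measurable P"
    using sub g by (rule measurable_from_subalg)
  define Q where "Q r = density P (\<lambda>w. r w * indicator H w)" for r :: "'w \<Rightarrow> ennreal"
  have sub_Q: "subalgebra (Q r) F" for r
    using sub by (simp add: subalgebra_def Q_def)
  have int: "(\<integral>\<^sup>+w. g w \<partial>restr_to_subalg (Q r) F) = (\<integral>\<^sup>+w\<in>H. (g w * r w) \<partial>P)"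
    if [measurable]: "r \<in> borel_measurable P" for r
  proof -
    have "(\<integral>\<^sup>+w. g w \<partial>restr_to_subalg (Q r) F) = (\<integral>\<^sup>+w. g w \<partial>Q r)"
      using sub_Q g by (rule nn_integral_subalgebra2)
    also have "\<dots> = (\<integral>\<^sup>+w. r w * indicator H w * g w \<partial>P)"
      unfolding Q_def by (rule nn_integral_density) measurable
    finally show ?thesis by (simp add: ac_simps)
  qed
  have "restr_to_subalg (Q q) F = restr_to_subalg (Q p) F"
  proof (rule measure_eqI)
    fix A assume "A \<in> sets (restr_to_subalg (Q q) F)"
    then have A: "A \<in> sets F" by (simp add: sets_restr_to_subalg[OF sub_Q])
    have *: "emeasure (restr_to_subalg (Q r) F) A = (\<integral>\<^sup>+w\<in>A \<inter> H. r w \<partial>P)"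
      if [measurable]: "r \<in> borel_measurable P" for r
    proof -
      have "emeasure (restr_to_subalg (Q r) F) A = emeasure (Q r) A"
        using sub_Q A by (rule emeasure_restr_to_subalg)
      also have "\<dots> = (\<integral>\<^sup>+w. r w * indicator H w * indicator A w \<partial>P)"
        unfolding Q_def using FP[OF A] by (intro emeasure_density) measurable
      finally show ?thesis by (simp add: indicator_inter_arith ac_simps)
    qed
    show "emeasure (restr_to_subalg (Q q) F) A = emeasure (restr_to_subalg (Q p) F) A"
      unfolding *[OF p] *[OF q] using A H by (intro eq) auto
  qed (simp add: sets_restr_to_subalg[OF sub_Q])
  then show ?thesis using int[OF p] int[OF q] by simp
qed

lemma measure_density_indicator:
  assumes "B \<in> sets M" "A \<in> sets M"
  shows "measure (density M (indicator B)) A = measure M (B \<inter> A)"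
  using assms by (simp add: measure_def emeasure_restricted)

lemma finite_measure_density_indicator:
  assumes "B \<in> sets M" "emeasure M B < \<infinity>"
  shows "finite_measure (density M (indicator B))"
proof (rule finite_measureI)
  have "emeasure (density M (indicator B)) (space M) = emeasure M B"
    using assms(1) sets.sets_into_space[OF assms(1)] by (simp add: emeasure_restricted Int_absorb2)
  then show "emeasure (density M (indicator B)) (space (density M (indicator B))) \<noteq> \<infinity>"
    using assms(2) by simp
qed

section \<open>Independence of the highest level outside a set and the points inside it\<close>

context poisson_avoidance
begin

text \<open>In the application \<open>s f\<close> is the value of \<open>f\<close> at the point
  being treated, \<open>B\<close> the set of functions violating a threshold, \<open>R\<close> the
  condition of not being removed, and \<open>lo\<close> the lowest level that is simulated.\<close>

context
  fixes s :: "'b \<Rightarrow> real" and B :: "'b set" and R :: "'w \<Rightarrow> 'b \<Rightarrow> bool"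
    and lo :: "'w \<Rightarrow> real" and top :: "'w \<Rightarrow> real"
  assumes s[measurable]: "s \<in> borel_measurable S" and B[measurable]: "B \<in> sets S"
    and R[measurable]: "Measurable.pred (F \<Otimes>\<^sub>M S) (\<lambda>p. R (fst p) (snd p))"
    and lo[measurable]: "lo \<in> borel_measurable F"
  defines "top \<equiv> \<lambda>w. Max (insert (lo w) (s ` {f \<in> Z w. f \<notin> B \<and> R w f}))"
begin

text \<open>A generator, stable under intersections, of the \<sigma>-algebra of everything known
  from \<open>F\<close> and the value of \<open>top\<close>. Half-lines are chosen because
  \<open>top w < z\<close> reduces to an avoidance event.\<close>

definition top_events :: "'w set set" where
  "top_events = {K \<inter> {w \<in> space P. top w < z} |K z. K \<in> sets F}"

definition top_algebra :: "'w measure" where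
  "top_algebra = sigma (space P) top_events"

lemma top_less_iff: "w \<in> space P \<Longrightarrow> top w < z \<longleftrightarrow> lo w < z \<and> (\<forall>f\<in>Z w. \<not> (f \<notin> B \<and> R w f \<and> z \<le> s f))"
  unfolding top_def using finite_points[of w] by (auto simp: not_le)

lemma R_P: "Measurable.pred (P \<Otimes>\<^sub>M S) (\<lambda>p. R (fst p) (snd p))"
proof -
  have "{p \<in> space (F \<Otimes>\<^sub>M S). R (fst p) (snd p)} \<in> sets (P \<Otimes>\<^sub>M S)"
    by (intro sets_pair_F) measurable
  then show ?thesis by (simp add: pred_def space_pair_measure space_F)
qed

lemma top_measurable_P: "top \<in> borel_measurable P"
  unfolding top_def
proof (rule borel_measurable_Max)
  note [measurable] = R_P
  show "Measurable.pred (P \<Otimes>\<^sub>M S) (\<lambda>p. snd p \<notin> B \<and> R (fst p) (snd p))"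
    by measurable
qed (rule measurable_F[OF lo], rule s)

lemma top_events_sets: "top_events \<subseteq> sets P"
proof
  note [measurable] = top_measurable_P
  fix A assume "A \<in> top_events"
  then obtain K z where A: "A = K \<inter> {w \<in> space P. top w < z}" and K: "K \<in> sets F"
    by (auto simp: top_events_def)
  show "A \<in> sets P"
    unfolding A using sets_F[OF K] by measurable
qed

lemma top_events_Pow: "top_events \<subseteq> Pow (space P)"
  using top_events_sets sets.sets_into_space by blast

lemma sets_top_algebra: "sets top_algebra = sigma_sets (space P) top_events"
  unfolding top_algebra_def using top_events_Pow by simp

lemma space_top_algebra: "space top_algebra = space P"
  unfolding top_algebra_def using top_events_Pow by (simp add: space_measure_of_conv)

lemma sub_top_algebra: "subalgebra P top_algebra"
  unfolding subalgebra_def sets_top_algebra space_top_algebra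
  using sets.sigma_sets_subset[OF top_events_sets] by simp

lemma F_top_algebra: "subalgebra top_algebra F"
  unfolding subalgebra_def
proof
  show "sets F \<subseteq> sets top_algebra"
  proof
    fix K assume K: "K \<in> sets F"
    have "(\<Union>n::nat. K \<inter> {w \<in> space P. top w < real n}) \<in> sets top_algebra"
      unfolding sets_top_algebra
    proof (intro sigma_sets.Union sigma_sets.Basic)
      show "K \<inter> {w \<in> space P. top w < real n} \<in> top_events" for n
        unfolding top_events_def using K by blast
    qed
    also have "(\<Union>n::nat. K \<inter> {w \<in> space P. top w < real n}) = K"
      using sets.sets_into_space[OF K] by (auto simp: space_F intro: reals_Archimedean2)
    finally show "K \<in> sets top_algebra" .
  qed
qed (simp add: space_F space_top_algebra)

lemma top_measurable: "top \<in> borel_measurable top_algebra"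
  unfolding borel_measurable_iff_less
proof
  fix z
  have "space P \<inter> {w \<in> space P. top w < z} \<in> top_events"
    unfolding top_events_def using sets.top[of F] by (auto simp: space_F)
  moreover have "{w \<in> space top_algebra. top w < z} = space P \<inter> {w \<in> space P. top w < z}"
    by (auto simp: space_top_algebra)
  ultimately show "{w \<in> space top_algebra. top w < z} \<in> sets top_algebra"
    unfolding sets_top_algebra by (simp only: sigma_sets.Basic)
qed

lemma R_top: "Measurable.pred (top_algebra \<Otimes>\<^sub>M S) (\<lambda>p. R (fst p) (snd p))"
proof -
  have "sets (F \<Otimes>\<^sub>M S) \<subseteq> sets (top_algebra \<Otimes>\<^sub>M S)"
    unfolding sets_pair_measure space_F space_top_algebra
    using F_top_algebra by (intro sigma_sets_mono') (auto simp: subalgebra_def)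
  moreover have "{p \<in> space (F \<Otimes>\<^sub>M S). R (fst p) (snd p)} \<in> sets (F \<Otimes>\<^sub>M S)"
    by measurable
  ultimately show ?thesis by (auto simp: pred_def space_pair_measure space_F space_top_algebra)
qed

text \<open>Where \<open>lo w < z\<close>, the event \<open>top w < z\<close> means that the set
  \<open>D\<close> of high points outside \<open>B\<close> is avoided. Avoiding \<open>D\<close> and
  \<open>B \<inter> A\<close> means avoiding their disjoint union, whose probability factorizes. The
  factor for \<open>D\<close> is then read backwards as the probability of avoiding
  \<open>D\<close>, which leaves the factor for \<open>B \<inter> A\<close> on the event about
  \<open>top\<close>.\<close>

lemma avoidance_top_events:
  assumes K: "K \<in> sets F" and A[measurable]: "A \<in> sets S"
  shows "emeasure P {w \<in> K \<inter> H \<inter> {w \<in> space P. top w < z}. Z w \<inter> (B \<inter> A) = {}} =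
    (\<integral>\<^sup>+w\<in>K \<inter> H \<inter> {w \<in> space P. top w < z}. ennreal (exp (- measure (\<nu> w) (B \<inter> A))) \<partial>P)"
proof -
  define K0 where "K0 = K \<inter> H \<inter> {w \<in> space F. lo w < z}"
  have K0: "K0 \<in> sets F" "K0 \<subseteq> H"
    unfolding K0_def using K H by (auto intro!: sets.Int)
  have K0_sp: "K0 \<subseteq> space P" using K0(1) sets.sets_into_space space_F by blast
  define D where "D = {p \<in> space (F \<Otimes>\<^sub>M S). snd p \<notin> B \<and> R (fst p) (snd p) \<and> z \<le> s (snd p)}"
  have D: "D \<in> sets (F \<Otimes>\<^sub>M S)" unfolding D_def by measurable
  define E where "E = {p \<in> space (F \<Otimes>\<^sub>M S). snd p \<in> B \<inter> A}"
  have E: "E \<in> sets (F \<Otimes>\<^sub>M S)" unfolding E_def by measurable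
  have sec_E: "Pair w -` E = B \<inter> A" if "w \<in> space P" for w
    using that sets.sets_into_space[OF A] by (auto simp: E_def space_pair_measure space_F)
  have top_iff: "w \<in> K \<inter> H \<inter> {w \<in> space P. top w < z} \<longleftrightarrow> w \<in> K0 \<and> (\<forall>f\<in>Z w. (w, f) \<notin> D)" for w
    using top_less_iff[of w z] points_in_space[of w]
    by (auto simp: K0_def D_def space_pair_measure space_F)
  have avoid_D: "{w \<in> K0. \<forall>f\<in>Z w. (w, f) \<notin> D} \<in> sets P"
  proof -
    have "{w \<in> K0. \<forall>f\<in>Z w. (w, f) \<notin> D} = K0 \<inter> {w \<in> space P. \<forall>f\<in>Z w. (w, f) \<notin> D}"
      using K0_sp by auto
    then show ?thesis using sets_F[OF K0(1)] sets_avoid[OF sets_pair_F[OF D]] by simp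
  qed
  have mD: "(\<lambda>w. ennreal (exp (- measure (\<nu> w) (Pair w -` D)))) \<in> borel_measurable P"
    using measurable_F[OF section_measurable[OF D]] by measurable
  have mBA: "(\<lambda>w. ennreal (exp (- measure (\<nu> w) (B \<inter> A)))) \<in> borel_measurable F"
    using intensity_measurable[of "B \<inter> A"] by measurable
  have "{w \<in> K \<inter> H \<inter> {w \<in> space P. top w < z}. Z w \<inter> (B \<inter> A) = {}} =
      {w \<in> K0. \<forall>f\<in>Z w. (w, f) \<notin> D \<union> E}"
  proof -
    have "Z w \<inter> (B \<inter> A) = {} \<longleftrightarrow> (\<forall>f\<in>Z w. (w, f) \<notin> E)" if "w \<in> K0" for w
      using that K0_sp points_in_space[of w] by (auto simp: E_def space_pair_measure space_F)
    then show ?thesis using top_iff by blast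
  qed
  then have "emeasure P {w \<in> K \<inter> H \<inter> {w \<in> space P. top w < z}. Z w \<inter> (B \<inter> A) = {}} =
      (\<integral>\<^sup>+w\<in>K0. ennreal (exp (- measure (\<nu> w) (Pair w -` (D \<union> E)))) \<partial>P)"
    using avoidance_section[of "D \<union> E" K0] D E K0 by simp
  also have "\<dots> = (\<integral>\<^sup>+w\<in>K0. (ennreal (exp (- measure (\<nu> w) (B \<inter> A))) *
      ennreal (exp (- measure (\<nu> w) (Pair w -` D)))) \<partial>P)"
  proof (rule nn_integral_cong)
    fix w assume w: "w \<in> space P"
    have "measure (\<nu> w) (Pair w -` (D \<union> E)) = measure (\<nu> w) (Pair w -` D \<union> Pair w -` E)"
      by (simp add: vimage_Un)
    also have "\<dots> = measure (\<nu> w) (Pair w -` D) + measure (\<nu> w) (Pair w -` E)"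
      by (rule finite_measure.finite_measure_Union[OF intensity_finite[OF w]])
        (use sets_Pair1[OF D] sets_Pair1[OF E] in \<open>auto simp: sets_intensity[OF w] D_def E_def\<close>)
    finally show "ennreal (exp (- measure (\<nu> w) (Pair w -` (D \<union> E)))) * indicator K0 w =
      (ennreal (exp (- measure (\<nu> w) (B \<inter> A))) * ennreal (exp (- measure (\<nu> w) (Pair w -` D)))) *
      indicator K0 w"
      by (simp add: sec_E[OF w] exp_add[symmetric] ennreal_mult[symmetric] minus_diff_commute)
  qed
  also have "\<dots> = (\<integral>\<^sup>+w\<in>K0. (ennreal (exp (- measure (\<nu> w) (B \<inter> A))) *
      indicator {w \<in> K0. \<forall>f\<in>Z w. (w, f) \<notin> D} w) \<partial>P)"
  proof (rule nn_integral_weight_subalgebra[OF sub K0(1) _ mD _ mBA])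
    show "(indicator {w \<in> K0. \<forall>f\<in>Z w. (w, f) \<notin> D} :: 'w \<Rightarrow> ennreal) \<in> borel_measurable P"
      using avoid_D by (rule borel_measurable_indicator)
    fix K1 assume K1: "K1 \<in> sets F" "K1 \<subseteq> K0"
    have "(\<integral>\<^sup>+w\<in>K1. indicator {w \<in> K0. \<forall>f\<in>Z w. (w, f) \<notin> D} w \<partial>P) =
        (\<integral>\<^sup>+w. indicator {w \<in> K1. \<forall>f\<in>Z w. (w, f) \<notin> D} w \<partial>P)"
      using K1(2) by (intro nn_integral_cong) (auto split: split_indicator)
    also have "\<dots> = emeasure P {w \<in> K1. \<forall>f\<in>Z w. (w, f) \<notin> D}"
    proof (rule nn_integral_indicator)
      have "{w \<in> K1. \<forall>f\<in>Z w. (w, f) \<notin> D} = K1 \<inter> {w \<in> K0. \<forall>f\<in>Z w. (w, f) \<notin> D}"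
        using K1(2) by auto
      then show "{w \<in> K1. \<forall>f\<in>Z w. (w, f) \<notin> D} \<in> sets P"
        using sets_F[OF K1(1)] avoid_D by simp
    qed
    also have "\<dots> = (\<integral>\<^sup>+w\<in>K1. ennreal (exp (- measure (\<nu> w) (Pair w -` D))) \<partial>P)"
      using D K1 K0 by (intro avoidance_section) auto
    finally show "(\<integral>\<^sup>+w\<in>K1. ennreal (exp (- measure (\<nu> w) (Pair w -` D))) \<partial>P) =
      (\<integral>\<^sup>+w\<in>K1. indicator {w \<in> K0. \<forall>f\<in>Z w. (w, f) \<notin> D} w \<partial>P)" ..
  qed
  also have "\<dots> = (\<integral>\<^sup>+w\<in>K \<inter> H \<inter> {w \<in> space P. top w < z}. ennreal (exp (- measure (\<nu> w) (B \<inter> A))) \<partial>P)"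
    using top_iff by (intro nn_integral_cong) (auto split: split_indicator)
  finally show ?thesis .
qed

text \<open>This is the independence of \<open>top\<close> and the points in \<open>B\<close>:
  knowing \<open>top\<close> does not change their avoidance probabilities. The locale is thus
  instantiated again with the larger \<sigma>-algebra, and its results on random sets become
  available for sets depending on \<open>top\<close>.\<close>

lemma poisson_avoidance_top:
  "poisson_avoidance P S (\<lambda>w. Z w \<inter> B) top_algebra H (\<lambda>w. density (\<nu> w) (indicator B))"
proof (intro poisson_avoidance.intro prob_space_axioms random_finite_set.intro
    poisson_avoidance_axioms.intro)
  fix w assume w: "w \<in> space P"
  show "finite (Z w \<inter> B)" "Z w \<inter> B \<subseteq> space S"
    using finite_points[OF w] points_in_space[OF w] by auto
  show "finite_measure (density (\<nu> w) (indicator B))"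
    using B finite_measure.emeasure_finite[OF intensity_finite[OF w]]
    by (intro finite_measure_density_indicator) (simp_all add: sets_intensity[OF w] less_top[symmetric])
  show "sets (density (\<nu> w) (indicator B)) = sets S"
    by (simp add: sets_intensity[OF w])
next
  fix A assume A: "A \<in> sets S"
  have BA: "B \<inter> A \<in> sets S" using A B by simp
  show "{w \<in> space P. (Z w \<inter> B) \<inter> A = {}} \<in> sets P"
    using avoid_fixed[OF BA] by (simp add: Int_assoc)
  have dens: "measure (density (\<nu> w) (indicator B)) A = measure (\<nu> w) (B \<inter> A)" if "w \<in> space P" for w
    using A B by (simp add: measure_density_indicator sets_intensity[OF that])
  have mF: "(\<lambda>w. measure (\<nu> w) (B \<inter> A)) \<in> borel_measurable F"
    by (rule intensity_measurable[OF BA])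
  show "(\<lambda>w. measure (density (\<nu> w) (indicator B)) A) \<in> borel_measurable top_algebra"
    using measurable_from_subalg[OF F_top_algebra mF]
    by (rule measurable_cong[THEN iffD1, rotated]) (simp add: dens space_top_algebra)
  have [measurable]: "(\<lambda>w. ennreal (exp (- measure (\<nu> w) (B \<inter> A)))) \<in> borel_measurable P"
    using measurable_F[OF mF] by measurable
  have HP[measurable]: "H \<in> sets P" using sets_F[OF H] .
  have av[measurable]: "{w \<in> space P. Z w \<inter> (B \<inter> A) = {}} \<in> sets P"
    by (rule avoid_fixed[OF BA])
  define Q where "Q r = density P (\<lambda>w. r w * indicator H w)" for r :: "'w \<Rightarrow> ennreal"
  define p where "p w = ennreal (exp (- measure (\<nu> w) (B \<inter> A)))" for w
  define q :: "'w \<Rightarrow> ennreal" where "q = indicator {w \<in> space P. Z w \<inter> (B \<inter> A) = {}}"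
  have pq[measurable]: "p \<in> borel_measurable P" "q \<in> borel_measurable P"
    unfolding p_def q_def by measurable
  have sub_Q: "subalgebra (Q r) top_algebra" for r
    using sub_top_algebra by (simp add: subalgebra_def Q_def)
  have Q: "emeasure (restr_to_subalg (Q r) top_algebra) K = (\<integral>\<^sup>+w\<in>K \<inter> H. r w \<partial>P)"
    if [measurable]: "r \<in> borel_measurable P" and K: "K \<in> sets top_algebra" for r K
  proof -
    have KP: "K \<in> sets P" using K sub_top_algebra by (auto simp: subalgebra_def)
    have "emeasure (restr_to_subalg (Q r) top_algebra) K = emeasure (Q r) K"
      using sub_Q K by (rule emeasure_restr_to_subalg)
    also have "\<dots> = (\<integral>\<^sup>+w. r w * indicator H w * indicator K w \<partial>P)"
      unfolding Q_def using KP by (intro emeasure_density) measurable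
    finally show ?thesis by (simp add: indicator_inter_arith ac_simps)
  qed
  have q_int: "(\<integral>\<^sup>+w\<in>K. q w \<partial>P) = emeasure P {w \<in> K. Z w \<inter> (B \<inter> A) = {}}" if "K \<in> sets P" for K
  proof -
    have "(\<integral>\<^sup>+w\<in>K. q w \<partial>P) = (\<integral>\<^sup>+w. indicator (K \<inter> {w \<in> space P. Z w \<inter> (B \<inter> A) = {}}) w \<partial>P)"
      by (simp add: q_def indicator_inter_arith ac_simps)
    also have "\<dots> = emeasure P (K \<inter> {w \<in> space P. Z w \<inter> (B \<inter> A) = {}})"
      using that av by (intro nn_integral_indicator) simp
    also have "K \<inter> {w \<in> space P. Z w \<inter> (B \<inter> A) = {}} = {w \<in> K. Z w \<inter> (B \<inter> A) = {}}"
      using sets.sets_into_space[OF that] by auto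
    finally show ?thesis .
  qed
  have "restr_to_subalg (Q q) top_algebra = restr_to_subalg (Q p) top_algebra"
  proof (rule measure_eqI_generator_eq[where E = top_events and \<Omega> = "space P" and
        A = "\<lambda>n. space P \<inter> {w \<in> space P. top w < real n}"])
    show "Int_stable top_events"
    proof (rule Int_stableI)
      fix a b assume "a \<in> top_events" "b \<in> top_events"
      then obtain K z K' z' where "K \<in> sets F" "K' \<in> sets F"
        "a = K \<inter> {w \<in> space P. top w < z}" "b = K' \<inter> {w \<in> space P. top w < z'}"
        by (auto simp: top_events_def)
      then show "a \<inter> b \<in> top_events"
        unfolding top_events_def
        by (intro CollectI exI[of _ "K \<inter> K'"] exI[of _ "min z z'"]) auto
    qed
    show "top_events \<subseteq> Pow (space P)" by (rule top_events_Pow)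
    show "sets (restr_to_subalg (Q r) top_algebra) = sigma_sets (space P) top_events" for r
      by (simp add: sets_restr_to_subalg[OF sub_Q] sets_top_algebra)
    then show "sets (restr_to_subalg (Q p) top_algebra) = sigma_sets (space P) top_events" .
    fix X assume X: "X \<in> top_events"
    then obtain K z where K: "K \<in> sets F" and XK: "X = K \<inter> {w \<in> space P. top w < z}"
      by (auto simp: top_events_def)
    have XH: "X \<inter> H = K \<inter> H \<inter> {w \<in> space P. top w < z}" unfolding XK by auto
    have XHP: "X \<inter> H \<in> sets P" using X top_events_sets HP by auto
    have X': "X \<in> sets top_algebra"
      using X unfolding sets_top_algebra by (rule sigma_sets.Basic)
    show "emeasure (restr_to_subalg (Q q) top_algebra) X = emeasure (restr_to_subalg (Q p) top_algebra) X"
      unfolding Q[OF pq(1) X'] Q[OF pq(2) X'] q_int[OF XHP]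
      unfolding XH p_def by (rule avoidance_top_events[OF K A])
  next
    show "range (\<lambda>n. space P \<inter> {w \<in> space P. top w < real n}) \<subseteq> top_events"
      unfolding top_events_def using sets.top[of F] by (auto simp: space_F)
    show "(\<Union>n. space P \<inter> {w \<in> space P. top w < real n}) = space P"
      by (auto intro: reals_Archimedean2)
    fix n
    have Xn: "space P \<inter> {w \<in> space P. top w < real n} \<in> sets top_algebra"
      unfolding sets_top_algebra top_events_def using sets.top[of F]
      by (intro sigma_sets.Basic) (auto simp: space_F)
    have "emeasure (restr_to_subalg (Q q) top_algebra) (space P \<inter> {w \<in> space P. top w < real n}) \<le>
        (\<integral>\<^sup>+w. 1 \<partial>P)"
      unfolding Q[OF pq(2) Xn] by (intro nn_integral_mono) (auto simp: q_def split: split_indicator)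
    also have "\<dots> < \<infinity>" by (simp add: emeasure_space_1)
    finally show "emeasure (restr_to_subalg (Q q) top_algebra)
      (space P \<inter> {w \<in> space P. top w < real n}) \<noteq> \<infinity>" by simp
  qed
  note eq = this
  fix K assume K: "K \<in> sets top_algebra" "K \<subseteq> H"
  have KH: "K \<inter> H = K" using K(2) by auto
  have KP: "K \<in> sets P" using K sub_top_algebra by (auto simp: subalgebra_def)
  have "emeasure P {w \<in> K. Z w \<inter> (B \<inter> A) = {}} = (\<integral>\<^sup>+w\<in>K. p w \<partial>P)"
    using arg_cong[OF eq, of "\<lambda>M. emeasure M K"]
    unfolding Q[OF pq(1) K(1)] Q[OF pq(2) K(1)] KH q_int[OF KP] .
  also have "\<dots> = (\<integral>\<^sup>+w\<in>K. ennreal (exp (- measure (density (\<nu> w) (indicator B)) A)) \<partial>P)"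
    by (intro nn_integral_cong) (simp add: p_def dens)
  finally show "emeasure P {w \<in> K. (Z w \<inter> B) \<inter> A = {}} =
      (\<integral>\<^sup>+w\<in>K. ennreal (exp (- measure (density (\<nu> w) (indicator B)) A)) \<partial>P)"
    by (simp add: Int_assoc)
qed (use sub_top_algebra F_top_algebra H in \<open>auto simp: subalgebra_def\<close>)

text \<open>The condition of reaching \<open>top\<close> is random, but measurable with respect to
  the \<sigma>-algebra on which the points of \<open>B\<close> are now conditioned; hence it may be
  treated as if the level were fixed.\<close>

lemma nn_integral_avoidance_at_top:
  assumes g: "g \<in> borel_measurable top_algebra"
  shows "(\<integral>\<^sup>+w\<in>H. (g w * indicator {w \<in> space P. \<forall>f\<in>Z w. f \<in> B \<and> R w f \<longrightarrow> s f < top w} w) \<partial>P) =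
    (\<integral>\<^sup>+w\<in>H. (g w * ennreal (exp (- measure (\<nu> w) {f \<in> B. R w f \<and> top w \<le> s f}))) \<partial>P)"
proof -
  interpret T: poisson_avoidance P S "\<lambda>w. Z w \<inter> B" top_algebra H "\<lambda>w. density (\<nu> w) (indicator B)"
    by (rule poisson_avoidance_top)
  note [measurable] = R_top top_measurable
  define D where "D = {p \<in> space (top_algebra \<Otimes>\<^sub>M S). R (fst p) (snd p) \<and> top (fst p) \<le> s (snd p)}"
  have D: "D \<in> sets (top_algebra \<Otimes>\<^sub>M S)" unfolding D_def by measurable
  have avoid: "(\<forall>f\<in>Z w \<inter> B. (w, f) \<notin> D) \<longleftrightarrow> (\<forall>f\<in>Z w. f \<in> B \<and> R w f \<longrightarrow> s f < top w)"
    if "w \<in> space P" for w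
    using that points_in_space[OF that] by (auto simp: D_def space_pair_measure space_top_algebra)
  have sec: "measure (density (\<nu> w) (indicator B)) (Pair w -` D) =
      measure (\<nu> w) {f \<in> B. R w f \<and> top w \<le> s f}" if w: "w \<in> space P" for w
  proof -
    have "measure (density (\<nu> w) (indicator B)) (Pair w -` D) = measure (\<nu> w) (B \<inter> Pair w -` D)"
      using B sets_Pair1[OF D] by (simp add: measure_density_indicator sets_intensity[OF w])
    also have "B \<inter> Pair w -` D = {f \<in> B. R w f \<and> top w \<le> s f}"
      using w sets.sets_into_space[OF B] by (auto simp: D_def space_pair_measure space_top_algebra)
    finally show ?thesis .
  qed
  have mD: "(\<lambda>w. ennreal (exp (- measure (density (\<nu> w) (indicator B)) (Pair w -` D)))) \<in> borel_measurable P"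
    using T.measurable_F[OF T.section_measurable[OF D]] by measurable
  have av: "{w \<in> space P. \<forall>f\<in>Z w. f \<in> B \<and> R w f \<longrightarrow> s f < top w} \<in> sets P" (is "?A \<in> _")
  proof -
    have "{w \<in> space P. \<forall>f\<in>Z w \<inter> B. (w, f) \<notin> D} \<in> sets P"
      by (rule T.sets_avoid[OF T.sets_pair_F[OF D]])
    then show ?thesis using avoid by (simp cong: conj_cong)
  qed
  have "(\<integral>\<^sup>+w\<in>H. (g w * indicator ?A w) \<partial>P) =
    (\<integral>\<^sup>+w\<in>H. (g w * ennreal (exp (- measure (density (\<nu> w) (indicator B)) (Pair w -` D)))) \<partial>P)"
  proof (rule nn_integral_weight_subalgebra[OF sub_top_algebra T.H mD _ _ g])
    show "(indicator ?A :: 'w \<Rightarrow> ennreal) \<in> borel_measurable P"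
      using av by (rule borel_measurable_indicator)
    fix K assume K: "K \<in> sets top_algebra" "K \<subseteq> H"
    have "(\<integral>\<^sup>+w\<in>K. indicator ?A w \<partial>P) = (\<integral>\<^sup>+w. indicator (K \<inter> ?A) w \<partial>P)"
      by (intro nn_integral_cong) (auto split: split_indicator)
    also have "\<dots> = emeasure P (K \<inter> ?A)"
      using T.sets_F[OF K(1)] av by (intro nn_integral_indicator sets.Int)
    also have "K \<inter> ?A = {w \<in> K. \<forall>f\<in>Z w \<inter> B. (w, f) \<notin> D}"
      using sets.sets_into_space[OF T.sets_F[OF K(1)]] avoid by auto
    also have "emeasure P \<dots> =
        (\<integral>\<^sup>+w\<in>K. ennreal (exp (- measure (density (\<nu> w) (indicator B)) (Pair w -` D))) \<partial>P)"
      by (rule T.avoidance_section[OF D K])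
    finally show "(\<integral>\<^sup>+w\<in>K. indicator ?A w \<partial>P) =
        (\<integral>\<^sup>+w\<in>K. ennreal (exp (- measure (density (\<nu> w) (indicator B)) (Pair w -` D))) \<partial>P)" .
  qed
  also have "\<dots> = (\<integral>\<^sup>+w\<in>H. (g w * ennreal (exp (- measure (\<nu> w) {f \<in> B. R w f \<and> top w \<le> s f}))) \<partial>P)"
    by (intro nn_integral_cong) (simp add: sec)
  finally show ?thesis .
qed

end

text \<open>The intensity gives no mass to the complement of the band, so on \<open>H\<close> it is
  avoided with conditional probability \<open>exp 0 = 1\<close>. The pointwise analysis of a step
  relies on this.\<close>

lemma AE_points_in_band:
  fixes s :: "'b \<Rightarrow> real" and lo :: "'w \<Rightarrow> real" and hi :: "'w \<Rightarrow> ereal"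
  assumes [measurable]: "s \<in> borel_measurable S" "lo \<in> borel_measurable F" "hi \<in> borel_measurable F"
    and null: "\<And>w. w \<in> H \<Longrightarrow> measure (\<nu> w) {f \<in> space S. \<not> (lo w \<le> s f \<and> ereal (s f) < hi w)} = 0"
  shows "AE w in P. w \<in> H \<longrightarrow> (\<forall>f\<in>Z w. lo w \<le> s f \<and> ereal (s f) < hi w)"
proof -
  define D where "D = {p \<in> space (F \<Otimes>\<^sub>M S). \<not> (lo (fst p) \<le> s (snd p) \<and> ereal (s (snd p)) < hi (fst p))}"
  have D: "D \<in> sets (F \<Otimes>\<^sub>M S)" unfolding D_def by measurable
  have HP: "H \<in> sets P" using sets_F[OF H] .
  have Hsp: "w \<in> H \<Longrightarrow> w \<in> space P" for w using sets.sets_into_space[OF HP] by auto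
  have "emeasure P {w \<in> H. \<forall>f\<in>Z w. (w, f) \<notin> D} =
      (\<integral>\<^sup>+w\<in>H. ennreal (exp (- measure (\<nu> w) (Pair w -` D))) \<partial>P)"
    by (rule avoidance_section[OF D H]) simp
  also have "\<dots> = (\<integral>\<^sup>+w. indicator H w \<partial>P)"
  proof (rule nn_integral_cong)
    fix w assume "w \<in> space P"
    then have "Pair w -` D = {f \<in> space S. \<not> (lo w \<le> s f \<and> ereal (s f) < hi w)}"
      by (auto simp: D_def space_pair_measure space_F)
    then show "ennreal (exp (- measure (\<nu> w) (Pair w -` D))) * indicator H w = indicator H w"
      using null[of w] by (auto split: split_indicator)
  qed
  also have "\<dots> = emeasure P H"
    using HP by simp
  finally have eq: "emeasure P {w \<in> H. \<forall>f\<in>Z w. (w, f) \<notin> D} = emeasure P H" .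
  have V: "{w \<in> H. \<forall>f\<in>Z w. (w, f) \<notin> D} \<in> sets P"
  proof -
    have "{w \<in> H. \<forall>f\<in>Z w. (w, f) \<notin> D} = H \<inter> {w \<in> space P. \<forall>f\<in>Z w. (w, f) \<notin> D}"
      using Hsp by auto
    then show ?thesis using HP sets_avoid[OF sets_pair_F[OF D]] by simp
  qed
  have "emeasure P (H - {w \<in> H. \<forall>f\<in>Z w. (w, f) \<notin> D}) = 0"
    using eq V HP by (subst emeasure_Diff) (auto simp: emeasure_eq_measure)
  then have "AE w in P. w \<notin> H - {w \<in> H. \<forall>f\<in>Z w. (w, f) \<notin> D}"
    using V HP by (intro AE_not_in) (auto simp: null_sets_def)
  then show ?thesis
  proof (rule AE_mp, intro AE_I2 impI ballI)
    fix w f assume "w \<in> space P" "w \<notin> H - {w \<in> H. \<forall>f\<in>Z w. (w, f) \<notin> D}" "w \<in> H" "f \<in> Z w"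
    then have "(w, f) \<notin> D" "f \<in> space S" using points_in_space[of w] by auto
    then show "lo w \<le> s f \<and> ereal (s f) < hi w"
      using \<open>w \<in> space P\<close> by (auto simp: D_def space_pair_measure space_F)
  qed
qed

text \<open>A point of \<open>B\<close> shows up among the points of the highest level iff some point of \<open>B\<close> reaches the
  level \<open>top\<close> of the points outside \<open>B\<close>. As \<open>top\<close> is independent of the points in \<open>B\<close>, the
  probability that this fails is \<open>exp (- \<kappa> {f \<in> B. top \<le> s f})\<close>, and the part of \<open>B\<close> below \<open>top\<close>,
  which is left to later stages, contributes the missing factor.\<close>

lemma nn_integral_highest_points:
  fixes s :: "'b \<Rightarrow> real" and B :: "'b set" and R :: "'w \<Rightarrow> 'b \<Rightarrow> bool"
    and lo :: "'w \<Rightarrow> real" and hi :: "'w \<Rightarrow> ereal" and top :: "'w \<Rightarrow> real" and \<kappa> :: "'b measure"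
  assumes s[measurable]: "s \<in> borel_measurable S" and B[measurable]: "B \<in> sets S"
    and R[measurable]: "Measurable.pred (F \<Otimes>\<^sub>M S) (\<lambda>p. R (fst p) (snd p))"
    and lo[measurable]: "lo \<in> borel_measurable F" and hi[measurable]: "hi \<in> borel_measurable F"
    and \<kappa>: "finite_measure \<kappa>" "sets \<kappa> = sets S"
    and lo_hi: "\<And>w. w \<in> H \<Longrightarrow> ereal (lo w) < hi w"
    and band: "\<And>w A. w \<in> H \<Longrightarrow> A \<in> sets S \<Longrightarrow> A \<subseteq> B \<Longrightarrow>
      measure (\<nu> w) A = measure \<kappa> {f \<in> A. lo w \<le> s f \<and> ereal (s f) < hi w}"
    and null: "\<And>w. w \<in> H \<Longrightarrow> measure (\<nu> w) {f \<in> space S. \<not> (lo w \<le> s f \<and> ereal (s f) < hi w)} = 0"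
  defines "top \<equiv> \<lambda>w. Max (insert (lo w) (s ` {f \<in> Z w. f \<notin> B \<and> R w f}))"
  shows "(\<integral>\<^sup>+w\<in>H. (ennreal (exp (- measure \<kappa> {f \<in> B. R w f \<and> s f < top w})) *
      indicator {w \<in> space P. \<forall>f\<in>Z w. f \<in> B \<and> R w f \<longrightarrow> s f < top w} w) \<partial>P) =
    (\<integral>\<^sup>+w\<in>H. ennreal (exp (- measure \<kappa> {f \<in> B. R w f \<and> ereal (s f) < hi w})) \<partial>P)"
proof -
  let ?G = "top_algebra s B R lo"
  note [measurable] = R_top[OF s B R lo] top_measurable[OF s B R lo, folded top_def]
  define D where "D = {p \<in> space (?G \<Otimes>\<^sub>M S). snd p \<in> B \<and> R (fst p) (snd p) \<and> s (snd p) < top (fst p)}"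
  have D: "D \<in> sets (?G \<Otimes>\<^sub>M S)" unfolding D_def by measurable
  have sec_D: "Pair w -` D = {f \<in> B. R w f \<and> s f < top w}" if "w \<in> space P" for w
    using that sets.sets_into_space[OF B]
    by (auto simp: D_def space_pair_measure space_top_algebra[OF s B R lo])
  have "(\<lambda>w. measure \<kappa> (Pair w -` D)) \<in> borel_measurable ?G"
    by (rule borel_measurable_measure_kernel[OF D]) (simp_all add: \<kappa>)
  then have "(\<lambda>w. ennreal (exp (- measure \<kappa> (Pair w -` D)))) \<in> borel_measurable ?G"
    by measurable
  then have g: "(\<lambda>w. ennreal (exp (- measure \<kappa> {f \<in> B. R w f \<and> s f < top w}))) \<in> borel_measurable ?G"
    by (rule measurable_cong[THEN iffD1, rotated]) (simp add: sec_D space_top_algebra[OF s B R lo])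
  have HP: "H \<in> sets P" using sets_F[OF H] .
  have Hsp: "w \<in> H \<Longrightarrow> w \<in> space P" for w using sets.sets_into_space[OF HP] by auto
  have "(\<integral>\<^sup>+w\<in>H. (ennreal (exp (- measure \<kappa> {f \<in> B. R w f \<and> s f < top w})) *
      indicator {w \<in> space P. \<forall>f\<in>Z w. f \<in> B \<and> R w f \<longrightarrow> s f < top w} w) \<partial>P) =
    (\<integral>\<^sup>+w\<in>H. (ennreal (exp (- measure \<kappa> {f \<in> B. R w f \<and> s f < top w})) *
      ennreal (exp (- measure (\<nu> w) {f \<in> B. R w f \<and> top w \<le> s f}))) \<partial>P)"
    unfolding top_def by (rule nn_integral_avoidance_at_top[OF s B R lo g[unfolded top_def]])
  also have "\<dots> = (\<integral>\<^sup>+w\<in>H. ennreal (exp (- measure \<kappa> {f \<in> B. R w f \<and> ereal (s f) < hi w})) \<partial>P)"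
  proof (rule nn_integral_cong_AE)
    have "AE w in P. w \<in> H \<longrightarrow> (\<forall>f\<in>Z w. lo w \<le> s f \<and> ereal (s f) < hi w)"
      by (rule AE_points_in_band[OF s lo hi null])
    then show "AE w in P. ennreal (exp (- measure \<kappa> {f \<in> B. R w f \<and> s f < top w})) *
        ennreal (exp (- measure (\<nu> w) {f \<in> B. R w f \<and> top w \<le> s f})) * indicator H w =
        ennreal (exp (- measure \<kappa> {f \<in> B. R w f \<and> ereal (s f) < hi w})) * indicator H w"
    proof (rule AE_mp, intro AE_I2 impI)
      fix w assume w: "w \<in> space P" and in_band: "w \<in> H \<longrightarrow> (\<forall>f\<in>Z w. lo w \<le> s f \<and> ereal (s f) < hi w)"
      show "ennreal (exp (- measure \<kappa> {f \<in> B. R w f \<and> s f < top w})) *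
        ennreal (exp (- measure (\<nu> w) {f \<in> B. R w f \<and> top w \<le> s f})) * indicator H w =
        ennreal (exp (- measure \<kappa> {f \<in> B. R w f \<and> ereal (s f) < hi w})) * indicator H w"
      proof (cases "w \<in> H")
        case True
        have fin: "finite (insert (lo w) (s ` {f \<in> Z w. f \<notin> B \<and> R w f}))"
          using finite_points[OF w] by simp
        have lo_top: "lo w \<le> top w"
          unfolding top_def using fin by (intro Max_ge) auto
        \<comment> \<open>Off the null set a point outside \<open>B\<close> could reach
          \<open>hi w\<close>, and then the part of \<open>B\<close> below \<open>top w\<close> need
          no longer be contained in the part below \<open>hi w\<close>.\<close>
        have "top w \<in> insert (lo w) (s ` {f \<in> Z w. f \<notin> B \<and> R w f})"
          unfolding top_def using fin by (intro Max_in) auto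
        then have top_hi: "ereal (top w) < hi w"
          using in_band True lo_hi by auto
        have Rw[measurable]: "Measurable.pred S (R w)"
        proof -
          have "{p \<in> space (F \<Otimes>\<^sub>M S). R (fst p) (snd p)} \<in> sets (F \<Otimes>\<^sub>M S)"
            by measurable
          from sets_Pair1[OF this, of w] show ?thesis
            using w by (simp add: pred_def space_pair_measure space_F vimage_def)
        qed
        have sets_B: "{f \<in> B. Q f} \<in> sets S" if "Measurable.pred S Q" for Q
        proof -
          have "{f \<in> B. Q f} = B \<inter> {f \<in> space S. Q f}"
            using sets.sets_into_space[OF B] by auto
          then show ?thesis using that B by (simp add: pred_def)
        qed
        have "measure (\<nu> w) {f \<in> B. R w f \<and> top w \<le> s f} =
            measure \<kappa> {f \<in> {f \<in> B. R w f \<and> top w \<le> s f}. lo w \<le> s f \<and> ereal (s f) < hi w}"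
          using True by (intro band sets_B) auto
        also have "{f \<in> {f \<in> B. R w f \<and> top w \<le> s f}. lo w \<le> s f \<and> ereal (s f) < hi w} =
            {f \<in> B. R w f \<and> top w \<le> s f \<and> ereal (s f) < hi w}"
          using lo_top by auto
        finally have "measure \<kappa> {f \<in> B. R w f \<and> s f < top w} + measure (\<nu> w) {f \<in> B. R w f \<and> top w \<le> s f} =
          measure \<kappa> {f \<in> B. R w f \<and> s f < top w} +
          measure \<kappa> {f \<in> B. R w f \<and> top w \<le> s f \<and> ereal (s f) < hi w}" by simp
        also have "\<dots> = measure \<kappa> ({f \<in> B. R w f \<and> s f < top w} \<union>
            {f \<in> B. R w f \<and> top w \<le> s f \<and> ereal (s f) < hi w})"
          by (rule finite_measure.finite_measure_Union[OF \<kappa>(1), symmetric])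
            (auto simp: \<kappa>(2) intro!: sets_B)
        also have "{f \<in> B. R w f \<and> s f < top w} \<union> {f \<in> B. R w f \<and> top w \<le> s f \<and> ereal (s f) < hi w} =
            {f \<in> B. R w f \<and> ereal (s f) < hi w}"
          using top_hi by (cases "hi w") auto
        finally have "- measure \<kappa> {f \<in> B. R w f \<and> s f < top w} - measure (\<nu> w) {f \<in> B. R w f \<and> top w \<le> s f} =
          - measure \<kappa> {f \<in> B. R w f \<and> ereal (s f) < hi w}" by linarith
        then show ?thesis
          by (simp add: ennreal_mult[symmetric] exp_add[symmetric])
      qed simp
    qed
  qed
  finally show ?thesis .
qed

end

section \<open>Point measures on the function space\<close>

lemma space_C0_borel: "space C0_borel = C0"
  by (auto simp: C0_borel_def CT_borel_def C0_def space_restrict_space space_measure_of_conv)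

lemma openin_ucc_subset:
  fixes U :: "('a::metric_space \<Rightarrow> real) set"
  assumes "openin ucc_topology U"
  shows "U \<subseteq> CT"
proof -
  have "U \<subseteq> topspace ucc_topology" using assms by (rule openin_subset)
  also have "\<dots> \<subseteq> CT" unfolding ucc_topology_def topology_generated_by_topspace by blast
  finally show ?thesis .
qed

lemma sets_CT_borel: "openin ucc_topology U \<Longrightarrow> U \<in> sets CT_borel"
  unfolding CT_borel_def
  by (subst sets_measure_of) (use openin_ucc_subset in \<open>blast intro: sigma_sets.Basic\<close>)+

lemma space_CT_borel: "space CT_borel = CT"
  by (simp add: CT_borel_def space_measure_of_conv)

text \<open>The generating neighbourhoods include those with a single point as compact set and a
  constant function as centre. The preimage of an open set is a union of these, over all balls
  contained in it.\<close>

lemma borel_measurable_eval [measurable]: "(\<lambda>f. f a) \<in> borel_measurable C0_borel"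
proof -
  have "(\<lambda>f. f a) \<in> borel_measurable (CT_borel :: ('a::metric_space \<Rightarrow> real) measure)"
  proof (rule borel_measurableI)
    fix U :: "real set" assume "open U"
    let ?G = "{{g \<in> CT. \<forall>x\<in>K. dist (g x) (f x) < e} |f K e. f \<in> CT \<and> compact K \<and> 0 < e}
      :: ('a \<Rightarrow> real) set set"
    have "openin ucc_topology {g \<in> CT. dist (g a) r < e}" if "0 < e" for r e
    proof -
      have "{g \<in> CT. dist (g a) r < e} \<in> ?G"
        using that
        by (intro CollectI exI[of _ "\<lambda>_. r"] exI[of _ "{a}"] exI[of _ e]) (auto simp: CT_def)
      then show ?thesis
        unfolding ucc_topology_def by (rule topology_generated_by_Basis)
    qed
    then have "openin ucc_topology (\<Union>(r, e)\<in>{(r, e). 0 < e \<and> ball r e \<subseteq> U}. {g \<in> CT. dist (g a) r < e})"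
      by (intro openin_Union) auto
    also have "(\<Union>(r, e)\<in>{(r, e). 0 < e \<and> ball r e \<subseteq> U}. {g \<in> CT. dist (g a) r < e}) =
        {g \<in> CT. g a \<in> U}"
    proof safe
      fix g :: "'a \<Rightarrow> real" assume "g a \<in> U" "g \<in> CT"
      then obtain e where "0 < e" "ball (g a) e \<subseteq> U" using \<open>open U\<close> open_contains_ball by blast
      then show "g \<in> (\<Union>(r, e)\<in>{(r, e). 0 < e \<and> ball r e \<subseteq> U}. {g \<in> CT. dist (g a) r < e})"
        using \<open>g \<in> CT\<close> by (intro UN_I[of "(g a, e)"]) auto
    next
      fix g :: "'a \<Rightarrow> real" and r e assume "ball r e \<subseteq> U" "dist (g a) r < e"
      then show "g a \<in> U" by (auto simp: dist_commute)
    qed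
    finally have "{g \<in> CT. g a \<in> U} \<in> sets CT_borel" by (rule sets_CT_borel)
    moreover have "(\<lambda>f. f a) -` U \<inter> space CT_borel = {g \<in> CT. g a \<in> U}"
      by (auto simp: space_CT_borel)
    ultimately show "(\<lambda>f. f a) -` U \<inter> space CT_borel \<in> sets CT_borel" by simp
  qed
  then show ?thesis
    unfolding C0_borel_def by (rule measurable_restrict_space1)
qed

lemma C0_nonneg: "f \<in> C0 \<Longrightarrow> 0 \<le> f x"
  by (simp add: C0_def)

text \<open>\<open>emeasure\<close> is zero on sets that are not measurable, so a singleton of
  positive mass is measurable and hence contained in the space.\<close>

lemma atoms_subset:
  assumes "is_point_measure S N"
  shows "atoms N \<subseteq> space S"
proof
  fix f assume "f \<in> atoms N"
  then have "{f} \<in> sets N"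
    unfolding atoms_def using emeasure_notin_sets[of "{f}" N] by force
  then show "f \<in> space S"
    using assms sets.sets_into_space[of "{f}" S] by (auto simp: is_point_measure_def)
qed

lemma point_measure_eq_0_iff:
  assumes "is_point_measure S N" "A \<in> sets S"
  shows "emeasure N A = 0 \<longleftrightarrow> atoms N \<inter> A = {}"
proof -
  have "emeasure N A = (\<integral>\<^sup>+ f. emeasure N {f} \<partial>count_space A)"
    using assms by (simp add: is_point_measure_def)
  then show ?thesis
    by (auto simp: nn_integral_0_iff_AE AE_count_space atoms_def zero_less_iff_neq_zero)
qed

text \<open>Atoms of a point measure have integer mass, so each has mass at least one and their
  number is bounded by the total mass.\<close>

lemma finite_atoms_Int:
  assumes N: "is_point_measure S N" and A: "A \<in> sets S" "emeasure N A < \<infinity>"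
  shows "finite (atoms N \<inter> A)"
proof -
  have "emeasure (count_space A) (atoms N \<inter> A) = (\<integral>\<^sup>+ f. indicator (atoms N \<inter> A) f \<partial>count_space A)"
    by simp
  also have "\<dots> \<le> (\<integral>\<^sup>+ f. emeasure N {f} \<partial>count_space A)"
  proof (intro nn_integral_mono)
    fix f assume "f \<in> space (count_space A)"
    then have "f \<in> space S" using A sets.sets_into_space by auto
    then obtain n :: nat where "emeasure N {f} = of_nat n"
      using N by (auto simp: is_point_measure_def Nats_def)
    then show "indicator (atoms N \<inter> A) f \<le> emeasure N {f}"
      by (auto simp: atoms_def Suc_le_eq split: split_indicator intro!: of_nat_mono[of 1, simplified])
  qed
  also have "\<dots> = emeasure N A"
    using N A by (simp add: is_point_measure_def)
  finally have "emeasure (count_space A) (atoms N \<inter> A) < \<infinity>"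
    using A(2) by (rule le_less_trans)
  then show ?thesis
    using emeasure_count_space_infinite[of "atoms N \<inter> A" A] by fastforce
qed

text \<open>Functions in \<open>C0\<close> are nonnegative, so the inserted zero changes nothing for
  nonempty sets and yields the convention for the empty set. Measurability of maxima is available in
  this form.\<close>

lemma pmax_eq_Max:
  assumes "finite A" "A \<subseteq> C0"
  shows "pmax A x = Max (insert 0 ((\<lambda>f. f x) ` A))"
proof (cases "A = {}")
  case False
  then have "Max ((\<lambda>f. f x) ` A) \<in> (\<lambda>f. f x) ` A"
    using assms(1) by (intro Max_in) auto
  then have "0 \<le> Max ((\<lambda>f. f x) ` A)"
    using assms(2) C0_nonneg by fastforce
  then show ?thesis
    using False assms(1) by (simp add: pmax_def cSup_eq_Max max_def)
qed (simp add: pmax_def)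

lemma pmax_nonneg:
  assumes "finite A" "A \<subseteq> C0"
  shows "0 \<le> pmax A x"
  using assms by (simp add: pmax_eq_Max)

lemma pmax_le_iff:
  assumes "finite A" "A \<subseteq> C0" "0 \<le> r"
  shows "pmax A x \<le> r \<longleftrightarrow> (\<forall>f\<in>A. f x \<le> r)"
  using assms by (simp add: pmax_eq_Max)

text \<open>A single set with count zero: this is the only instance of the conditional count
  probabilities that the analysis of a run uses.\<close>

lemma prm_given_void:
  assumes prm: "prm_given P F S N \<nu>" and K: "K \<in> sets F" "K \<subseteq> space P" and A: "A \<in> sets S"
  shows "emeasure P {w \<in> K. atoms (N w) \<inter> A = {}} = (\<integral>\<^sup>+w\<in>K. poisson_prob (emeasure (\<nu> w) A) 0 \<partial>P)"
proof -
  have "emeasure P {w \<in> K. emeasure (N w) A = 0} = (\<integral>\<^sup>+w\<in>K. poisson_prob (emeasure (\<nu> w) A) 0 \<partial>P)"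
  proof -
    have "\<forall>H\<in>sets F. \<forall>(k::nat) A n. (\<forall>l<k. A l \<in> sets S) \<longrightarrow> disjoint_family_on A {..<k} \<longrightarrow>
        emeasure P {w \<in> H. \<forall>l<k. emeasure (N w) (A l) = of_nat (n l)} =
        (\<integral>\<^sup>+w\<in>H. (\<Prod>l<k. poisson_prob (emeasure (\<nu> w) (A l)) (n l)) \<partial>P)"
      using prm unfolding prm_given_def by blast
    from this[rule_format, OF K(1), of 1 "\<lambda>_. A" "\<lambda>_. 0"] show ?thesis
      using A by (simp add: disjoint_family_on_def)
  qed
  moreover have "{w \<in> K. emeasure (N w) A = 0} = {w \<in> K. atoms (N w) \<inter> A = {}}"
  proof -
    have "emeasure (N w) A = 0 \<longleftrightarrow> atoms (N w) \<inter> A = {}" if "w \<in> K" for w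
      using that K(2) prm A by (intro point_measure_eq_0_iff[of S]) (auto simp: prm_given_def)
    then show ?thesis by auto
  qed
  ultimately show ?thesis by simp
qed

lemma poisson_prob_0: "emeasure M A < \<infinity> \<Longrightarrow> poisson_prob (emeasure M A) 0 = ennreal (exp (- measure M A))"
  by (simp add: poisson_prob_def measure_def)


section \<open>Runs of the algorithm\<close>

text \<open>The max-id process does not occur. The index set is instead characterized by the mass of
  the functions that are positive at the point: finite for indices in \<open>J\<close>, so that step
  2 simulates finite measures, and infinite for the others, so that the search succeeds.\<close>

locale simulation = prob_space P for P :: "'p measure" +
  fixes \<mu> :: "('a::metric_space \<Rightarrow> real) measure" and J :: "nat set" and d :: nat
    and t :: "nat \<Rightarrow> 'a" and c :: "nat \<Rightarrow> real" and N :: "nat \<Rightarrow> 'p \<Rightarrow> ('a \<Rightarrow> real) measure"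
  assumes sets_mu: "sets \<mu> = sets C0_borel"
    and exceed_finite: "\<And>l e. l \<in> {1..d} \<Longrightarrow> 0 < e \<Longrightarrow> emeasure \<mu> {f \<in> C0. f (t l) > e} < \<infinity>"
    and J_subset: "J \<subseteq> {1..d}"
    and J_finite: "\<And>j. j \<in> J \<Longrightarrow> emeasure \<mu> {f \<in> C0. f (t j) > 0} < \<infinity>"
    and not_J_infinite: "\<And>i. i \<in> {1..d} - J \<Longrightarrow> emeasure \<mu> {f \<in> C0. f (t i) > 0} = \<infinity>"
    and c_pos: "\<And>i. 0 < c i"
    and run: "is_run P \<mu> J d t c N"
begin

abbreviation cfg :: "nat \<Rightarrow> 'p \<Rightarrow> 'a config" where
  "cfg n w \<equiv> config_at J d t c (\<lambda>m. N m w) n"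

abbreviation hist :: "nat \<Rightarrow> 'p measure" where
  "hist n \<equiv> history P C0_borel N n"

abbreviation mut :: "('a \<Rightarrow> real) measure" where
  "mut \<equiv> mu_tilde \<mu> J t"

lemma finite_J: "finite J"
  using J_subset by (rule finite_subset) simp

lemma sets_C0 [measurable]: "C0 \<in> sets C0_borel"
  using sets.top[of C0_borel] by (simp add: space_C0_borel)

lemma sets_Collect_C0:
  assumes "Measurable.pred C0_borel Q"
  shows "{f \<in> C0. Q f} \<in> sets C0_borel"
  using assms by (simp add: pred_def space_C0_borel)

lemma sets_mut: "sets mut = sets C0_borel"
  by (simp add: mu_tilde_def sets_mu)

lemma emeasure_mut:
  assumes "A \<in> sets C0_borel"
  shows "emeasure mut A = emeasure \<mu> {f \<in> A. \<forall>j\<in>J. f (t j) = 0}"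
proof -
  have [measurable]: "countable J" using finite_J by (rule countable_finite)
  have "{f \<in> C0. \<forall>j\<in>J. f (t j) = 0} \<in> sets \<mu>"
    unfolding sets_mu by (rule sets_Collect_C0) measurable
  then have "emeasure mut A = emeasure \<mu> ({f \<in> C0. \<forall>j\<in>J. f (t j) = 0} \<inter> A)"
    unfolding mu_tilde_def using assms by (simp add: emeasure_restricted sets_mu)
  also have "{f \<in> C0. \<forall>j\<in>J. f (t j) = 0} \<inter> A = {f \<in> A. \<forall>j\<in>J. f (t j) = 0}"
    using sets.sets_into_space[OF assms] by (auto simp: space_C0_borel)
  finally show ?thesis .
qed

lemma emeasure_mut_le: "A \<in> sets C0_borel \<Longrightarrow> emeasure mut A \<le> emeasure \<mu> A"
  by (auto simp: emeasure_mut sets_mu intro!: emeasure_mono)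

lemma mut_exceed_finite:
  assumes "l \<in> {1..d}" "0 < e" "A \<in> sets C0_borel" "A \<subseteq> {f \<in> C0. e \<le> f (t l)}"
  shows "emeasure mut A < \<infinity>"
proof -
  have "emeasure mut A \<le> emeasure \<mu> A"
    using assms by (intro emeasure_mut_le)
  \<comment> \<open>The finiteness assumption is about strict inequality; half the level absorbs the
    difference.\<close>
  also have "\<dots> \<le> emeasure \<mu> {f \<in> C0. f (t l) > e / 2}"
    using assms by (intro emeasure_mono) (auto simp: sets_mu intro!: sets_Collect_C0)
  also have "\<dots> < \<infinity>" using assms by (intro exceed_finite) auto
  finally show ?thesis .
qed

lemma emeasure_mu_J:
  assumes "A \<in> sets C0_borel"
  shows "emeasure (mu_J \<mu> J t j) A = emeasure \<mu> {f \<in> A. f (t j) > 0 \<and> (\<forall>k\<in>J. k < j \<longrightarrow> f (t k) = 0)}"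
proof -
  have [measurable]: "countable J" using finite_J by (rule countable_finite)
  have "{f \<in> C0. f (t j) > 0 \<and> (\<forall>k\<in>J. k < j \<longrightarrow> f (t k) = 0)} \<in> sets \<mu>"
    unfolding sets_mu by (rule sets_Collect_C0) measurable
  then have "emeasure (mu_J \<mu> J t j) A =
      emeasure \<mu> ({f \<in> C0. f (t j) > 0 \<and> (\<forall>k\<in>J. k < j \<longrightarrow> f (t k) = 0)} \<inter> A)"
    unfolding mu_J_def using assms by (simp add: emeasure_restricted sets_mu)
  also have "{f \<in> C0. f (t j) > 0 \<and> (\<forall>k\<in>J. k < j \<longrightarrow> f (t k) = 0)} \<inter> A =
      {f \<in> A. f (t j) > 0 \<and> (\<forall>k\<in>J. k < j \<longrightarrow> f (t k) = 0)}"
    using sets.sets_into_space[OF assms] by (auto simp: space_C0_borel)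
  finally show ?thesis .
qed

lemma mu_J_finite:
  assumes "j \<in> J" "A \<in> sets C0_borel"
  shows "emeasure (mu_J \<mu> J t j) A < \<infinity>"
proof -
  have "emeasure (mu_J \<mu> J t j) A \<le> emeasure \<mu> {f \<in> C0. f (t j) > 0}"
    unfolding emeasure_mu_J[OF assms(2)] using sets.sets_into_space[OF assms(2)]
    by (intro emeasure_mono) (auto simp: sets_mu space_C0_borel intro!: sets_Collect_C0)
  then show ?thesis using J_finite[OF assms(1)] by (rule le_less_trans)
qed

text \<open>An invariant of runs. Positive lower levels make the intensities finite, nonnegativity
  lets maxima be written with zero included, and \<open>Xt (t i) = 0\<close> during a search keeps
  small thresholds at \<open>t i\<close> respected in the termination argument.\<close>

fun valid :: "'a config \<Rightarrow> bool" where
  "valid (Zeros j Xh) \<longleftrightarrow> 1 \<le> j \<and> (\<forall>k x. 0 \<le> Xh k x)"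
| "valid (Outer i Xh Xt) \<longleftrightarrow> 1 \<le> i \<and> i \<le> d + 1 \<and> (\<forall>k x. 0 \<le> Xh k x) \<and> (\<forall>x. 0 \<le> Xt x)"
| "valid (Search i Xh Xt cu cl) \<longleftrightarrow> i \<in> {1..d} - J \<and> (\<forall>k x. 0 \<le> Xh k x) \<and> (\<forall>x. 0 \<le> Xt x) \<and>
    Xt (t i) = 0 \<and> 0 < cl \<and> ereal cl < cu"
| "valid (Stopped X) \<longleftrightarrow> (\<forall>x. 0 \<le> X x)"

lemma valid_step:
  assumes "valid C" "finite (atoms M)" "atoms M \<subseteq> C0"
  shows "valid (step J d t c C M)"
proof (cases C)
  case (Zeros j Xh)
  then show ?thesis using assms by (auto simp: pmax_nonneg)
next
  case (Outer i Xh Xt)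
  then show ?thesis using assms c_pos by (auto simp: update_def le_max_iff_disj not_less)
next
  case (Search i Xh Xt cu cl)
  then show ?thesis using assms by (auto simp: update_def le_max_iff_disj)
next
  case (Stopped X)
  then show ?thesis using assms by simp
qed

lemma emeasure_intensity_band:
  assumes A: "A \<in> sets C0_borel"
  shows "emeasure (density mut (indicator {f \<in> C0. cu > ereal (f a) \<and> f a \<ge> cl})) A =
    emeasure mut {f \<in> A. ereal (f a) < cu \<and> cl \<le> f a}"
proof -
  have "{f \<in> C0. cu > ereal (f a) \<and> f a \<ge> cl} \<in> sets mut"
    unfolding sets_mut by (rule sets_Collect_C0) measurable
  then have "emeasure (density mut (indicator {f \<in> C0. cu > ereal (f a) \<and> f a \<ge> cl})) A =
      emeasure mut ({f \<in> C0. cu > ereal (f a) \<and> f a \<ge> cl} \<inter> A)"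
    using A by (simp add: emeasure_restricted sets_mut)
  also have "{f \<in> C0. cu > ereal (f a) \<and> f a \<ge> cl} \<inter> A = {f \<in> A. ereal (f a) < cu \<and> cl \<le> f a}"
    using sets.sets_into_space[OF A] by (auto simp: space_C0_borel)
  finally show ?thesis .
qed

lemma band_finite:
  assumes "i \<in> {1..d}" "0 < cl"
  shows "emeasure (density mut (indicator {f \<in> C0. cu > ereal (f (t i)) \<and> f (t i) \<ge> cl})) (space C0_borel) < \<infinity>"
proof -
  have "emeasure mut {f \<in> C0. ereal (f (t i)) < cu \<and> cl \<le> f (t i)} < \<infinity>"
    using assms by (intro mut_exceed_finite[of i cl]) (auto intro!: sets_Collect_C0)
  then show ?thesis by (subst emeasure_intensity_band) (auto simp: space_C0_borel)
qed

lemma valid_intensity_finite: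
  assumes "valid C"
  shows "emeasure (intensity \<mu> J d t C) (space C0_borel) < \<infinity>"
proof (cases C)
  case (Zeros j Xh)
  then show ?thesis using mu_J_finite[of j "space C0_borel"] by auto
next
  case (Outer i Xh Xt)
  show ?thesis
  proof (cases "i \<le> d \<and> i \<notin> J \<and> Xt (t i) \<noteq> 0")
    case True
    then have "0 < Xt (t i)" "i \<in> {1..d}" using assms Outer by (auto simp: less_le)
    then show ?thesis
      using True band_finite[of i "Xt (t i)" \<infinity>] by (simp add: Outer)
  qed (auto simp: Outer)
next
  case (Search i Xh Xt cu cl)
  then show ?thesis using assms band_finite[of i cl cu] by simp
next
  case (Stopped X)
  then show ?thesis by simp
qed

lemma prm_run: "prm_given P (hist n) C0_borel (N n) (\<lambda>w. intensity \<mu> J d t (cfg n w))"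
  using run by (simp add: is_run_def)

lemma point_measure: "w \<in> space P \<Longrightarrow> is_point_measure C0_borel (N n w)"
  using prm_run by (simp add: prm_given_def)

lemma atoms_C0: "w \<in> space P \<Longrightarrow> atoms (N n w) \<subseteq> C0"
  using atoms_subset[OF point_measure] by (simp add: space_C0_borel)

text \<open>Both hold at every sample point, not only almost surely: a valid configuration asks for
  a finite intensity, this makes the simulated measure finite, and finitely many atoms lead to a
  valid configuration again.\<close>

lemma valid_cfg: "w \<in> space P \<Longrightarrow> valid (cfg n w)"
  and finite_atoms: "w \<in> space P \<Longrightarrow> finite (atoms (N n w))"
proof -
  have fin: "finite (atoms (N n w))" if "w \<in> space P" "valid (cfg n w)" for n
  proof -
    have "emeasure (N n w) (space C0_borel) < \<infinity>"
      using prm_run[of n] that valid_intensity_finite[OF that(2)] by (simp add: prm_given_def)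
    from finite_atoms_Int[OF point_measure[OF that(1)] _ this] show ?thesis
      using atoms_C0[OF that(1), of n] by (simp add: space_C0_borel Int_absorb2)
  qed
  show valid: "valid (cfg n w)" if "w \<in> space P"
    by (induction n) (use that fin atoms_C0 in \<open>auto intro!: valid_step\<close>)
  then show "finite (atoms (N n w))" if "w \<in> space P"
    using that fin by simp
qed

lemma intensity_cfg_finite:
  "w \<in> space P \<Longrightarrow> emeasure (intensity \<mu> J d t (cfg n w)) (space C0_borel) < \<infinity>"
  by (rule valid_intensity_finite[OF valid_cfg])

lemma space_hist: "space (hist n) = space P"
  unfolding history_def by (subst space_measure_of_conv) auto

lemma sets_hist: "sets (hist n) = sigma_sets (space P)
    {{w \<in> space P. emeasure (N m w) A \<in> B} |m A B. m < n \<and> A \<in> sets C0_borel \<and> B \<in> sets borel}"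
  unfolding history_def by (subst sets_measure_of) auto

lemma subalgebra_hist: "subalgebra P (hist n)"
  unfolding subalgebra_def
proof
  have "{{w \<in> space P. emeasure (N m w) A \<in> B} |m A B. m < n \<and> A \<in> sets C0_borel \<and> B \<in> sets borel}
      \<subseteq> sets P"
  proof safe
    fix m and A :: "('a \<Rightarrow> real) set" and B :: "ennreal set" assume "A \<in> sets C0_borel" "B \<in> sets borel"
    moreover from this have "(\<lambda>w. emeasure (N m w) A) \<in> borel_measurable P"
      using prm_run[of m] by (simp add: prm_given_def)
    ultimately show "{w \<in> space P. emeasure (N m w) A \<in> B} \<in> sets P"
      using measurable_sets[of "\<lambda>w. emeasure (N m w) A" P borel B]
      by (simp add: vimage_def Int_def conj_commute)
  qed
  then show "sets (hist n) \<subseteq> sets P"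
    unfolding sets_hist by (rule sets.sigma_sets_subset)
qed (rule space_hist)

lemma subalgebra_hist_mono:
  assumes "m \<le> n"
  shows "subalgebra (hist n) (hist m)"
proof -
  have "{{w \<in> space P. emeasure (N k w) A \<in> B} |k A B. k < m \<and> A \<in> sets C0_borel \<and> B \<in> sets borel}
      \<subseteq> {{w \<in> space P. emeasure (N k w) A \<in> B} |k A B. k < n \<and> A \<in> sets C0_borel \<and> B \<in> sets borel}"
    using less_le_trans[OF _ assms] by blast
  then show ?thesis
    unfolding subalgebra_def space_hist sets_hist by (intro conjI refl sigma_sets_mono')
qed

lemma points_hist: "random_finite_set (hist (Suc n)) C0_borel (\<lambda>w. atoms (N n w))"
proof
  fix A :: "('a \<Rightarrow> real) set" assume A: "A \<in> sets C0_borel"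
  have "{w \<in> space (hist (Suc n)). atoms (N n w) \<inter> A = {}} = {w \<in> space P. emeasure (N n w) A \<in> {0}}"
    using point_measure_eq_0_iff[OF point_measure A] by (auto simp: space_hist)
  also have "\<dots> \<in> sets (hist (Suc n))"
    unfolding sets_hist using A by (intro sigma_sets.Basic CollectI exI[of _ n] exI[of _ A] exI[of _ "{0}"]) auto
  finally show "{w \<in> space (hist (Suc n)). atoms (N n w) \<inter> A = {}} \<in> sets (hist (Suc n))" .
qed (use finite_atoms atoms_C0 in \<open>auto simp: space_hist space_C0_borel\<close>)

end

section \<open>Measurability of the configurations\<close>

text \<open>Configurations carry no \<sigma>-algebra. They are described by coordinates with
  numerical values, functions being evaluated at each point; a constructor without a coordinate gets
  a default value.\<close>

fun phase :: "'a config \<Rightarrow> nat" where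
  "phase (Zeros j Xh) = 0"
| "phase (Outer i Xh Xt) = 1"
| "phase (Search i Xh Xt cu cl) = 2"
| "phase (Stopped X) = 3"

fun index :: "'a config \<Rightarrow> nat" where
  "index (Zeros j Xh) = j"
| "index (Outer i Xh Xt) = i"
| "index (Search i Xh Xt cu cl) = i"
| "index (Stopped X) = 0"

fun current :: "'a config \<Rightarrow> 'a \<Rightarrow> real" where
  "current (Zeros j Xh) = (\<lambda>_. 0)"
| "current (Outer i Xh Xt) = Xt"
| "current (Search i Xh Xt cu cl) = Xt"
| "current (Stopped X) = X"

fun zero_part :: "'a config \<Rightarrow> nat \<Rightarrow> 'a \<Rightarrow> real" where
  "zero_part (Zeros j Xh) = Xh"
| "zero_part (Outer i Xh Xt) = Xh"
| "zero_part (Search i Xh Xt cu cl) = Xh"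
| "zero_part (Stopped X) = (\<lambda>_ _. 0)"

text \<open>The default \<infinity> makes the condition on the upper level void outside the search,
  so that the potential has one formula for \<open>Outer\<close> and \<open>Search\<close>, and step
  3(b) is a band without upper bound.\<close>

fun upper :: "'a config \<Rightarrow> ereal" where
  "upper (Search i Xh Xt cu cl) = cu"
| "upper _ = \<infinity>"

fun lower :: "'a config \<Rightarrow> real" where
  "lower (Search i Xh Xt cu cl) = cl"
| "lower _ = 0"

lemma admissible_eq:
  "admissible J t i Xt M = {f \<in> atoms M. \<forall>k. 1 \<le> k \<and> k < i \<and> k \<notin> J \<longrightarrow> f (t k) < Xt (t k)}"
  unfolding admissible_def by (auto simp: not_le)

text \<open>Being a maximizer relates pairs of functions; comparing with the maximal level turns it
  into a condition on one function with a random threshold, which is itself a maximum over the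
  atoms. The inserted zero is harmless by nonnegativity.\<close>

lemma update_eq_Max:
  assumes "finite A" "A \<subseteq> C0"
  shows "update t i A Xt x = max (Max (insert 0 ((\<lambda>f. f x) `
    {f \<in> A. Max (insert 0 ((\<lambda>g. g (t i)) ` A)) \<le> f (t i)}))) (Xt x)"
proof -
  have "{f \<in> A. \<forall>g\<in>A. f (t i) \<ge> g (t i)} = {f \<in> A. Max (insert 0 ((\<lambda>g. g (t i)) ` A)) \<le> f (t i)}"
    using assms C0_nonneg by auto
  moreover have "pmax {f \<in> A. Max (insert 0 ((\<lambda>g. g (t i)) ` A)) \<le> f (t i)} x =
      Max (insert 0 ((\<lambda>f. f x) ` {f \<in> A. Max (insert 0 ((\<lambda>g. g (t i)) ` A)) \<le> f (t i)}))"
    using assms by (intro pmax_eq_Max) auto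
  ultimately show ?thesis by (simp add: update_def)
qed

text \<open>The counterpart of \<open>pmax_eq_Max\<close> for the functions computed in step 2,
  which need not lie in \<open>C0\<close>: such a function is zero when no atom was
  simulated.\<close>

lemma pmax_image_eq_Max:
  assumes "finite J" "\<And>k x. 0 \<le> Xh k x"
  shows "pmax (Xh ` J) x = Max (insert 0 ((\<lambda>k. Xh k x) ` J))"
proof (cases "J = {}")
  case False
  then have "Max ((\<lambda>k. Xh k x) ` J) \<in> (\<lambda>k. Xh k x) ` J"
    using assms(1) by (intro Max_in) auto
  then have "0 \<le> Max ((\<lambda>k. Xh k x) ` J)"
    using assms(2) by fastforce
  then show ?thesis
    using False assms(1) by (simp add: pmax_def image_image cSup_eq_Max max_def)
qed (simp add: pmax_def)

context simulation
begin

lemma phase_step: "phase (step J d t c C M) =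
  (if phase C = 0 then if index C > d then 1 else 0
   else if phase C = 1 then
     if index C > d then 3 else if index C \<in> J then 1 else if current C (t (index C)) = 0 then 2 else 1
   else if phase C = 2 then if admissible J t (index C) (current C) M = {} then 2 else 1
   else 3)"
  by (cases C) auto

lemma index_step: "index (step J d t c C M) =
  (if phase C = 0 then if index C > d then 1 else index C + 1
   else if phase C = 1 then
     if index C > d then 0 else if index C \<in> J then index C + 1
     else if current C (t (index C)) = 0 then index C else index C + 1
   else if phase C = 2 then if admissible J t (index C) (current C) M = {} then index C else index C + 1
   else 0)"
  by (cases C) auto

lemma current_step:
  assumes "valid C"
  shows "current (step J d t c C M) x =
  (if phase C = 1 \<and> index C > d then max (Max (insert 0 ((\<lambda>k. zero_part C k x) ` J))) (current C x)
   else if phase C = 1 \<and> index C \<notin> J \<and> current C (t (index C)) \<noteq> 0 \<or> phase C = 2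
   then update t (index C) (admissible J t (index C) (current C) M) (current C) x
   else current C x)"
proof (cases C)
  case (Outer i Xh Xt)
  then have "\<And>k x. 0 \<le> Xh k x" using assms by simp
  then show ?thesis by (simp add: Outer pmax_image_eq_Max[OF finite_J])
next
  case (Search i Xh Xt cu cl)
  \<comment> \<open>The maximum over the empty set is zero, so updating with no functions leaves the
    nonnegative \<open>Xt\<close> unchanged and an unsuccessful search needs no separate
    case.\<close>
  then have "0 \<le> Xt x" using assms by simp
  then show ?thesis
    by (cases "admissible J t i Xt M = {}") (simp_all add: Search update_def pmax_def)
qed simp_all

lemma zero_part_step: "zero_part (step J d t c C M) k x =
  (if phase C = 0 \<and> index C \<le> d \<and> index C \<in> J \<and> k = index C then pmax (atoms M) x
   else if phase C = 1 \<and> index C > d then 0 else zero_part C k x)"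
  by (cases C) auto

lemma upper_step: "upper (step J d t c C M) =
  (if phase C = 2 \<and> admissible J t (index C) (current C) M = {} then ereal (lower C) else \<infinity>)"
  by (cases C) auto

lemma lower_step: "lower (step J d t c C M) =
  (if phase C = 1 \<and> index C \<le> d \<and> index C \<notin> J \<and> current C (t (index C)) = 0 then c (index C)
   else if phase C = 2 \<and> admissible J t (index C) (current C) M = {} then lower C / 2 else 0)"
  by (cases C) auto

definition observable :: "nat \<Rightarrow> bool" where
  "observable n \<longleftrightarrow>
    (\<lambda>w. phase (cfg n w)) \<in> measurable (hist n) (count_space UNIV) \<and>
    (\<lambda>w. index (cfg n w)) \<in> measurable (hist n) (count_space UNIV) \<and>
    (\<forall>x. (\<lambda>w. current (cfg n w) x) \<in> borel_measurable (hist n)) \<and>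
    (\<forall>k x. (\<lambda>w. zero_part (cfg n w) k x) \<in> borel_measurable (hist n)) \<and>
    (\<lambda>w. upper (cfg n w)) \<in> borel_measurable (hist n) \<and>
    (\<lambda>w. lower (cfg n w)) \<in> borel_measurable (hist n)"

text \<open>The new coordinates are built from the old ones and from maxima and emptiness conditions
  over the atoms. As the treated index is random, these are shown to be measurable for each fixed
  index and then composed with the observable index, which takes countably many values.\<close>

lemma observable_step:
  assumes "observable n"
  shows "observable (Suc n)"
proof -
  let ?H = "hist (Suc n)"
  interpret Z: random_finite_set ?H C0_borel "\<lambda>w. atoms (N n w)"
    by (rule points_hist)
  have sub: "subalgebra ?H (hist n)"
    by (rule subalgebra_hist_mono) simp
  have ph[measurable]: "(\<lambda>w. phase (cfg n w)) \<in> measurable ?H (count_space UNIV)"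
    and ix[measurable]: "(\<lambda>w. index (cfg n w)) \<in> measurable ?H (count_space UNIV)"
    and cu[measurable]: "\<And>x. (\<lambda>w. current (cfg n w) x) \<in> borel_measurable ?H"
    and zp[measurable]: "\<And>k x. (\<lambda>w. zero_part (cfg n w) k x) \<in> borel_measurable ?H"
    and lw[measurable]: "(\<lambda>w. lower (cfg n w)) \<in> borel_measurable ?H"
    using assms unfolding observable_def by (blast intro: measurable_from_subalg[OF sub])+
  have ev[measurable]: "(\<lambda>p. snd p x) \<in> borel_measurable (?H \<Otimes>\<^sub>M C0_borel)" for x
    using measurable_compose[OF measurable_snd borel_measurable_eval] .
  have cuf[measurable]: "(\<lambda>p. current (cfg n (fst p)) x) \<in> borel_measurable (?H \<Otimes>\<^sub>M C0_borel)" for x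
    using measurable_compose[OF measurable_fst cu] .
  define D where "D i w f \<longleftrightarrow> (\<forall>k. 1 \<le> k \<and> k < i \<and> k \<notin> J \<longrightarrow> f (t k) < current (cfg n w) (t k))"
    for i w and f :: "'a \<Rightarrow> real"
  have D[measurable]: "Measurable.pred (?H \<Otimes>\<^sub>M C0_borel) (\<lambda>p. D i (fst p) (snd p))" for i
    unfolding D_def by measurable
  have adm: "admissible J t i (current (cfg n w)) (N n w) = {f \<in> atoms (N n w). D i w f}" for i w
    unfolding admissible_eq D_def ..
  have "(admissible J t i (current (cfg n w)) (N n w) = {}) \<longleftrightarrow> (\<forall>f\<in>atoms (N n w). \<not> D i w f)" for i w
    by (auto simp: adm)
  moreover have "Measurable.pred ?H (\<lambda>w. \<forall>f\<in>atoms (N n w). \<not> D i w f)" for i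
    by (rule Z.pred_avoid) measurable
  ultimately have "(\<lambda>w. admissible J t i (current (cfg n w)) (N n w) = {}) \<in> measurable ?H (count_space UNIV)" for i
    by presburger
  then have adm_empty[measurable]:
      "Measurable.pred ?H (\<lambda>w. admissible J t (index (cfg n w)) (current (cfg n w)) (N n w) = {})"
    by (rule measurable_compose_countable) (rule ix)
  have curi[measurable]: "(\<lambda>w. current (cfg n w) (t (index (cfg n w)))) \<in> borel_measurable ?H"
    by (rule measurable_compose_countable[OF _ ix]) (rule cu)
  have ci[measurable]: "(\<lambda>w. c (index (cfg n w))) \<in> borel_measurable ?H"
    by (rule measurable_compose_countable[OF _ ix]) simp
  have "(\<lambda>w. update t i (admissible J t i (current (cfg n w)) (N n w)) (current (cfg n w)) x)
      \<in> borel_measurable ?H" for i x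
  proof -
    define m where "m w = Max (insert 0 ((\<lambda>f. f (t i)) ` {f \<in> atoms (N n w). D i w f}))" for w
    have "(\<lambda>w. Max (insert ((\<lambda>_. 0) w) ((\<lambda>f. f (t i)) ` {f \<in> atoms (N n w). D i w f}))) \<in> borel_measurable ?H"
      by (rule Z.borel_measurable_Max) measurable
    then have m: "m \<in> borel_measurable ?H" by (simp add: m_def[abs_def])
    have [measurable]: "(\<lambda>p. m (fst p)) \<in> borel_measurable (?H \<Otimes>\<^sub>M C0_borel)"
      using measurable_compose[OF measurable_fst m] .
    have "(\<lambda>w. max (Max (insert ((\<lambda>_. 0) w) ((\<lambda>f. f x) ` {f \<in> atoms (N n w). D i w f \<and> m w \<le> f (t i)})))
        (current (cfg n w) x)) \<in> borel_measurable ?H"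
      by (rule borel_measurable_max[OF cu Z.borel_measurable_Max[where b = "\<lambda>_. 0" and g = "\<lambda>f. f x"
          and D = "\<lambda>w f. D i w f \<and> m w \<le> f (t i)"]]) measurable
    moreover have "update t i (admissible J t i (current (cfg n w)) (N n w)) (current (cfg n w)) x =
      max (Max (insert ((\<lambda>_. 0) w) ((\<lambda>f. f x) ` {f \<in> atoms (N n w). D i w f \<and> m w \<le> f (t i)})))
        (current (cfg n w) x)" if "w \<in> space ?H" for w
      using finite_atoms[of w n] atoms_C0[of w n] that
      unfolding adm by (subst update_eq_Max) (auto simp: space_hist m_def Collect_conj_eq intro!: arg_cong2[where f = max] arg_cong[where f = Max])
    ultimately show ?thesis
      by (rule measurable_cong[THEN iffD2, rotated])
  qed
  then have upd[measurable]: "(\<lambda>w. update t (index (cfg n w))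
      (admissible J t (index (cfg n w)) (current (cfg n w)) (N n w)) (current (cfg n w)) x) \<in> borel_measurable ?H" for x
    by (rule measurable_compose_countable) (rule ix)
  have pm[measurable]: "(\<lambda>w. pmax (atoms (N n w)) x) \<in> borel_measurable ?H" for x
  proof -
    have "(\<lambda>w. Max (insert ((\<lambda>_. 0) w) ((\<lambda>f. f x) ` {f \<in> atoms (N n w). True}))) \<in> borel_measurable ?H"
      by (rule Z.borel_measurable_Max) measurable
    then show ?thesis
      by (rule measurable_cong[THEN iffD1, rotated])
        (simp add: pmax_eq_Max finite_atoms atoms_C0 space_hist)
  qed
  have "(\<lambda>w. Max (insert 0 ((\<lambda>k. zero_part (cfg n w) k x) ` K))) \<in> borel_measurable ?H"
    if "finite K" for x K
    using that
  proof (induction rule: finite_induct)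
    case (insert j K)
    have "Max (insert 0 ((\<lambda>k. zero_part (cfg n w) k x) ` insert j K)) =
        max (zero_part (cfg n w) j x) (Max (insert 0 ((\<lambda>k. zero_part (cfg n w) k x) ` K)))" for w
      using insert(1) by (simp add: insert_commute[of 0])
    then show ?case using borel_measurable_max[OF insert(3) zp] by simp
  qed simp
  from this[OF finite_J] have zmax[measurable]:
    "(\<lambda>w. Max (insert 0 ((\<lambda>k. zero_part (cfg n w) k x) ` J))) \<in> borel_measurable ?H" for x .
  have "(\<lambda>w. current (cfg (Suc n) w) x) \<in> borel_measurable ?H" for x
  proof -
    have "(\<lambda>w. if phase (cfg n w) = 1 \<and> index (cfg n w) > d
        then max (Max (insert 0 ((\<lambda>k. zero_part (cfg n w) k x) ` J))) (current (cfg n w) x)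
      else if phase (cfg n w) = 1 \<and> index (cfg n w) \<notin> J \<and> current (cfg n w) (t (index (cfg n w))) \<noteq> 0 \<or>
        phase (cfg n w) = 2
      then update t (index (cfg n w)) (admissible J t (index (cfg n w)) (current (cfg n w)) (N n w))
        (current (cfg n w)) x
      else current (cfg n w) x) \<in> borel_measurable ?H"
      by measurable
    then show ?thesis
      by (rule measurable_cong[THEN iffD1, rotated])
        (simp add: current_step[OF valid_cfg] space_hist)
  qed
  moreover have "(\<lambda>w. phase (cfg (Suc n) w)) \<in> measurable ?H (count_space UNIV)"
    unfolding config_at.simps phase_step by measurable
  moreover have "(\<lambda>w. index (cfg (Suc n) w)) \<in> measurable ?H (count_space UNIV)"
    unfolding config_at.simps index_step by measurable
  moreover have "(\<lambda>w. zero_part (cfg (Suc n) w) k x) \<in> borel_measurable ?H" for k x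
    unfolding config_at.simps zero_part_step by measurable
  moreover have "(\<lambda>w. upper (cfg (Suc n) w)) \<in> borel_measurable ?H"
    unfolding config_at.simps upper_step by measurable
  moreover have "(\<lambda>w. lower (cfg (Suc n) w)) \<in> borel_measurable ?H"
    unfolding config_at.simps lower_step by measurable
  ultimately show ?thesis
    unfolding observable_def by blast
qed

lemma observable: "observable n"
proof (induction n)
  case 0
  then show ?case by (simp add: observable_def)
qed (rule observable_step)

lemma
  phase_measurable: "(\<lambda>w. phase (cfg n w)) \<in> measurable (hist n) (count_space UNIV)" and
  index_measurable: "(\<lambda>w. index (cfg n w)) \<in> measurable (hist n) (count_space UNIV)" and
  current_measurable: "(\<lambda>w. current (cfg n w) x) \<in> borel_measurable (hist n)" and
  zero_part_measurable: "(\<lambda>w. zero_part (cfg n w) k x) \<in> borel_measurable (hist n)" and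
  upper_measurable: "(\<lambda>w. upper (cfg n w)) \<in> borel_measurable (hist n)" and
  lower_measurable: "(\<lambda>w. lower (cfg n w)) \<in> borel_measurable (hist n)"
  using observable[of n] unfolding observable_def by blast+


section \<open>The potential along one transition\<close>

definition exceeding :: "(nat \<Rightarrow> real) \<Rightarrow> ('a \<Rightarrow> real) set" where
  "exceeding y = {f \<in> C0. \<exists>l\<in>{1..d}. y l < f (t l)}"

definition below :: "nat \<Rightarrow> ('a \<Rightarrow> real) \<Rightarrow> ('a \<Rightarrow> real) \<Rightarrow> bool" where
  "below i h f \<longleftrightarrow> (\<forall>k. 1 \<le> k \<and> k < i \<and> k \<notin> J \<longrightarrow> f (t k) < h (t k))"

lemma admissible_below: "admissible J t i h M = {f \<in> atoms M. below i h f}"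
  unfolding admissible_eq below_def ..

lemma below_Suc: "1 \<le> i \<Longrightarrow> i \<notin> J \<Longrightarrow> below (Suc i) h f \<longleftrightarrow> below i h f \<and> f (t i) < h (t i)"
  unfolding below_def by (auto simp: less_Suc_eq)

lemma sets_exceeding: "exceeding y \<in> sets C0_borel"
  unfolding exceeding_def by (rule sets_Collect_C0) measurable

lemma exceeding_finite:
  assumes "\<And>l. 0 < y l"
  shows "emeasure \<mu> (exceeding y) < \<infinity>"
proof -
  have "exceeding y = (\<Union>l\<in>{1..d}. {f \<in> C0. f (t l) > y l})"
    by (auto simp: exceeding_def)
  then have "emeasure \<mu> (exceeding y) \<le> (\<Sum>l\<in>{1..d}. emeasure \<mu> {f \<in> C0. f (t l) > y l})"
    by (simp only:) (intro emeasure_subadditive_finite, auto simp: sets_mu intro!: sets_Collect_C0)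
  also have "\<dots> < \<infinity>"
    using exceed_finite[OF _ assms] by (simp add: ennreal_sum_less_top)
  finally show ?thesis .
qed

lemma mut_exceeding_finite:
  assumes "\<And>l. 0 < y l" "A \<subseteq> exceeding y"
  shows "emeasure mut A < \<infinity>"
proof -
  have "emeasure mut A \<le> emeasure mut (exceeding y)"
    using assms(2) by (intro emeasure_mono) (auto simp: sets_mut sets_exceeding)
  also have "\<dots> \<le> emeasure \<mu> (exceeding y)" by (rule emeasure_mut_le[OF sets_exceeding])
  finally show ?thesis using exceeding_finite[OF assms(1)] by (rule le_less_trans)
qed

text \<open>The conditional probability, given the current configuration, that in the end the functions
  computed in step 2 are bounded by \<open>y\<close> and the one computed in step 3 is bounded by \<open>z\<close> at the
  points \<open>t 1, \<dots>, t d\<close>.\<close>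

definition potential :: "(nat \<Rightarrow> real) \<Rightarrow> (nat \<Rightarrow> real) \<Rightarrow> 'a config \<Rightarrow> real" where
  "potential y z C =
    (if phase C = 0 then
       if \<forall>k\<in>J. k < index C \<longrightarrow> (\<forall>l\<in>{1..d}. zero_part C k (t l) \<le> y l)
       then exp (- (\<Sum>k\<in>{k \<in> J. index C \<le> k}. measure (mu_J \<mu> J t k) (exceeding y)) - measure mut (exceeding z))
       else 0
     else if phase C = 3 then if \<forall>l\<in>{1..d}. current C (t l) \<le> min (y l) (z l) then 1 else 0
     else
       if (\<forall>k\<in>J. \<forall>l\<in>{1..d}. zero_part C k (t l) \<le> y l) \<and> (\<forall>l\<in>{1..d}. current C (t l) \<le> z l)
       then exp (- measure mut {f \<in> exceeding z. below (index C) (current C) f \<and>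
         ereal (f (t (index C))) < upper C})
       else 0)"

lemma potential_le_1: "potential y z C \<le> 1"
proof -
  have "0 \<le> (\<Sum>k\<in>{k \<in> J. index C \<le> k}. measure (mu_J \<mu> J t k) (exceeding y)) + measure mut (exceeding z)"
    by (intro add_nonneg_nonneg sum_nonneg) auto
  then show ?thesis
    by (auto simp: potential_def)
qed

lemma potential_eq_0:
  assumes "phase C = 1 \<or> phase C = 2"
    and "\<not> ((\<forall>k\<in>J. \<forall>l\<in>{1..d}. zero_part C k (t l) \<le> y l) \<and> (\<forall>l\<in>{1..d}. current C (t l) \<le> z l))"
  shows "potential y z C = 0"
proof -
  have "phase C \<noteq> 0" "phase C \<noteq> 3" using assms(1) by auto
  then show ?thesis unfolding potential_def using assms(2) by (simp only: if_False simp_thms)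
qed

text \<open>The simulated measure does not influence the potential here: either the transition is
  deterministic, or a threshold is already violated and the potential is zero before and after. Only
  the stopping transition separates \<open>y\<close> from \<open>z\<close>, as it compares the
  overall maximum with both, whereas before each part is compared with its own thresholds.\<close>

lemma potential_not_active_step:
  assumes C: "valid C" and z: "\<And>l. 0 < z l"
    and not0: "\<not> (phase C = 0 \<and> index C \<in> J \<and>
      (\<forall>k\<in>J. k < index C \<longrightarrow> (\<forall>l\<in>{1..d}. zero_part C k (t l) \<le> y l)))"
    and not1: "\<not> ((phase C = 2 \<or> phase C = 1 \<and> index C \<le> d \<and> index C \<notin> J \<and> current C (t (index C)) \<noteq> 0) \<and>
      (\<forall>k\<in>J. \<forall>l\<in>{1..d}. zero_part C k (t l) \<le> y l) \<and> (\<forall>l\<in>{1..d}. current C (t l) \<le> z l))"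
    and M: "finite (atoms M)" "atoms M \<subseteq> C0"
  shows "potential y z (step J d t c C M) \<le> potential y z C \<and>
    (y = z \<longrightarrow> potential y z (step J d t c C M) = potential y z C)"
proof (cases C)
  case (Zeros j Xh)
  consider "j > d" | "j \<le> d" "j \<notin> J" | "j \<le> d" "j \<in> J" by force
  then show ?thesis
  proof cases
    case 1
    then have *: "{k \<in> J. j \<le> k} = {}" "\<And>k. k \<in> J \<Longrightarrow> k < j" "{f \<in> exceeding z. below 1 (\<lambda>_. 0) f} = exceeding z"
      using J_subset by (auto simp: below_def)
    have "(\<Sum>k | k \<in> J \<and> j \<le> k. measure (mu_J \<mu> J t k) (exceeding y)) = 0"
      unfolding *(1) by simp
    then show ?thesis
      using 1 *(2,3) z[THEN less_imp_le] by (auto simp: Zeros potential_def)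
  next
    case 2
    then have *: "{k \<in> J. j \<le> k} = {k \<in> J. j + 1 \<le> k}" "\<And>k. k \<in> J \<Longrightarrow> k < j + 1 \<longleftrightarrow> k < j"
      by (auto simp: Suc_le_eq le_less less_Suc_eq)
    then show ?thesis
      using 2 by (auto simp: Zeros potential_def)
  next
    case 3
    then obtain k l where "k \<in> J" "k < j" "l \<in> {1..d}" "\<not> Xh k (t l) \<le> y l"
      using not0 Zeros by auto
    moreover from this have "\<not> (Xh(j := pmax (atoms M))) k (t l) \<le> y l" by simp
    ultimately have "\<not> (\<forall>k\<in>J. k < j + 1 \<longrightarrow> (\<forall>l\<in>{1..d}. (Xh(j := pmax (atoms M))) k (t l) \<le> y l))"
      using less_Suc_eq unfolding add_0_right Suc_eq_plus1[symmetric] by blast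
    then have "potential y z (step J d t c C M) = 0"
      using 3 unfolding Zeros potential_def by (simp del: fun_upd_apply)
    moreover have "\<not> (\<forall>k\<in>J. k < j \<longrightarrow> (\<forall>l\<in>{1..d}. Xh k (t l) \<le> y l))"
      using \<open>k \<in> J\<close> \<open>k < j\<close> \<open>l \<in> {1..d}\<close> \<open>\<not> Xh k (t l) \<le> y l\<close> by blast
    then have "potential y z C = 0" unfolding Zeros potential_def by simp
    ultimately have "potential y z (step J d t c C M) = potential y z C" by linarith
    from this eq_refl[OF this] show ?thesis by blast
  qed
next
  case (Outer i Xh Xt)
  have nn: "\<And>k x. 0 \<le> Xh k x" "\<And>x. 0 \<le> Xt x" "1 \<le> i" "i \<le> d + 1" using C Outer by auto
  consider "i > d" | "i \<le> d" "i \<in> J" | "i \<le> d" "i \<notin> J" "Xt (t i) = 0" | "i \<le> d" "i \<notin> J" "Xt (t i) \<noteq> 0"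
    by force
  then show ?thesis
  proof cases
    case 1
    have le: "max (pmax (Xh ` J) x) (Xt x) \<le> r \<longleftrightarrow> (\<forall>k\<in>J. Xh k x \<le> r) \<and> Xt x \<le> r" if "0 \<le> r" for x r
      using that by (simp add: pmax_image_eq_Max[OF finite_J nn(1)] finite_J)
    have "current (step J d t c C M) = (\<lambda>x. max (pmax (Xh ` J) x) (Xt x))" "phase (step J d t c C M) = 3"
      using 1 by (simp_all add: Outer)
    then have step: "potential y z (step J d t c C M) =
        (if \<forall>l\<in>{1..d}. max (pmax (Xh ` J) (t l)) (Xt (t l)) \<le> min (y l) (z l) then 1 else 0)"
      by (simp add: potential_def)
    \<comment> \<open>No mass is left once all indices are treated: functions in the support of the
      restriction vanish at the points of \<open>J\<close>, where they respect the positive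
      thresholds, and at the other points they lie below \<open>Xt\<close>, hence below the
      thresholds.\<close>
    have "measure mut {f \<in> exceeding z. below i Xt f} = 0" if "\<forall>l\<in>{1..d}. Xt (t l) \<le> z l"
    proof -
      have cJ[measurable]: "countable J" using finite_J by (rule countable_finite)
      have sets: "{f \<in> exceeding z. below i Xt f} \<in> sets C0_borel"
        unfolding exceeding_def below_def Collect_conj_eq[symmetric] mem_Collect_eq conj_assoc
        by (rule sets_Collect_C0) measurable
      have empty: "{f \<in> {f \<in> exceeding z. below i Xt f}. \<forall>j\<in>J. f (t j) = 0} = {}"
      proof (rule ccontr)
        assume "{f \<in> {f \<in> exceeding z. below i Xt f}. \<forall>j\<in>J. f (t j) = 0} \<noteq> {}"
        then obtain f l where f: "below i Xt f" "\<forall>j\<in>J. f (t j) = 0" "l \<in> {1..d}" "z l < f (t l)"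
          by (auto simp: exceeding_def)
        show False
        proof (cases "l \<in> J")
          case True
          then show False using f z[of l] by auto
        next
          case False
          then have "f (t l) < Xt (t l)" using f 1 by (auto simp: below_def)
          then show False using f that by fastforce
        qed
      qed
      show ?thesis unfolding measure_def emeasure_mut[OF sets] empty by simp
    qed
    then have pot: "potential y z C =
        (if (\<forall>k\<in>J. \<forall>l\<in>{1..d}. Xh k (t l) \<le> y l) \<and> (\<forall>l\<in>{1..d}. Xt (t l) \<le> z l) then 1 else 0)"
      by (auto simp: potential_def Outer)
    have "(\<forall>k\<in>J. Xh k (t l) \<le> y l) \<and> Xt (t l) \<le> z l"
      if "max (pmax (Xh ` J) (t l)) (Xt (t l)) \<le> min (y l) (z l)" for l
    proof -
      have m: "max (pmax (Xh ` J) (t l)) (Xt (t l)) \<le> y l" "max (pmax (Xh ` J) (t l)) (Xt (t l)) \<le> z l"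
        using that by linarith+
      have "0 \<le> y l" using m(1) nn(2)[of "t l"] by linarith
      from le[OF this, THEN iffD1, OF m(1)] m(2) show ?thesis by linarith
    qed
    then have "(\<forall>l\<in>{1..d}. max (pmax (Xh ` J) (t l)) (Xt (t l)) \<le> min (y l) (z l)) \<longrightarrow>
        (\<forall>k\<in>J. \<forall>l\<in>{1..d}. Xh k (t l) \<le> y l) \<and> (\<forall>l\<in>{1..d}. Xt (t l) \<le> z l)"
      by blast
    moreover have "(\<forall>l\<in>{1..d}. max (pmax (Xh ` J) (t l)) (Xt (t l)) \<le> min (y l) (z l)) \<longleftrightarrow>
        (\<forall>k\<in>J. \<forall>l\<in>{1..d}. Xh k (t l) \<le> y l) \<and> (\<forall>l\<in>{1..d}. Xt (t l) \<le> z l)" if "y = z"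
      unfolding that min.idem le[OF z[THEN less_imp_le]] by blast
    ultimately show ?thesis unfolding step pot by simp
  next
    case 2
    then have "below (Suc i) Xt f \<longleftrightarrow> below i Xt f" for f
      unfolding below_def by (auto simp: less_Suc_eq)
    then show ?thesis using 2 by (simp add: Outer potential_def)
  next
    case 3
    then show ?thesis by (simp add: Outer potential_def)
  next
    case 4
    then have not_ok: "\<not> ((\<forall>k\<in>J. \<forall>l\<in>{1..d}. Xh k (t l) \<le> y l) \<and> (\<forall>l\<in>{1..d}. Xt (t l) \<le> z l))"
      using not1 Outer by auto
    let ?X = "update t i (admissible J t i Xt M) Xt"
    have "Xt x \<le> ?X x" for x by (simp add: update_def)
    then have not_ok': "\<not> ((\<forall>k\<in>J. \<forall>l\<in>{1..d}. Xh k (t l) \<le> y l) \<and> (\<forall>l\<in>{1..d}. ?X (t l) \<le> z l))"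
      using not_ok order_trans by blast
    have "step J d t c C M = Outer (i + 1) Xh ?X" using 4 by (simp add: Outer)
    then have "potential y z (step J d t c C M) = 0"
      using not_ok' by (simp only:) (rule potential_eq_0, simp_all only: phase.simps zero_part.simps current.simps simp_thms)
    moreover have "potential y z C = 0"
      unfolding Outer by (rule potential_eq_0) (simp_all only: phase.simps zero_part.simps current.simps simp_thms not_ok)
    ultimately have eq: "potential y z (step J d t c C M) = potential y z C" by linarith
    from eq eq_refl[OF eq] show ?thesis by blast
  qed
next
  case (Search i Xh Xt cu cl)
  then have not_ok: "\<not> ((\<forall>k\<in>J. \<forall>l\<in>{1..d}. Xh k (t l) \<le> y l) \<and> (\<forall>l\<in>{1..d}. Xt (t l) \<le> z l))"
    using not1 by auto
  let ?X = "update t i (admissible J t i Xt M) Xt"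
  have "Xt x \<le> ?X x" for x by (simp add: update_def)
  then have not_ok': "\<not> ((\<forall>k\<in>J. \<forall>l\<in>{1..d}. Xh k (t l) \<le> y l) \<and> (\<forall>l\<in>{1..d}. ?X (t l) \<le> z l))"
    using not_ok order_trans by blast
  have "step J d t c C M = Outer (i + 1) Xh ?X \<or> step J d t c C M = Search i Xh Xt (ereal cl) (cl / 2)"
    by (simp add: Search)
  then have "potential y z (step J d t c C M) = 0"
  proof (elim disjE)
    assume eq: "step J d t c C M = Outer (i + 1) Xh ?X"
    show ?thesis
      unfolding eq by (rule potential_eq_0) (simp_all only: phase.simps zero_part.simps current.simps simp_thms not_ok')
  next
    assume eq: "step J d t c C M = Search i Xh Xt (ereal cl) (cl / 2)"
    show ?thesis
      unfolding eq by (rule potential_eq_0) (simp_all only: phase.simps zero_part.simps current.simps simp_thms not_ok)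
  qed
  moreover have "potential y z C = 0"
    unfolding Search by (rule potential_eq_0) (simp_all only: phase.simps zero_part.simps current.simps simp_thms not_ok)
  ultimately have eq: "potential y z (step J d t c C M) = potential y z C" by linarith
  from eq eq_refl[OF eq] show ?thesis by blast
next
  case (Stopped X)
  then show ?thesis by (simp add: potential_def)
qed

text \<open>\<open>level\<close> is the highest value at the treated point among the admissible
  functions that respect the thresholds, or \<open>lo\<close> if there are none. The update takes
  all maximizers, so it respects the thresholds iff no admissible function of
  \<open>exceeding z\<close> reaches \<open>level\<close>; a tie counts as a violation, hence the
  strict inequality. In the good case only functions below \<open>level\<close> at this point
  remain: \<open>level\<close> is the new value of the maximum, or the next upper level of the
  search.\<close>

lemma potential_active_step:
  fixes C :: "'a config" and z :: "nat \<Rightarrow> real" and M :: "('a \<Rightarrow> real) measure"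
  defines "i \<equiv> index C"
  defines "lo \<equiv> (if phase C = 2 then lower C else current C (t i))"
  defines "level \<equiv> Max (insert lo ((\<lambda>f. f (t i)) ` {f \<in> atoms M. f \<notin> exceeding z \<and> below i (current C) f}))"
  assumes C: "valid C" and z: "\<And>l. 0 < z l"
    and active: "phase C = 2 \<or> phase C = 1 \<and> i \<le> d \<and> i \<notin> J \<and> current C (t i) \<noteq> 0"
    and y_ok: "\<forall>k\<in>J. \<forall>l\<in>{1..d}. zero_part C k (t l) \<le> y l"
    and z_ok: "\<forall>l\<in>{1..d}. current C (t l) \<le> z l"
    and M: "finite (atoms M)" "atoms M \<subseteq> C0" "\<And>f. f \<in> atoms M \<Longrightarrow> lo \<le> f (t i)"
  shows "potential y z (step J d t c C M) =
    (if \<forall>f\<in>atoms M. f \<in> exceeding z \<and> below i (current C) f \<longrightarrow> f (t i) < level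
     then exp (- measure mut {f \<in> exceeding z. below i (current C) f \<and> f (t i) < level}) else 0)"
proof -
  define h where "h = current C"
  define A where "A = {f \<in> atoms M. below i h f}"
  have adm: "admissible J t i h M = A" by (simp add: A_def admissible_below)
  have A: "finite A" "A \<subseteq> C0" using M by (auto simp: A_def)
  have i: "i \<in> {1..d}" "i \<notin> J" and h: "\<And>x. 0 \<le> h x"
    and h_lo: "h (t i) \<le> lo" and h_lo': "phase C = 1 \<Longrightarrow> h (t i) = lo" and lo: "0 < lo"
    using C active by (cases C; auto simp: i_def lo_def h_def less_le)+
  have fin: "finite (insert lo ((\<lambda>f. f (t i)) ` {f \<in> atoms M. f \<notin> exceeding z \<and> below i h f}))"
    using M(1) by simp
  show ?thesis
  proof (cases "A = {}")
    case True
    then have empty: "{f \<in> atoms M. f \<notin> exceeding z \<and> below i h f} = {}"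
      by (auto simp: A_def)
    \<comment> \<open>With nothing admissible, \<open>lo\<close> is the bound that the next
      configuration inherits: the unchanged value of the maximum in step 3(b), the new upper level
      in the search.\<close>
    have top: "level = lo"
      unfolding level_def h_def[symmetric] empty by simp
    have "potential y z (step J d t c C M) =
        exp (- measure mut {f \<in> exceeding z. below i h f \<and> f (t i) < lo})"
    proof (cases C)
      case (Outer i' Xh Xt)
      then have [simp]: "i' = i" "Xt = h" by (simp_all add: i_def h_def)
      have "step J d t c C M = Outer (i + 1) Xh h"
        using active h i by (auto simp: Outer adm True update_def pmax_def max_absorb2)
      then show ?thesis
        using y_ok z_ok i h_lo' by (simp add: Outer potential_def below_Suc conj_assoc)
    next
      case (Search i' Xh Xt cu cl)
      then have [simp]: "i' = i" "Xt = h" "cl = lo" by (simp_all add: i_def h_def lo_def)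
      have "step J d t c C M = Search i Xh h (ereal lo) (lo / 2)"
        using adm True by (simp add: Search)
      then show ?thesis
        using y_ok z_ok by (simp add: Search potential_def)
    qed (use active in auto)
    then show ?thesis using True by (auto simp: top A_def h_def)
  next
    case False
    define X where "X = update t i A h"
    define T where "T = {f \<in> A. \<forall>g\<in>A. f (t i) \<ge> g (t i)}"
    have T: "finite T" "T \<subseteq> C0" using A by (auto simp: T_def)
    have X: "X x = max (pmax T x) (h x)" for x by (simp add: X_def update_def T_def)
    obtain Xh where step: "step J d t c C M = Outer (i + 1) Xh X" and Xh: "Xh = zero_part C"
      using active False i adm by (cases C) (auto simp: i_def h_def X_def)
    define m where "m = Max ((\<lambda>f. f (t i)) ` A)"
    have m_ge: "f \<in> A \<Longrightarrow> f (t i) \<le> m" for f using A by (simp add: m_def)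
    have "m \<in> (\<lambda>f. f (t i)) ` A" unfolding m_def using A False by (intro Max_in) auto
    then obtain g where g: "g \<in> A" "g (t i) = m" by auto
    have T_iff: "f \<in> T \<longleftrightarrow> f \<in> A \<and> f (t i) = m" for f
      using g m_ge by (fastforce simp: T_def)
    have lo_m: "lo \<le> m" using g M(3) by (auto simp: A_def)
    have lo_top: "lo \<le> level" and le_top: "f \<in> A \<Longrightarrow> f \<notin> exceeding z \<Longrightarrow> f (t i) \<le> level" for f
      unfolding level_def h_def[symmetric] using fin by (auto intro!: Max_ge simp: A_def)
    have "level \<in> insert lo ((\<lambda>f. f (t i)) ` {f \<in> atoms M. f \<notin> exceeding z \<and> below i h f})"
      unfolding level_def h_def[symmetric] using fin by (intro Max_in) auto
    then have top_m: "level \<le> m" using lo_m m_ge by (auto simp: A_def)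
    have pot: "potential y z (step J d t c C M) = (if \<forall>l\<in>{1..d}. X (t l) \<le> z l
        then exp (- measure mut {f \<in> exceeding z. below (Suc i) X f}) else 0)"
      using y_ok by (simp add: step potential_def Xh)
    show ?thesis
    proof (cases "\<forall>f\<in>atoms M. f \<in> exceeding z \<and> below i h f \<longrightarrow> f (t i) < level")
      case True
      have "g \<notin> exceeding z" using True g top_m by (fastforce simp: A_def)
      then have top: "level = m" using le_top g top_m by fastforce
      have "f \<notin> exceeding z" if "f \<in> T" for f
        using that True top by (fastforce simp: T_iff A_def)
      then have "f (t l) \<le> z l" if "f \<in> T" "l \<in> {1..d}" for f l
        using that T by (auto simp: exceeding_def not_less)
      then have X_le: "\<forall>l\<in>{1..d}. X (t l) \<le> z l"
        using z_ok z[THEN less_imp_le] by (simp add: X pmax_le_iff[OF T] h_def)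
      have "pmax T (t i) = m"
      proof (rule antisym)
        show "pmax T (t i) \<le> m" using lo lo_m by (subst pmax_le_iff[OF T]) (auto simp: T_iff)
        show "m \<le> pmax T (t i)"
          using T g by (auto simp: pmax_eq_Max T_iff intro!: Max_ge)
      qed
      then have Xi: "X (t i) = level" using h_lo lo_m by (simp add: X top)
      \<comment> \<open>Admissible functions lie below the maximum at the points treated before, so
        the update does not alter the earlier conditions.\<close>
      have "X (t k) = h (t k)" if "1 \<le> k" "k < i" "k \<notin> J" for k
      proof -
        have "f (t k) \<le> h (t k)" if "f \<in> T" for f
          using that \<open>1 \<le> k\<close> \<open>k < i\<close> \<open>k \<notin> J\<close> by (auto simp: T_def A_def below_def intro: less_imp_le)
        then have "pmax T (t k) \<le> h (t k)" using h by (simp add: pmax_le_iff[OF T])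
        then show ?thesis by (simp add: X)
      qed
      then have "below i X f \<longleftrightarrow> below i h f" for f
        unfolding below_def by (metis (no_types))
      then have "{f \<in> exceeding z. below (Suc i) X f} = {f \<in> exceeding z. below i h f \<and> f (t i) < level}"
        using i Xi by (simp add: below_Suc)
      then show ?thesis using True X_le by (simp add: pot h_def)
    next
      case False
      then obtain f where f: "f \<in> A" "f \<in> exceeding z" "level \<le> f (t i)"
        by (auto simp: A_def not_less)
      have "\<exists>f\<in>T. f \<in> exceeding z"
      proof (cases "g \<in> exceeding z")
        case True
        then show ?thesis using g by (auto simp: T_iff)
      next
        case False
        \<comment> \<open>A maximizer \<open>g\<close> outside \<open>exceeding z\<close> cannot be
          above \<open>level\<close>, so \<open>f\<close>, which reaches \<open>level\<close>, is a
          maximizer too.\<close>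
        then have "f (t i) = m" using le_top[OF g(1)] f m_ge[OF f(1)] g by simp
        then show ?thesis using f by (auto simp: T_iff)
      qed
      then obtain f l where f: "f \<in> T" "l \<in> {1..d}" "z l < f (t l)" by (auto simp: exceeding_def)
      have "\<not> pmax T (t l) \<le> z l"
        using f z[of l] by (subst pmax_le_iff[OF T]) (auto simp: not_le)
      then have "\<not> X (t l) \<le> z l" by (simp add: X)
      then have "potential y z (step J d t c C M) = 0" using f by (auto simp: pot)
      then show ?thesis using False by (simp add: h_def)
    qed
  qed
qed


text \<open>\<open>mut\<close> may have infinite mass, while measurability of sections is available
  for finite measures. It is therefore cut off at the levels \<open>1 / real (Suc m)\<close>; as
  \<open>lo w\<close> is positive, the cut is eventually invisible at each sample point.\<close>

lemma measure_band_measurable: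
  assumes i: "i \<in> {1..d}" and lo[measurable]: "lo \<in> borel_measurable F" and hi[measurable]: "hi \<in> borel_measurable F"
    and lo_pos: "\<And>w. w \<in> space F \<Longrightarrow> 0 < lo w" and A[measurable]: "A \<in> sets C0_borel"
  shows "(\<lambda>w. measure mut {f \<in> A. ereal (f (t i)) < hi w \<and> lo w \<le> f (t i)}) \<in> borel_measurable F"
proof (rule borel_measurable_LIMSEQ_real)
  define L where "L m = {f \<in> C0. f (t i) \<ge> 1 / real (Suc m)}" for m
  define \<kappa> where "\<kappa> m = density mut (indicator (L m))" for m
  have L: "L m \<in> sets C0_borel" for m
    unfolding L_def by (rule sets_Collect_C0) measurable
  have A_sub: "A \<subseteq> C0" using sets.sets_into_space[OF A] by (simp add: space_C0_borel)
  have \<kappa>: "finite_measure (\<kappa> m)" "sets (\<kappa> m) = sets C0_borel" for m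
  proof -
    have fin: "emeasure mut (L m) < \<infinity>"
      using L i by (intro mut_exceed_finite[of i "1 / real (Suc m)"]) (auto simp: L_def)
    show "finite_measure (\<kappa> m)"
      unfolding \<kappa>_def by (rule finite_measure_density_indicator[OF _ fin]) (simp add: L sets_mut)
  qed (simp add: \<kappa>_def sets_mut)
  have ev[measurable]: "(\<lambda>p. snd p x) \<in> borel_measurable (F \<Otimes>\<^sub>M C0_borel)" for x
    using measurable_compose[OF measurable_snd borel_measurable_eval] .
  define D where "D = {p \<in> space (F \<Otimes>\<^sub>M C0_borel). snd p \<in> A \<and> ereal (snd p (t i)) < hi (fst p) \<and> lo (fst p) \<le> snd p (t i)}"
  have D: "D \<in> sets (F \<Otimes>\<^sub>M C0_borel)" unfolding D_def by measurable
  show "(\<lambda>w. measure (\<kappa> m) (Pair w -` D)) \<in> borel_measurable F" for m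
    by (rule borel_measurable_measure_kernel[OF D]) (simp_all add: \<kappa>)
  fix w assume w: "w \<in> space F"
  obtain m0 where m0: "1 / real (Suc m0) < lo w"
    using lo_pos[OF w] by (metis nat_approx_posE)
  have sec: "Pair w -` D = {f \<in> A. ereal (f (t i)) < hi w \<and> lo w \<le> f (t i)}"
    using w A_sub by (auto simp: D_def space_pair_measure space_C0_borel)
  have "measure (\<kappa> m) (Pair w -` D) = measure mut {f \<in> A. ereal (f (t i)) < hi w \<and> lo w \<le> f (t i)}"
    if "m0 \<le> m" for m
  proof -
    have "1 / real (Suc m) \<le> 1 / real (Suc m0)" using that by (simp add: frac_le)
    then have "L m \<inter> Pair w -` D = Pair w -` D"
      using m0 A_sub by (auto simp: sec L_def)
    moreover have "measure (\<kappa> m) (Pair w -` D) = measure mut (L m \<inter> Pair w -` D)"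
      unfolding \<kappa>_def using L sets_Pair1[OF D] by (intro measure_density_indicator) (auto simp: sets_mut)
    ultimately show ?thesis by (simp add: sec)
  qed
  then show "(\<lambda>m. measure (\<kappa> m) (Pair w -` D)) \<longlonglongrightarrow>
      measure mut {f \<in> A. ereal (f (t i)) < hi w \<and> lo w \<le> f (t i)}"
    by (intro tendsto_eventually) (auto simp: eventually_sequentially)
qed

lemma finite_measure_mut_exceeding:
  assumes "\<And>l. 0 < z l"
  shows "finite_measure (density mut (indicator (exceeding z)))"
  by (rule finite_measure_density_indicator[OF _ mut_exceeding_finite[of z "exceeding z", OF assms order_refl]])
    (simp add: sets_exceeding sets_mut)

lemma measure_mut_exceeding:
  assumes "A \<in> sets C0_borel" "A \<subseteq> exceeding z"
  shows "measure (density mut (indicator (exceeding z))) A = measure mut A"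
  using assms sets_exceeding by (simp add: measure_density_indicator sets_mut Int_absorb1)

lemma below_measurable: "Measurable.pred (hist n \<Otimes>\<^sub>M C0_borel) (\<lambda>p. below i (current (cfg n (fst p))) (snd p))"
proof -
  have [measurable]: "(\<lambda>p. snd p x) \<in> borel_measurable (hist n \<Otimes>\<^sub>M C0_borel)" for x
    using measurable_compose[OF measurable_snd borel_measurable_eval] .
  have [measurable]: "(\<lambda>p. current (cfg n (fst p)) x) \<in> borel_measurable (hist n \<Otimes>\<^sub>M C0_borel)" for x
    using measurable_compose[OF measurable_fst current_measurable] .
  show ?thesis unfolding below_def by measurable
qed

lemma potential_measurable:
  assumes z: "\<And>l. 0 < z l"
  shows "(\<lambda>w. potential y z (cfg n w)) \<in> borel_measurable (hist n)"
proof -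
  note [measurable] = phase_measurable index_measurable current_measurable zero_part_measurable
    upper_measurable below_measurable sets_exceeding
  have cJ[measurable]: "countable J" using finite_J by (rule countable_finite)
  have [measurable]: "(\<lambda>p. snd p x) \<in> borel_measurable (hist n \<Otimes>\<^sub>M C0_borel)" for x
    using measurable_compose[OF measurable_snd borel_measurable_eval] .
  have sec: "(\<lambda>w. measure mut {f \<in> exceeding z. below i (current (cfg n w)) f \<and> ereal (f (t i)) < upper (cfg n w)})
      \<in> borel_measurable (hist n)" for i
  proof -
    define D where "D = {p \<in> space (hist n \<Otimes>\<^sub>M C0_borel). snd p \<in> exceeding z \<and>
      below i (current (cfg n (fst p))) (snd p) \<and> ereal (snd p (t i)) < upper (cfg n (fst p))}"
    have D: "D \<in> sets (hist n \<Otimes>\<^sub>M C0_borel)" unfolding D_def by measurable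
    have "(\<lambda>w. measure (density mut (indicator (exceeding z))) (Pair w -` D)) \<in> borel_measurable (hist n)"
      by (rule borel_measurable_measure_kernel[OF D]) (simp_all add: finite_measure_mut_exceeding z sets_mut)
    moreover have "measure (density mut (indicator (exceeding z))) (Pair w -` D) =
        measure mut {f \<in> exceeding z. below i (current (cfg n w)) f \<and> ereal (f (t i)) < upper (cfg n w)}"
      if "w \<in> space (hist n)" for w
    proof -
      have "Pair w -` D = {f \<in> exceeding z. below i (current (cfg n w)) f \<and> ereal (f (t i)) < upper (cfg n w)}"
        using that sets.sets_into_space[OF sets_exceeding] by (auto simp: D_def space_pair_measure)
      then show ?thesis using sets_Pair1[OF D, of w] by (simp add: measure_mut_exceeding)
    qed
    ultimately show ?thesis by (rule measurable_cong[THEN iffD1, rotated])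
  qed
  define m1 where "m1 w = measure mut {f \<in> exceeding z. below (index (cfg n w)) (current (cfg n w)) f \<and>
      ereal (f (t (index (cfg n w)))) < upper (cfg n w)}" for w
  define m2 where "m2 w = (\<Sum>k\<in>{k \<in> J. index (cfg n w) \<le> k}. measure (mu_J \<mu> J t k) (exceeding y))" for w
  from measurable_compose_countable[OF sec index_measurable]
  have [measurable]: "m1 \<in> borel_measurable (hist n)" unfolding m1_def .
  have [measurable]: "m2 \<in> borel_measurable (hist n)"
    unfolding m2_def
    using measurable_compose[OF index_measurable, of "\<lambda>i. \<Sum>k\<in>{k \<in> J. i \<le> k}. measure (mu_J \<mu> J t k) (exceeding y)"]
    by simp
  have [measurable]: "Measurable.pred (hist n) (\<lambda>w. \<forall>k\<in>J. k < index (cfg n w) \<longrightarrow>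
      (\<forall>l\<in>{1..d}. zero_part (cfg n w) k (t l) \<le> y l))"
    by measurable
  have [measurable]: "Measurable.pred (hist n) (\<lambda>w. (\<forall>k\<in>J. \<forall>l\<in>{1..d}. zero_part (cfg n w) k (t l) \<le> y l) \<and>
      (\<forall>l\<in>{1..d}. current (cfg n w) (t l) \<le> z l))"
    by measurable
  have [measurable]: "Measurable.pred (hist n) (\<lambda>w. \<forall>l\<in>{1..d}. current (cfg n w) (t l) \<le> min (y l) (z l))"
    by measurable
  have [measurable]: "Measurable.pred (hist n) (\<lambda>w. phase (cfg n w) = 0)" "Measurable.pred (hist n) (\<lambda>w. phase (cfg n w) = 3)"
    by measurable
  show ?thesis
    unfolding potential_def
    unfolding m1_def[symmetric] m2_def[symmetric] by measurable
qed

section \<open>Conservation of the expected potential\<close>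

definition zeros_event :: "(nat \<Rightarrow> real) \<Rightarrow> nat \<Rightarrow> nat \<Rightarrow> 'p set" where
  "zeros_event y n q = {w \<in> space P. phase (cfg n w) = 0 \<and> index (cfg n w) = q \<and>
    (\<forall>k\<in>J. k < q \<longrightarrow> (\<forall>l\<in>{1..d}. zero_part (cfg n w) k (t l) \<le> y l))}"

text \<open>With \<open>q\<close> outside \<open>J\<close> here and in \<open>J\<close> for
  \<open>zeros_event\<close>, these are the events on which the simulated measure influences the
  potential. They belong to the history, and fixing \<open>q\<close> fixes the point at which levels
  are compared.\<close>

definition active_event :: "(nat \<Rightarrow> real) \<Rightarrow> (nat \<Rightarrow> real) \<Rightarrow> nat \<Rightarrow> nat \<Rightarrow> 'p set" where
  "active_event y z n q = {w \<in> space P.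
    (phase (cfg n w) = 2 \<or> phase (cfg n w) = 1 \<and> current (cfg n w) (t q) \<noteq> 0) \<and> index (cfg n w) = q \<and>
    (\<forall>k\<in>J. \<forall>l\<in>{1..d}. zero_part (cfg n w) k (t l) \<le> y l) \<and> (\<forall>l\<in>{1..d}. current (cfg n w) (t l) \<le> z l)}"

lemma sets_zeros_event: "zeros_event y n q \<in> sets (hist n)"
proof -
  note [measurable] = zero_part_measurable
  have [measurable]: "countable J" using finite_J by (rule countable_finite)
  have 1: "Measurable.pred (hist n) (\<lambda>w. \<forall>k\<in>J. k < q \<longrightarrow> (\<forall>l\<in>{1..d}. zero_part (cfg n w) k (t l) \<le> y l))"
    by measurable
  have "zeros_event y n q = (\<lambda>w. phase (cfg n w)) -` {0} \<inter> space (hist n) \<inter>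
      ((\<lambda>w. index (cfg n w)) -` {q} \<inter> space (hist n)) \<inter>
      {w \<in> space (hist n). \<forall>k\<in>J. k < q \<longrightarrow> (\<forall>l\<in>{1..d}. zero_part (cfg n w) k (t l) \<le> y l)}"
    unfolding zeros_event_def space_hist by blast
  also have "\<dots> \<in> sets (hist n)"
    by (intro sets.Int measurable_sets[OF phase_measurable] measurable_sets[OF index_measurable]
        predE[OF 1]) simp_all
  finally show ?thesis .
qed

lemma sets_active_event: "active_event y z n q \<in> sets (hist n)"
proof -
  note [measurable] = zero_part_measurable current_measurable
  have [measurable]: "countable J" using finite_J by (rule countable_finite)
  have 1: "Measurable.pred (hist n) (\<lambda>w. (\<forall>k\<in>J. \<forall>l\<in>{1..d}. zero_part (cfg n w) k (t l) \<le> y l) \<and>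
      (\<forall>l\<in>{1..d}. current (cfg n w) (t l) \<le> z l))"
    by measurable
  have 2: "Measurable.pred (hist n) (\<lambda>w. current (cfg n w) (t q) \<noteq> 0)"
    by measurable
  have "active_event y z n q = ((\<lambda>w. phase (cfg n w)) -` {2} \<inter> space (hist n) \<union>
      (\<lambda>w. phase (cfg n w)) -` {1} \<inter> space (hist n) \<inter> {w \<in> space (hist n). current (cfg n w) (t q) \<noteq> 0}) \<inter>
      ((\<lambda>w. index (cfg n w)) -` {q} \<inter> space (hist n)) \<inter>
      {w \<in> space (hist n). (\<forall>k\<in>J. \<forall>l\<in>{1..d}. zero_part (cfg n w) k (t l) \<le> y l) \<and>
        (\<forall>l\<in>{1..d}. current (cfg n w) (t l) \<le> z l)}"
    unfolding active_event_def space_hist by blast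
  also have "\<dots> \<in> sets (hist n)"
    by (intro sets.Int sets.Un measurable_sets[OF phase_measurable] measurable_sets[OF index_measurable]
        predE[OF 1] predE[OF 2]) simp_all
  finally show ?thesis .
qed

lemma hist_sets: "K \<in> sets (hist n) \<Longrightarrow> K \<in> sets P"
  using subalgebra_hist[of n] by (auto simp: subalgebra_def)

lemma points_P: "random_finite_set P C0_borel (\<lambda>w. atoms (N n w))"
proof
  fix A :: "('a \<Rightarrow> real) set" assume A: "A \<in> sets C0_borel"
  have "{w \<in> space P. atoms (N n w) \<inter> A = {}} \<in> sets (hist (Suc n))"
    using random_finite_set.avoid_fixed[OF points_hist A, of n] by (simp add: space_hist)
  then show "{w \<in> space P. atoms (N n w) \<inter> A = {}} \<in> sets P" by (rule hist_sets)
qed (use finite_atoms atoms_C0 in \<open>auto simp: space_C0_borel\<close>)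

text \<open>The intensity on this event is the deterministic measure \<open>mu_J\<close>, so the
  void probability of \<open>exceeding y\<close> is exactly the factor by which the potentials for
  the indices \<open>q\<close> and \<open>Suc q\<close> differ.\<close>

lemma integral_zeros_step:
  assumes q: "q \<in> J" and y: "\<And>l. 0 < y l"
  shows "(\<integral>\<^sup>+w\<in>zeros_event y n q. ennreal (potential y z (cfg (Suc n) w)) \<partial>P) =
    (\<integral>\<^sup>+w\<in>zeros_event y n q. ennreal (potential y z (cfg n w)) \<partial>P)"
proof -
  let ?H = "zeros_event y n q"
  define a where "a q = exp (- (\<Sum>k\<in>{k \<in> J. q \<le> k}. measure (mu_J \<mu> J t k) (exceeding y)) - measure mut (exceeding z))" for q
  have HP: "?H \<in> sets P" using sets_zeros_event by (rule hist_sets)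
  have Hsp: "?H \<subseteq> space P" using HP by (rule sets.sets_into_space)
  have split: "{k \<in> J. q \<le> k} = insert q {k \<in> J. Suc q \<le> k}"
    using q by (auto simp: Suc_le_eq le_less)
  have a_q: "a q = exp (- measure (mu_J \<mu> J t q) (exceeding y)) * a (Suc q)"
    unfolding a_def split using finite_J by (simp add: exp_add[symmetric])
  have now: "potential y z (cfg n w) = a q" if "w \<in> ?H" for w
    using that by (simp add: zeros_event_def potential_def a_def)
  have after: "potential y z (cfg (Suc n) w) =
      (if atoms (N n w) \<inter> exceeding y = {} then a (Suc q) else 0)" if "w \<in> ?H" for w
  proof -
    from that have w: "w \<in> space P" "phase (cfg n w) = 0" "index (cfg n w) = q" by (auto simp: zeros_event_def)
    then obtain Xh where c: "cfg n w = Zeros q Xh" by (cases "cfg n w") auto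
    have Xh: "\<forall>k\<in>J. k < q \<longrightarrow> (\<forall>l\<in>{1..d}. Xh k (t l) \<le> y l)"
      using that by (simp add: zeros_event_def c)
    have "q \<le> d" using q J_subset by auto
    define Xh' where "Xh' = Xh(q := pmax (atoms (N n w)))"
    have Xh'_q: "Xh' q = pmax (atoms (N n w))" and Xh'_less: "k < q \<Longrightarrow> Xh' k = Xh k" for k
      by (simp_all add: Xh'_def)
    have step: "cfg (Suc n) w = Zeros (Suc q) Xh'"
      using q \<open>q \<le> d\<close> by (simp add: c Xh'_def)
    have pot: "potential y z (cfg (Suc n) w) =
        (if \<forall>k\<in>J. k < Suc q \<longrightarrow> (\<forall>l\<in>{1..d}. Xh' k (t l) \<le> y l) then a (Suc q) else 0)"
      unfolding step potential_def a_def phase.simps index.simps zero_part.simps if_True simp_thms ..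
    show ?thesis
    proof (cases "atoms (N n w) \<inter> exceeding y = {}")
      case True
      have "pmax (atoms (N n w)) (t l) \<le> y l" if "l \<in> {1..d}" for l
      proof -
        have "f (t l) \<le> y l" if "f \<in> atoms (N n w)" for f
        proof -
          have "f \<in> C0" "f \<notin> exceeding y" using that True atoms_C0[OF w(1), of n] by blast+
          then show ?thesis using \<open>l \<in> {1..d}\<close> not_less unfolding exceeding_def by blast
        qed
        then show ?thesis
          using pmax_le_iff[OF finite_atoms[OF w(1)] atoms_C0[OF w(1)] less_imp_le[OF y]] by blast
      qed
      then have "\<forall>k\<in>J. k < Suc q \<longrightarrow> (\<forall>l\<in>{1..d}. Xh' k (t l) \<le> y l)"
        using Xh Xh'_q Xh'_less by (metis less_Suc_eq)
      then show ?thesis unfolding pot using True by simp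
    next
      case False
      then obtain f where f: "f \<in> atoms (N n w)" "f \<in> exceeding y" by blast
      then obtain l where l: "l \<in> {1..d}" "y l < f (t l)" unfolding exceeding_def by blast
      have "f (t l) \<le> pmax (atoms (N n w)) (t l)"
        unfolding pmax_eq_Max[OF finite_atoms[OF w(1)] atoms_C0[OF w(1)]]
        using f(1) finite_atoms[OF w(1), of n] by (intro Max_ge) auto
      then have "\<not> Xh' q (t l) \<le> y l" using l by (simp add: Xh'_q)
      then have "\<not> (\<forall>k\<in>J. k < Suc q \<longrightarrow> (\<forall>l\<in>{1..d}. Xh' k (t l) \<le> y l))"
        using q l(1) lessI by blast
      then have "potential y z (cfg (Suc n) w) = 0" unfolding pot by (rule if_not_P)
      also have "0 = (if atoms (N n w) \<inter> exceeding y = {} then a (Suc q) else 0)"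
        using False by (rule if_not_P[symmetric])
      finally show ?thesis .
    qed
  qed
  have av: "{w \<in> ?H. atoms (N n w) \<inter> exceeding y = {}} \<in> sets P"
  proof -
    have "{w \<in> ?H. atoms (N n w) \<inter> exceeding y = {}} = ?H \<inter> {w \<in> space P. atoms (N n w) \<inter> exceeding y = {}}"
      using Hsp by auto
    then show ?thesis using HP random_finite_set.avoid_fixed[OF points_P sets_exceeding] by simp
  qed
  have "(\<integral>\<^sup>+w\<in>?H. ennreal (potential y z (cfg (Suc n) w)) \<partial>P) =
      (\<integral>\<^sup>+w. ennreal (a (Suc q)) * indicator {w \<in> ?H. atoms (N n w) \<inter> exceeding y = {}} w \<partial>P)"
    by (intro nn_integral_cong) (auto simp: after simp del: config_at.simps split: split_indicator)
  also have "\<dots> = ennreal (a (Suc q)) * emeasure P {w \<in> ?H. atoms (N n w) \<inter> exceeding y = {}}"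
    using av by (rule nn_integral_cmult_indicator)
  also have "emeasure P {w \<in> ?H. atoms (N n w) \<inter> exceeding y = {}} =
      (\<integral>\<^sup>+w\<in>?H. poisson_prob (emeasure (intensity \<mu> J d t (cfg n w)) (exceeding y)) 0 \<partial>P)"
    by (rule prm_given_void[OF prm_run sets_zeros_event Hsp sets_exceeding])
  also have "\<dots> = (\<integral>\<^sup>+w. ennreal (exp (- measure (mu_J \<mu> J t q) (exceeding y))) * indicator ?H w \<partial>P)"
  proof (intro nn_integral_cong)
    fix w assume w: "w \<in> space P"
    have "intensity \<mu> J d t (cfg n w) = mu_J \<mu> J t q" if "w \<in> ?H"
      using that q J_subset by (cases "cfg n w") (auto simp: zeros_event_def)
    then show "poisson_prob (emeasure (intensity \<mu> J d t (cfg n w)) (exceeding y)) 0 * indicator ?H w =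
        ennreal (exp (- measure (mu_J \<mu> J t q) (exceeding y))) * indicator ?H w"
      using mu_J_finite[OF q sets_exceeding] by (simp add: poisson_prob_0 split: split_indicator)
  qed
  also have "\<dots> = ennreal (exp (- measure (mu_J \<mu> J t q) (exceeding y))) * emeasure P ?H"
    using HP by (rule nn_integral_cmult_indicator)
  also have "ennreal (a (Suc q)) * \<dots> = ennreal (a q) * emeasure P ?H"
    unfolding a_q by (subst ennreal_mult) (auto simp: a_def ac_simps)
  also have "\<dots> = (\<integral>\<^sup>+w\<in>?H. ennreal (potential y z (cfg n w)) \<partial>P)"
    using HP by (subst nn_integral_cmult_indicator[symmetric]) (auto intro!: nn_integral_cong simp: now split: split_indicator)
  finally show ?thesis .
qed

text \<open>An instance of \<open>nn_integral_highest_points\<close>, with levels taken at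
  \<open>t q\<close>. Steps 3(a) and 3(b) are treated at once as the simulation of a band of levels
  from \<open>lo\<close> to \<open>hi\<close>.\<close>

lemma integral_active_step:
  assumes q: "q \<in> {1..d} - J" and z: "\<And>l. 0 < z l"
  shows "(\<integral>\<^sup>+w\<in>active_event y z n q. ennreal (potential y z (cfg (Suc n) w)) \<partial>P) =
    (\<integral>\<^sup>+w\<in>active_event y z n q. ennreal (potential y z (cfg n w)) \<partial>P)"
proof -
  define H where "H = active_event y z n q"
  define s where "s = (\<lambda>f :: 'a \<Rightarrow> real. f (t q))"
  define B where "B = exceeding z"
  define R where "R w = below q (current (cfg n w))" for w
  \<comment> \<open>The default \<open>1\<close> outside \<open>H\<close> keeps the lower level
    positive everywhere, so that \<open>\<nu> w\<close> is finite at every sample point.\<close>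
  define lo where "lo w = (if w \<in> H then if phase (cfg n w) = 2 then lower (cfg n w) else current (cfg n w) (t q) else 1)" for w
  define hi where "hi w = upper (cfg n w)" for w
  define \<nu> where "\<nu> w = density mut (indicator {f \<in> C0. hi w > ereal (f (t q)) \<and> f (t q) \<ge> lo w})" for w
  \<comment> \<open>Restricted to the functions violating a threshold, \<open>mut\<close> is a
    finite measure that is the same for all sample points; inside \<open>B\<close> the intensity is
    its restriction to the band.\<close>
  define \<kappa> where "\<kappa> = density mut (indicator B)"
  define level where "level w = Max (insert (lo w) (s ` {f \<in> atoms (N n w). f \<notin> B \<and> R w f}))" for w
  have HF: "H \<in> sets (hist n)" unfolding H_def by (rule sets_active_event)
  have HP: "H \<in> sets P" using HF by (rule hist_sets)
  have Hsp: "H \<subseteq> space P" using HP by (rule sets.sets_into_space)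
  have q': "q \<le> d" "q \<notin> J" using q by auto
  have on_H: "phase (cfg n w) = 2 \<or> phase (cfg n w) = 1 \<and> q \<le> d \<and> q \<notin> J \<and> current (cfg n w) (t q) \<noteq> 0"
      "index (cfg n w) = q" "\<forall>k\<in>J. \<forall>l\<in>{1..d}. zero_part (cfg n w) k (t l) \<le> y l"
      "\<forall>l\<in>{1..d}. current (cfg n w) (t l) \<le> z l" "w \<in> space P" if "w \<in> H" for w
    using that q' unfolding H_def active_event_def mem_Collect_eq by blast+
  have shape: "(\<exists>Xh Xt. cfg n w = Outer q Xh Xt \<and> 0 < Xt (t q) \<and> lo w = Xt (t q) \<and> hi w = \<infinity>) \<or>
      (\<exists>Xh Xt cu cl. cfg n w = Search q Xh Xt cu cl \<and> 0 < cl \<and> ereal cl < cu \<and> lo w = cl \<and> hi w = cu)"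
    if w: "w \<in> H" for w
  proof (cases "cfg n w")
    case (Outer i Xh Xt)
    have "Xt (t q) \<noteq> 0" "0 \<le> Xt (t q)"
      using on_H(1)[OF w] valid_cfg[OF on_H(5)[OF w], of n] unfolding Outer by simp_all
    then show ?thesis using w on_H(2)[OF w] unfolding lo_def hi_def Outer by simp
  next
    case (Search i Xh Xt cu cl)
    then show ?thesis
      using w on_H(2)[OF w] valid_cfg[OF on_H(5)[OF w], of n] unfolding lo_def hi_def Search by simp
  qed (use on_H(1)[OF w] in simp_all)
  have lo_pos: "0 < lo w" for w
  proof (cases "w \<in> H")
    case True
    from shape[OF this] show ?thesis by (elim disjE exE) simp_all
  qed (simp add: lo_def)
  have lo_hi: "ereal (lo w) < hi w" if "w \<in> H" for w
    using shape[OF that] by (elim disjE exE) simp_all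
  have intens: "intensity \<mu> J d t (cfg n w) = \<nu> w" if "w \<in> H" for w
    using shape[OF that]
  proof (elim disjE exE conjE)
    fix Xh Xt assume "cfg n w = Outer q Xh Xt" "0 < Xt (t q)" "lo w = Xt (t q)" "hi w = \<infinity>"
    then show ?thesis using q by (simp add: \<nu>_def)
  next
    fix Xh Xt cu cl assume "cfg n w = Search q Xh Xt cu cl" "lo w = cl" "hi w = cu"
    then show ?thesis by (simp add: \<nu>_def)
  qed
  have lo_m: "lo \<in> borel_measurable (hist n)"
  proof -
    have "(\<lambda>w. phase (cfg n w)) -` {2} \<inter> space (hist n) \<in> sets (hist n)"
      by (rule measurable_sets[OF phase_measurable]) simp
    moreover have "(\<lambda>w. phase (cfg n w)) -` {2} \<inter> space (hist n) = {w \<in> space (hist n). phase (cfg n w) = 2}"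
      by blast
    moreover have "{w \<in> space (hist n). w \<in> H} = H"
      using Hsp unfolding space_hist by blast
    ultimately show ?thesis
      unfolding lo_def using HF
      by (intro measurable_If lower_measurable current_measurable borel_measurable_const) simp_all
  qed
  have hi_m: "hi \<in> borel_measurable (hist n)"
    unfolding hi_def by (rule upper_measurable)
  have s_m: "s \<in> borel_measurable C0_borel" unfolding s_def by (rule borel_measurable_eval)
  have B: "B \<in> sets C0_borel" unfolding B_def by (rule sets_exceeding)
  have R_m: "Measurable.pred (hist n \<Otimes>\<^sub>M C0_borel) (\<lambda>p. R (fst p) (snd p))"
    unfolding R_def by (rule below_measurable)
  have \<nu>: "emeasure (\<nu> w) A = emeasure mut {f \<in> A. ereal (f (t q)) < hi w \<and> lo w \<le> f (t q)}"
    if "A \<in> sets C0_borel" for w A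
    unfolding \<nu>_def using that by (rule emeasure_intensity_band)
  then have m\<nu>: "measure (\<nu> w) A = measure mut {f \<in> A. ereal (f (t q)) < hi w \<and> lo w \<le> f (t q)}"
    if "A \<in> sets C0_borel" for w A
    using that by (simp add: measure_def)
  have sets_\<nu>: "sets (\<nu> w) = sets C0_borel" for w by (simp add: \<nu>_def sets_mut)
  have fin_\<nu>: "emeasure (\<nu> w) (space C0_borel) < \<infinity>" for w
    unfolding \<nu>_def using q lo_pos by (intro band_finite) auto
  interpret poisson_avoidance P C0_borel "\<lambda>w. atoms (N n w)" "hist n" H \<nu>
  proof (intro poisson_avoidance.intro prob_space_axioms points_P poisson_avoidance_axioms.intro
      subalgebra_hist HF sets_\<nu>)
    show "finite_measure (\<nu> w)" for w
      using fin_\<nu>[of w] sets_eq_imp_space_eq[OF sets_\<nu>[of w]] by (intro finite_measureI) simp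
    show "(\<lambda>w. measure (\<nu> w) A) \<in> borel_measurable (hist n)" if "A \<in> sets C0_borel" for A
      unfolding m\<nu>[OF that] using q by (intro measure_band_measurable lo_m hi_m lo_pos that) auto
    fix A :: "('a \<Rightarrow> real) set" and K
    assume A: "A \<in> sets C0_borel" and K: "K \<in> sets (hist n)" "K \<subseteq> H"
    have "emeasure P {w \<in> K. atoms (N n w) \<inter> A = {}} =
        (\<integral>\<^sup>+w\<in>K. poisson_prob (emeasure (intensity \<mu> J d t (cfg n w)) A) 0 \<partial>P)"
      using K Hsp by (intro prm_given_void[OF prm_run K(1) _ A]) auto
    also have "\<dots> = (\<integral>\<^sup>+w\<in>K. ennreal (exp (- measure (\<nu> w) A)) \<partial>P)"
    proof (intro nn_integral_cong)
      fix w
      have "emeasure (\<nu> w) A \<le> emeasure (\<nu> w) (space C0_borel)"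
        using sets.sets_into_space[OF A] by (intro emeasure_mono) (auto simp: sets_\<nu>)
      then have "emeasure (\<nu> w) A < \<infinity>" using fin_\<nu>[of w] by (rule le_less_trans)
      then show "poisson_prob (emeasure (intensity \<mu> J d t (cfg n w)) A) 0 * indicator K w =
          ennreal (exp (- measure (\<nu> w) A)) * indicator K w"
        using intens[of w] K(2) poisson_prob_0[of "\<nu> w" A] by (cases "w \<in> K") auto
    qed
    finally show "emeasure P {w \<in> K. atoms (N n w) \<inter> A = {}} =
        (\<integral>\<^sup>+w\<in>K. ennreal (exp (- measure (\<nu> w) A)) \<partial>P)" .
  qed
  have sets_Q: "{f \<in> A. Q f} \<in> sets C0_borel" if "A \<in> sets C0_borel" "Measurable.pred C0_borel Q" for A Q
  proof -
    have "{f \<in> A. Q f} = A \<inter> {f \<in> space C0_borel. Q f}"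
      using sets.sets_into_space[OF that(1)] by auto
    then show ?thesis using that by (simp add: pred_def)
  qed
  have below_m[measurable]: "Measurable.pred C0_borel (below q h)" for h
    unfolding below_def by measurable
  have \<kappa>: "finite_measure \<kappa>" "sets \<kappa> = sets C0_borel"
    unfolding \<kappa>_def B_def using finite_measure_mut_exceeding[of z] z by (simp_all add: sets_mut)
  have m\<kappa>: "measure \<kappa> {f \<in> B. Q f} = measure mut {f \<in> B. Q f}" if "Measurable.pred C0_borel Q" for Q
    unfolding \<kappa>_def B_def using sets_Q[OF sets_exceeding that] by (intro measure_mut_exceeding) auto
  have null: "measure (\<nu> w) {f \<in> space C0_borel. \<not> (lo w \<le> s f \<and> ereal (s f) < hi w)} = 0" for w
  proof -
    have "{f \<in> space C0_borel. \<not> (lo w \<le> s f \<and> ereal (s f) < hi w)} \<in> sets C0_borel"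
      unfolding s_def by measurable
    then have "measure (\<nu> w) {f \<in> space C0_borel. \<not> (lo w \<le> s f \<and> ereal (s f) < hi w)} =
      measure mut {f \<in> {f \<in> space C0_borel. \<not> (lo w \<le> s f \<and> ereal (s f) < hi w)}.
        ereal (f (t q)) < hi w \<and> lo w \<le> f (t q)}" by (rule m\<nu>)
    also have "{f \<in> {f \<in> space C0_borel. \<not> (lo w \<le> s f \<and> ereal (s f) < hi w)}.
        ereal (f (t q)) < hi w \<and> lo w \<le> f (t q)} = {}" by (auto simp: s_def)
    finally show ?thesis by simp
  qed
  have band: "measure (\<nu> w) A = measure \<kappa> {f \<in> A. lo w \<le> s f \<and> ereal (s f) < hi w}"
    if A: "A \<in> sets C0_borel" "A \<subseteq> B" for w A
  proof -
    have "{f \<in> A. ereal (f (t q)) < hi w \<and> lo w \<le> f (t q)} \<in> sets C0_borel"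
      by (rule sets_Q[OF A(1)]) measurable
    then have "measure \<kappa> {f \<in> A. ereal (f (t q)) < hi w \<and> lo w \<le> f (t q)} =
        measure mut {f \<in> A. ereal (f (t q)) < hi w \<and> lo w \<le> f (t q)}"
      unfolding \<kappa>_def B_def using A(2) by (intro measure_mut_exceeding) (auto simp: B_def)
    then show ?thesis using m\<nu>[OF A(1)] by (simp add: s_def conj_commute)
  qed
  have now: "ennreal (potential y z (cfg n w)) = ennreal (exp (- measure \<kappa> {f \<in> B. R w f \<and> ereal (s f) < hi w}))"
    if "w \<in> H" for w
  proof -
    have "measure \<kappa> {f \<in> B. R w f \<and> ereal (s f) < hi w} = measure mut {f \<in> B. R w f \<and> ereal (s f) < hi w}"
      unfolding R_def s_def by (rule m\<kappa>) measurable
    moreover have "phase (cfg n w) \<noteq> 0" "phase (cfg n w) \<noteq> 3" using on_H(1)[OF that] by auto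
    ultimately show ?thesis
      using on_H(2-4)[OF that] by (simp add: potential_def B_def R_def s_def hi_def)
  qed
  \<comment> \<open>The pointwise description of the step assumes all atoms to lie at or above
    \<open>lo\<close>, which is available only almost surely.\<close>
  have "AE w in P. w \<in> H \<longrightarrow> (\<forall>f\<in>atoms (N n w). lo w \<le> s f \<and> ereal (s f) < hi w)"
    by (rule AE_points_in_band[OF s_m lo_m hi_m null])
  then have after: "AE w in P. w \<in> H \<longrightarrow> ennreal (potential y z (cfg (Suc n) w)) =
      ennreal (exp (- measure \<kappa> {f \<in> B. R w f \<and> s f < level w})) *
      indicator {w \<in> space P. \<forall>f\<in>atoms (N n w). f \<in> B \<and> R w f \<longrightarrow> s f < level w} w"
  proof (rule AE_mp, intro AE_I2 impI)
    fix w assume w: "w \<in> space P" and in_band: "w \<in> H \<longrightarrow> (\<forall>f\<in>atoms (N n w). lo w \<le> s f \<and> ereal (s f) < hi w)"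
      and wH: "w \<in> H"
    let ?C = "cfg n w"
    have lo_eq: "(if phase ?C = 2 then lower ?C else current ?C (t (index ?C))) = lo w"
      using wH on_H(2)[OF wH] by (simp add: lo_def)
    have "potential y z (step J d t c ?C (N n w)) =
      (if \<forall>f\<in>atoms (N n w). f \<in> B \<and> R w f \<longrightarrow> s f < level w
       then exp (- measure mut {f \<in> B. R w f \<and> s f < level w}) else 0)"
      using potential_active_step[where M = "N n w" and z = z and y = y, OF valid_cfg[OF w, of n] z, unfolded lo_eq] on_H[OF wH] in_band wH
        finite_atoms[OF w, of n] atoms_C0[OF w, of n]
      by (simp add: B_def R_def s_def level_def)
    moreover have "measure \<kappa> {f \<in> B. R w f \<and> s f < level w} = measure mut {f \<in> B. R w f \<and> s f < level w}"
      unfolding R_def s_def by (rule m\<kappa>) measurable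
    ultimately show "ennreal (potential y z (cfg (Suc n) w)) =
      ennreal (exp (- measure \<kappa> {f \<in> B. R w f \<and> s f < level w})) *
      indicator {w \<in> space P. \<forall>f\<in>atoms (N n w). f \<in> B \<and> R w f \<longrightarrow> s f < level w} w"
      using w by (simp split: split_indicator)
  qed
  have "(\<integral>\<^sup>+w\<in>H. ennreal (potential y z (cfg (Suc n) w)) \<partial>P) =
    (\<integral>\<^sup>+w\<in>H. (ennreal (exp (- measure \<kappa> {f \<in> B. R w f \<and> s f < level w})) *
      indicator {w \<in> space P. \<forall>f\<in>atoms (N n w). f \<in> B \<and> R w f \<longrightarrow> s f < level w} w) \<partial>P)"
    using after by (intro nn_integral_cong_AE) (auto elim!: eventually_mono split: split_indicator)
  also have "\<dots> = (\<integral>\<^sup>+w\<in>H. ennreal (exp (- measure \<kappa> {f \<in> B. R w f \<and> ereal (s f) < hi w})) \<partial>P)"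
    unfolding level_def
    by (rule nn_integral_highest_points[OF s_m B R_m lo_m hi_m \<kappa> lo_hi band null])
  also have "\<dots> = (\<integral>\<^sup>+w\<in>H. ennreal (potential y z (cfg n w)) \<partial>P)"
    by (intro nn_integral_cong) (auto simp: now split: split_indicator)
  finally show ?thesis unfolding H_def .
qed


text \<open>The space is cut according to the index on which the simulated measure acts. The
  remaining part, labelled \<open>0\<close> since indices start at \<open>1\<close>, consists of
  transitions that are controlled at each sample point.\<close>

lemma integral_potential_step:
  assumes y: "\<And>l. 0 < y l" and z: "\<And>l. 0 < z l"
  shows "(\<integral>\<^sup>+w. ennreal (potential y z (cfg (Suc n) w)) \<partial>P) \<le> (\<integral>\<^sup>+w. ennreal (potential y z (cfg n w)) \<partial>P)" (is ?le)
    and "y = z \<Longrightarrow>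
      (\<integral>\<^sup>+w. ennreal (potential y z (cfg (Suc n) w)) \<partial>P) = (\<integral>\<^sup>+w. ennreal (potential y z (cfg n w)) \<partial>P)"
proof -
  define V where "V q = (if q \<in> J then zeros_event y n q else active_event y z n q)" for q
  define E where "E q = (if q = 0 then space P - (\<Union>q\<in>{1..d}. V q) else if q \<le> d then V q else {})" for q
  have V: "V q \<in> sets P" for q
    by (simp add: V_def hist_sets[OF sets_zeros_event] hist_sets[OF sets_active_event])
  then have V_sub: "V q \<subseteq> space P" for q by (rule sets.sets_into_space)
  have E: "E q \<in> sets P" for q
    unfolding E_def using V by auto
  have index_V: "w \<in> V q \<Longrightarrow> index (cfg n w) = q" for w q
    by (auto simp: V_def zeros_event_def active_event_def split: if_splits)
  have E_index: "w \<in> E q \<Longrightarrow> q \<noteq> 0 \<Longrightarrow> q \<in> {1..d} \<and> w \<in> V q \<and> index (cfg n w) = q" for w q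
    using index_V by (auto simp: E_def split: if_splits)
  have "disjoint_family E"
    unfolding disjoint_family_on_def
  proof (intro ballI impI)
    fix p q :: nat assume "p \<noteq> q"
    have "False" if "w \<in> E p" "w \<in> E q" for w
    proof (cases "p = 0 \<or> q = 0")
      case True
      then show False
        using that \<open>p \<noteq> q\<close> E_index[of w p] E_index[of w q] by (auto simp: E_def)
    next
      case False
      then show False using that \<open>p \<noteq> q\<close> E_index by blast
    qed
    then show "E p \<inter> E q = {}" by blast
  qed
  moreover have UN: "(\<Union>q. E q) = space P"
  proof (intro equalityI subsetI)
    fix w assume w: "w \<in> space P"
    show "w \<in> (\<Union>q. E q)"
    proof (cases "\<exists>q\<in>{1..d}. w \<in> V q")
      case True
      then obtain q where "q \<in> {1..d}" "w \<in> V q" by blast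
      then show ?thesis by (intro UN_I[of q]) (auto simp: E_def)
    next
      case False
      then show ?thesis using w by (intro UN_I[of 0]) (auto simp: E_def)
    qed
  qed (use E sets.sets_into_space in blast)
  ultimately have split: "(\<integral>\<^sup>+w. ennreal (potential y z (cfg m w)) \<partial>P) =
      (\<Sum>q. \<integral>\<^sup>+w\<in>E q. ennreal (potential y z (cfg m w)) \<partial>P)" for m
  proof -
    have "(\<lambda>w. ennreal (potential y z (cfg m w))) \<in> borel_measurable P"
      using measurable_from_subalg[OF subalgebra_hist potential_measurable[OF z]] by measurable
    then have "(\<integral>\<^sup>+w\<in>(\<Union>q. E q). ennreal (potential y z (cfg m w)) \<partial>P) =
        (\<Sum>q. \<integral>\<^sup>+w\<in>E q. ennreal (potential y z (cfg m w)) \<partial>P)"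
      using E \<open>disjoint_family E\<close> by (intro nn_integral_disjoint_family)
    moreover have "(\<integral>\<^sup>+w\<in>space P. ennreal (potential y z (cfg m w)) \<partial>P) =
        (\<integral>\<^sup>+w. ennreal (potential y z (cfg m w)) \<partial>P)"
      by (intro nn_integral_cong) simp
    ultimately show ?thesis unfolding UN by simp
  qed
  have eq: "(\<integral>\<^sup>+w\<in>E q. ennreal (potential y z (cfg (Suc n) w)) \<partial>P) =
      (\<integral>\<^sup>+w\<in>E q. ennreal (potential y z (cfg n w)) \<partial>P)" if "q \<noteq> 0" for q
  proof (cases "q \<le> d")
    case True
    then have "E q = V q" using that by (simp add: E_def)
    show ?thesis
    proof (cases "q \<in> J")
      case True
      have "E q = zeros_event y n q" unfolding \<open>E q = V q\<close> V_def using True by (rule if_P)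
      then show ?thesis by (simp only:) (rule integral_zeros_step[OF True y])
    next
      case False
      then have "q \<in> {1..d} - J" using \<open>q \<le> d\<close> that by simp
      have "E q = active_event y z n q" unfolding \<open>E q = V q\<close> V_def using False by (rule if_not_P)
      then show ?thesis by (simp only:) (rule integral_active_step[OF \<open>q \<in> {1..d} - J\<close> z])
    qed
  next
    case False
    then have "E q = {}" using that by (simp add: E_def)
    then show ?thesis by (simp del: config_at.simps)
  qed
  have rest: "potential y z (cfg (Suc n) w) \<le> potential y z (cfg n w) \<and>
      (y = z \<longrightarrow> potential y z (cfg (Suc n) w) = potential y z (cfg n w))" if w: "w \<in> E 0" for w
  proof -
    have wP: "w \<in> space P" and notV: "\<And>q. q \<in> {1..d} \<Longrightarrow> w \<notin> V q"
      using w by (auto simp: E_def)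
    have valid: "valid (cfg n w)" using wP by (rule valid_cfg)
    let ?i = "index (cfg n w)"
    have not0: "\<not> (phase (cfg n w) = 0 \<and> ?i \<in> J \<and>
      (\<forall>k\<in>J. k < ?i \<longrightarrow> (\<forall>l\<in>{1..d}. zero_part (cfg n w) k (t l) \<le> y l)))"
    proof
      assume a: "phase (cfg n w) = 0 \<and> ?i \<in> J \<and>
        (\<forall>k\<in>J. k < ?i \<longrightarrow> (\<forall>l\<in>{1..d}. zero_part (cfg n w) k (t l) \<le> y l))"
      then have "w \<in> zeros_event y n ?i" unfolding zeros_event_def using wP by blast
      moreover have "V ?i = zeros_event y n ?i" unfolding V_def using a by (simp only: if_True)
      moreover have "?i \<in> {1..d}" using a J_subset by blast
      ultimately show False using notV by blast
    qed
    have not1: "\<not> ((phase (cfg n w) = 2 \<or> phase (cfg n w) = 1 \<and> ?i \<le> d \<and>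
        ?i \<notin> J \<and> current (cfg n w) (t ?i) \<noteq> 0) \<and>
      (\<forall>k\<in>J. \<forall>l\<in>{1..d}. zero_part (cfg n w) k (t l) \<le> y l) \<and> (\<forall>l\<in>{1..d}. current (cfg n w) (t l) \<le> z l))"
      (is "\<not> (?A \<and> ?B)")
    proof
      assume a: "?A \<and> ?B"
      then have "w \<in> active_event y z n ?i" unfolding active_event_def using wP by blast
      moreover have i: "?i \<in> {1..d} - J"
        using conjunct1[OF a] valid by (cases "cfg n w") simp_all
      moreover from i have "V ?i = active_event y z n ?i" unfolding V_def by (intro if_not_P) simp
      ultimately show False using notV[of ?i] by simp
    qed
    show ?thesis
      unfolding config_at.simps
      by (rule potential_not_active_step[OF valid z not0 not1 finite_atoms[OF wP] atoms_C0[OF wP]])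
  qed
  have le0: "(\<integral>\<^sup>+w\<in>E 0. ennreal (potential y z (cfg (Suc n) w)) \<partial>P) \<le>
      (\<integral>\<^sup>+w\<in>E 0. ennreal (potential y z (cfg n w)) \<partial>P)"
  proof (rule nn_integral_mono)
    fix w
    show "ennreal (potential y z (cfg (Suc n) w)) * indicator (E 0) w \<le>
        ennreal (potential y z (cfg n w)) * indicator (E 0) w"
      using rest[of w] by (cases "w \<in> E 0") (simp_all add: ennreal_leI del: config_at.simps)
  qed
  show ?le
    unfolding split
  proof (rule suminf_le)
    fix q
    show "(\<integral>\<^sup>+w\<in>E q. ennreal (potential y z (cfg (Suc n) w)) \<partial>P) \<le>
      (\<integral>\<^sup>+w\<in>E q. ennreal (potential y z (cfg n w)) \<partial>P)"
    proof (cases "q = 0")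
      case True
      then show ?thesis using le0 by (simp only:)
    next
      case False
      then show ?thesis by (intro eq_refl eq)
    qed
  qed simp_all
  assume yz: "y = z"
  have eq0: "(\<integral>\<^sup>+w\<in>E 0. ennreal (potential y z (cfg (Suc n) w)) \<partial>P) =
      (\<integral>\<^sup>+w\<in>E 0. ennreal (potential y z (cfg n w)) \<partial>P)"
  proof (rule nn_integral_cong)
    fix w
    show "ennreal (potential y z (cfg (Suc n) w)) * indicator (E 0) w =
        ennreal (potential y z (cfg n w)) * indicator (E 0) w"
    proof (cases "w \<in> E 0")
      case True
      then have "potential y z (cfg (Suc n) w) = potential y z (cfg n w)"
        using rest[of w] yz by blast
      then show ?thesis by (simp only:)
    qed simp
  qed
  show "(\<integral>\<^sup>+w. ennreal (potential y z (cfg (Suc n) w)) \<partial>P) = (\<integral>\<^sup>+w. ennreal (potential y z (cfg n w)) \<partial>P)"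
    unfolding split
  proof (rule suminf_cong)
    fix q
    show "(\<integral>\<^sup>+w\<in>E q. ennreal (potential y z (cfg (Suc n) w)) \<partial>P) =
      (\<integral>\<^sup>+w\<in>E q. ennreal (potential y z (cfg n w)) \<partial>P)"
    proof (cases "q = 0")
      case True
      then show ?thesis using eq0 by (simp only:)
    next
      case False
      then show ?thesis by (rule eq)
    qed
  qed
qed

section \<open>The initial value of the potential\<close>

definition initial_potential :: "(nat \<Rightarrow> real) \<Rightarrow> (nat \<Rightarrow> real) \<Rightarrow> real" where
  "initial_potential y z = exp (- (\<Sum>k\<in>J. measure (mu_J \<mu> J t k) (exceeding y)) - measure mut (exceeding z))"

lemma integral_potential_0:
  "(\<integral>\<^sup>+w. ennreal (potential y z (cfg 0 w)) \<partial>P) = ennreal (initial_potential y z)"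
proof -
  have "{k \<in> J. Suc 0 \<le> k} = J" using J_subset by auto
  then have "potential y z (cfg 0 w) = initial_potential y z" for w
    using J_subset by (auto simp: potential_def initial_potential_def)
  then show ?thesis by (simp add: emeasure_space_1)
qed

lemma integral_potential_le:
  assumes y: "\<And>l. 0 < y l" and z: "\<And>l. 0 < z l"
  shows "(\<integral>\<^sup>+w. ennreal (potential y z (cfg n w)) \<partial>P) \<le> ennreal (initial_potential y z)"
proof (induction n)
  case 0
  show ?case by (simp only: integral_potential_0 order_refl)
next
  case (Suc n)
  show ?case using integral_potential_step(1)[of y z n, OF y z] Suc by (rule order_trans)
qed

lemma integral_potential_eq:
  assumes y: "\<And>l. 0 < y l"
  shows "(\<integral>\<^sup>+w. ennreal (potential y y (cfg n w)) \<partial>P) = ennreal (initial_potential y y)"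
proof (induction n)
  case 0
  show ?case by (rule integral_potential_0)
next
  case (Suc n)
  show ?case using integral_potential_step(2)[of y y n, OF y y refl] Suc by (rule trans)
qed

lemma exists_first_positive:
  assumes "f \<in> C0" "j \<in> J" "f (t j) \<noteq> 0"
  shows "\<exists>k\<in>J. 0 < f (t k) \<and> (\<forall>i\<in>J. i < k \<longrightarrow> f (t i) = 0)"
proof -
  define k where "k = (LEAST k. k \<in> J \<and> f (t k) \<noteq> 0)"
  have k: "k \<in> J \<and> f (t k) \<noteq> 0"
    unfolding k_def using assms by (intro LeastI[of "\<lambda>k. k \<in> J \<and> f (t k) \<noteq> 0" j]) auto
  moreover have "\<forall>i\<in>J. i < k \<longrightarrow> f (t i) = 0"
    unfolding k_def using not_less_Least by blast
  ultimately show ?thesis using C0_nonneg[OF assms(1), of "t k"] by (auto simp: less_le)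
qed

text \<open>Each function belongs to exactly one piece: that of the first index in \<open>J\<close>
  at which it is positive, or that of \<open>mut\<close> if it vanishes at all points of
  \<open>J\<close>.\<close>

lemma measure_decomposition:
  assumes A: "A \<in> sets C0_borel" and fin: "emeasure \<mu> A < \<infinity>"
  shows "(\<Sum>k\<in>J. measure (mu_J \<mu> J t k) A) + measure mut A = measure \<mu> A"
proof -
  have cJ[measurable]: "countable J" using finite_J by (rule countable_finite)
  have A_sub: "A \<subseteq> C0" using sets.sets_into_space[OF A] by (simp add: space_C0_borel)
  define a where "a k = {f \<in> A. f (t k) > 0 \<and> (\<forall>i\<in>J. i < k \<longrightarrow> f (t i) = 0)}" for k
  define a0 where "a0 = {f \<in> A. \<forall>j\<in>J. f (t j) = 0}"
  have sets_Q: "{f \<in> A. Q f} \<in> sets \<mu>" if "Measurable.pred C0_borel Q" for Q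
  proof -
    have "{f \<in> A. Q f} = A \<inter> {f \<in> space C0_borel. Q f}"
      using A_sub by (auto simp: space_C0_borel)
    then show ?thesis using that A by (simp add: sets_mu pred_def)
  qed
  have "a k \<in> sets \<mu>" for k unfolding a_def by (rule sets_Q) measurable
  moreover have "a0 \<in> sets \<mu>" unfolding a0_def by (rule sets_Q) measurable
  ultimately have sets: "a k \<in> sets \<mu>" "a0 \<in> sets \<mu>" for k by blast+
  have fin': "emeasure \<mu> B \<noteq> \<infinity>" if "B \<subseteq> A" for B
  proof -
    have "emeasure \<mu> B \<le> emeasure \<mu> A" using that A by (intro emeasure_mono) (auto simp: sets_mu)
    then show ?thesis using fin by auto
  qed
  have sub: "a k \<subseteq> A" "a0 \<subseteq> A" "(\<Union>k\<in>J. a k) \<subseteq> A" for k by (auto simp: a_def a0_def)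
  have "f \<in> (\<Union>k\<in>J. a k) \<union> a0" if f: "f \<in> A" for f
  proof (cases "f \<in> a0")
    case False
    then obtain j where "j \<in> J" "f (t j) \<noteq> 0" using f unfolding a0_def by blast
    then show ?thesis using exists_first_positive[of f j] A_sub f unfolding a_def by blast
  qed simp
  then have "A = (\<Union>k\<in>J. a k) \<union> a0"
    using sub by blast
  then have "measure \<mu> A = measure \<mu> ((\<Union>k\<in>J. a k) \<union> a0)" by simp
  also have "\<dots> = measure \<mu> (\<Union>k\<in>J. a k) + measure \<mu> a0"
  proof (rule measure_Union[OF fin'[OF sub(3)] fin'[OF sub(2)] _ sets(2)])
    show "(\<Union>k\<in>J. a k) \<in> sets \<mu>" using finite_J sets(1) by (rule sets.finite_UN)
    have False if "f \<in> a0" "f \<in> a k" "k \<in> J" for f k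
    proof -
      have "f (t k) = 0" using that(1,3) by (simp add: a0_def)
      moreover have "0 < f (t k)" using that(2) by (simp add: a_def)
      ultimately show False by simp
    qed
    then show "(\<Union>k\<in>J. a k) \<inter> a0 = {}" by blast
  qed
  also have "measure \<mu> (\<Union>k\<in>J. a k) = (\<Sum>k\<in>J. measure \<mu> (a k))"
  proof (rule measure_finite_Union[OF finite_J _ _ fin'[OF sub(1)]])
    show "a ` J \<subseteq> sets \<mu>" using sets(1) by blast
    have False if "f \<in> a k" "f \<in> a l" "k \<in> J" "k < l" for f k l
    proof -
      have "0 < f (t k)" using that(1) by (simp add: a_def)
      moreover have "f (t k) = 0" using that(2-4) by (simp add: a_def)
      ultimately show False by simp
    qed
    then have "a k \<inter> a l = {}" if "k \<in> J" "l \<in> J" "k \<noteq> l" for k l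
      using that by (meson disjoint_iff linorder_neqE_nat)
    then show "disjoint_family_on a J"
      unfolding disjoint_family_on_def by blast
  qed
  finally have "measure \<mu> A = (\<Sum>k\<in>J. measure \<mu> (a k)) + measure \<mu> a0" .
  moreover have "measure (mu_J \<mu> J t k) A = measure \<mu> (a k)" for k
    unfolding measure_def emeasure_mu_J[OF A] a_def ..
  moreover have "measure mut A = measure \<mu> a0"
    unfolding measure_def emeasure_mut[OF A] a0_def ..
  ultimately show ?thesis by (simp only:)
qed

lemma initial_potential_eq:
  assumes "\<And>l. 0 < y l"
  shows "initial_potential y y = exp (- measure \<mu> (exceeding y))"
proof -
  have "(\<Sum>k\<in>J. measure (mu_J \<mu> J t k) (exceeding y)) + measure mut (exceeding y) = measure \<mu> (exceeding y)"
    by (rule measure_decomposition[OF sets_exceeding exceeding_finite[of y, OF assms]])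
  then have "- (\<Sum>k\<in>J. measure (mu_J \<mu> J t k) (exceeding y)) - measure mut (exceeding y) = - measure \<mu> (exceeding y)"
    by linarith
  then show ?thesis unfolding initial_potential_def by (simp only:)
qed

section \<open>Almost sure termination\<close>

text \<open>Restricting \<open>\<mu>\<close> to functions vanishing at the points of
  \<open>J\<close> removes finitely many sets of finite mass, so an infinite mass stays infinite.
  This is what forces the search to succeed.\<close>

lemma mut_infinite:
  assumes i: "i \<in> {1..d} - J"
  shows "emeasure mut {f \<in> C0. f (t i) > 0} = \<infinity>"
proof (rule ccontr)
  let ?A = "{f \<in> C0. f (t i) > 0}"
  assume "emeasure mut ?A \<noteq> \<infinity>"
  have A: "?A \<in> sets C0_borel" by (rule sets_Collect_C0) measurable
  have cJ[measurable]: "countable J" using finite_J by (rule countable_finite)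
  have A0: "{f \<in> ?A. \<forall>j\<in>J. f (t j) = 0} \<in> sets C0_borel"
    unfolding mem_Collect_eq conj_assoc by (rule sets_Collect_C0) measurable
  have Aj: "{f \<in> C0. f (t j) > 0} \<in> sets C0_borel" for j by (rule sets_Collect_C0) measurable
  have "?A \<subseteq> {f \<in> ?A. \<forall>j\<in>J. f (t j) = 0} \<union> (\<Union>j\<in>J. {f \<in> C0. f (t j) > 0})"
  proof
    fix f assume f: "f \<in> ?A"
    show "f \<in> {f \<in> ?A. \<forall>j\<in>J. f (t j) = 0} \<union> (\<Union>j\<in>J. {f \<in> C0. f (t j) > 0})"
    proof (cases "\<forall>j\<in>J. f (t j) = 0")
      case False
      then obtain j where "j \<in> J" "f (t j) \<noteq> 0" by blast
      moreover have "0 < f (t j)" using f C0_nonneg[of f "t j"] \<open>f (t j) \<noteq> 0\<close> by (simp add: less_le)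
      ultimately show ?thesis using f by blast
    qed (use f in simp)
  qed
  then have "emeasure \<mu> ?A \<le> emeasure \<mu> ({f \<in> ?A. \<forall>j\<in>J. f (t j) = 0} \<union> (\<Union>j\<in>J. {f \<in> C0. f (t j) > 0}))"
    using A0 Aj finite_J by (intro emeasure_mono) (auto simp: sets_mu)
  also have "\<dots> \<le> emeasure \<mu> {f \<in> ?A. \<forall>j\<in>J. f (t j) = 0} + emeasure \<mu> (\<Union>j\<in>J. {f \<in> C0. f (t j) > 0})"
    using A0 Aj finite_J by (intro emeasure_subadditive) (auto simp: sets_mu)
  also have "\<dots> \<le> emeasure mut ?A + (\<Sum>j\<in>J. emeasure \<mu> {f \<in> C0. f (t j) > 0})"
    unfolding emeasure_mut[OF A] using Aj finite_J
    by (intro add_left_mono emeasure_subadditive_finite) (auto simp: sets_mu)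
  also have "\<dots> < \<infinity>"
    using \<open>emeasure mut ?A \<noteq> \<infinity>\<close> J_finite finite_J by (simp add: ennreal_sum_less_top less_top)
  finally show False using not_J_infinite[OF i] by simp
qed


text \<open>While the run searches at index \<open>i\<close>, the potential with threshold \<open>\<delta>\<close> at \<open>t i\<close> stays bounded
  away from zero once the upper level is below \<open>\<delta>\<close>, whereas its expectation is at most
  \<open>exp (- \<mu>~ {f. f (t i) > \<delta>})\<close>, which vanishes as \<open>\<delta>\<close> tends to zero. Hence searching forever has
  probability zero.\<close>

definition searching :: "nat \<Rightarrow> nat \<Rightarrow> real \<Rightarrow> nat \<Rightarrow> 'p set" where
  "searching i L \<delta> n = {w \<in> space P. phase (cfg n w) = 2 \<and> index (cfg n w) = i \<and> upper (cfg n w) \<le> ereal \<delta> \<and>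
    (\<forall>k\<in>J. \<forall>l\<in>{1..d}. zero_part (cfg n w) k (t l) \<le> real (Suc L)) \<and>
    (\<forall>l\<in>{1..d}. current (cfg n w) (t l) \<le> real (Suc L))}"

lemma sets_searching: "searching i L \<delta> n \<in> sets P"
proof -
  note [measurable] = zero_part_measurable current_measurable upper_measurable
  have [measurable]: "countable J" using finite_J by (rule countable_finite)
  have 1: "Measurable.pred (hist n) (\<lambda>w. upper (cfg n w) \<le> ereal \<delta> \<and>
      (\<forall>k\<in>J. \<forall>l\<in>{1..d}. zero_part (cfg n w) k (t l) \<le> real (Suc L)) \<and>
      (\<forall>l\<in>{1..d}. current (cfg n w) (t l) \<le> real (Suc L)))"
    by measurable
  have "searching i L \<delta> n = (\<lambda>w. phase (cfg n w)) -` {2} \<inter> space (hist n) \<inter>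
      ((\<lambda>w. index (cfg n w)) -` {i} \<inter> space (hist n)) \<inter>
      {w \<in> space (hist n). upper (cfg n w) \<le> ereal \<delta> \<and>
        (\<forall>k\<in>J. \<forall>l\<in>{1..d}. zero_part (cfg n w) k (t l) \<le> real (Suc L)) \<and>
        (\<forall>l\<in>{1..d}. current (cfg n w) (t l) \<le> real (Suc L))}"
    unfolding searching_def space_hist by blast
  also have "\<dots> \<in> sets (hist n)"
    by (intro sets.Int measurable_sets[OF phase_measurable] measurable_sets[OF index_measurable]
        predE[OF 1]) simp_all
  finally show ?thesis by (rule hist_sets)
qed

text \<open>The threshold is \<open>\<delta>\<close> only in step 3 and only at \<open>t i\<close>;
  everywhere else it is the bound \<open>Suc L\<close>, so the potential stays positive on the
  event. The factor on the left does not depend on \<open>\<delta>\<close>, which makes the estimate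
  useful as \<open>\<delta>\<close> tends to zero.\<close>

lemma prob_searching_le:
  assumes i: "i \<in> {1..d}" and \<delta>: "0 < \<delta>"
  shows "exp (- measure mut (exceeding (\<lambda>_. real (Suc L)))) * prob (searching i L \<delta> n) \<le>
    exp (- measure mut {f \<in> C0. \<delta> < f (t i)})"
proof -
  define K where "K = real (Suc L)"
  define z where "z l = (if l = i then \<delta> else K)" for l
  have K: "0 < K" by (simp add: K_def)
  have z: "0 < z l" for l using \<delta> K by (simp add: z_def)
  let ?q = "exp (- measure mut (exceeding (\<lambda>_. K)))"
  have low: "?q \<le> potential (\<lambda>_. K) z (cfg n w)" if w: "w \<in> searching i L \<delta> n" for w
  proof -
    have wP: "w \<in> space P" and ph: "phase (cfg n w) = 2" "index (cfg n w) = i" "upper (cfg n w) \<le> ereal \<delta>"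
      and y_ok: "\<forall>k\<in>J. \<forall>l\<in>{1..d}. zero_part (cfg n w) k (t l) \<le> K"
      and c_ok: "\<forall>l\<in>{1..d}. current (cfg n w) (t l) \<le> K"
      using w unfolding searching_def K_def by blast+
    \<comment> \<open>During a search the maximum vanishes at \<open>t i\<close>, hence respects
      even the small threshold.\<close>
    have "current (cfg n w) (t i) = 0"
      using valid_cfg[OF wP, of n] ph(1,2) by (cases "cfg n w") auto
    then have z_ok: "\<forall>l\<in>{1..d}. current (cfg n w) (t l) \<le> z l"
      using c_ok \<delta> by (simp add: z_def)
    let ?A = "{f \<in> exceeding z. below (index (cfg n w)) (current (cfg n w)) f \<and>
         ereal (f (t (index (cfg n w)))) < upper (cfg n w)}"
    have pot: "potential (\<lambda>_. K) z (cfg n w) = exp (- measure mut ?A)"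
    proof -
      have "phase (cfg n w) \<noteq> 0" "phase (cfg n w) \<noteq> 3" using ph(1) by simp_all
      then have "potential (\<lambda>_. K) z (cfg n w) =
          (if (\<forall>k\<in>J. \<forall>l\<in>{1..d}. zero_part (cfg n w) k (t l) \<le> K) \<and> (\<forall>l\<in>{1..d}. current (cfg n w) (t l) \<le> z l)
           then exp (- measure mut ?A) else 0)"
        unfolding potential_def by (simp only: if_False)
      also have "\<dots> = exp (- measure mut ?A)"
        by (rule if_P[OF conjI[OF y_ok z_ok]])
      finally show ?thesis .
    qed
    \<comment> \<open>Below the upper level, which is at most \<open>\<delta>\<close>, a function
      cannot exceed the threshold at \<open>t i\<close>, so it exceeds one of the large thresholds
      elsewhere.\<close>
    have sub: "?A \<subseteq> exceeding (\<lambda>_. K)"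
    proof
      fix f assume f: "f \<in> ?A"
      then obtain l where l: "l \<in> {1..d}" "z l < f (t l)" unfolding exceeding_def by blast
      have "ereal (f (t i)) < upper (cfg n w)" using f unfolding ph(2) by blast
      then have "ereal (f (t i)) < ereal \<delta>" using ph(3) by (rule less_le_trans)
      then have "l \<noteq> i" using l by (auto simp: z_def)
      then have "K < f (t l)" using l by (simp add: z_def)
      moreover have "f \<in> C0" using f unfolding exceeding_def by blast
      ultimately show "f \<in> exceeding (\<lambda>_. K)" using l(1) unfolding exceeding_def by blast
    qed
    have "measure mut ?A \<le> measure mut (exceeding (\<lambda>_. K))"
      unfolding measure_def
      using sub mut_exceeding_finite[of "\<lambda>_. K" "exceeding (\<lambda>_. K)"] K
      by (intro enn2real_mono emeasure_mono) (auto simp: sets_mut sets_exceeding)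
    then show ?thesis unfolding pot by simp
  qed
  have "ennreal (?q * prob (searching i L \<delta> n)) = ennreal ?q * emeasure P (searching i L \<delta> n)"
    by (simp add: ennreal_mult emeasure_eq_measure)
  also have "\<dots> = (\<integral>\<^sup>+w. ennreal ?q * indicator (searching i L \<delta> n) w \<partial>P)"
    using sets_searching by (rule nn_integral_cmult_indicator[symmetric])
  also have "\<dots> \<le> (\<integral>\<^sup>+w. ennreal (potential (\<lambda>_. K) z (cfg n w)) \<partial>P)"
  proof (rule nn_integral_mono)
    fix w
    show "ennreal ?q * indicator (searching i L \<delta> n) w \<le> ennreal (potential (\<lambda>_. K) z (cfg n w))"
      by (cases "w \<in> searching i L \<delta> n") (simp_all add: low ennreal_leI)
  qed
  also have "\<dots> \<le> ennreal (initial_potential (\<lambda>_. K) z)"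
    by (rule integral_potential_le[OF K z])
  also have "\<dots> \<le> ennreal (exp (- measure mut {f \<in> C0. \<delta> < f (t i)}))"
  proof (rule ennreal_leI)
    have "{f \<in> C0. \<delta> < f (t i)} \<subseteq> exceeding z"
      using i unfolding exceeding_def by (auto simp: z_def intro!: bexI[of _ i])
    then have "measure mut {f \<in> C0. \<delta> < f (t i)} \<le> measure mut (exceeding z)"
      unfolding measure_def using mut_exceeding_finite[OF z order_refl]
      by (intro enn2real_mono emeasure_mono) (auto simp: sets_mut sets_exceeding)
    moreover have "0 \<le> (\<Sum>k\<in>J. measure (mu_J \<mu> J t k) (exceeding (\<lambda>_. K)))"
      by (intro sum_nonneg) simp
    ultimately show "initial_potential (\<lambda>_. K) z \<le> exp (- measure mut {f \<in> C0. \<delta> < f (t i)})"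
      unfolding initial_potential_def by simp
  qed
  finally show ?thesis unfolding K_def by simp
qed

lemma mut_exceed_at_top:
  assumes i: "i \<in> {1..d} - J"
  shows "filterlim (\<lambda>m. measure mut {f \<in> C0. 1 / real (Suc m) < f (t i)}) at_top sequentially"
proof -
  let ?A = "\<lambda>m. {f \<in> C0. 1 / real (Suc m) < f (t i)}"
  have A: "?A m \<in> sets C0_borel" for m by (rule sets_Collect_C0) measurable
  have fin: "emeasure mut (?A m) < \<infinity>" for m
    using i by (intro mut_exceed_finite[of i "1 / real (Suc m)"] A) auto
  have "incseq ?A"
  proof (rule incseq_SucI, rule subsetI)
    fix m f assume "f \<in> ?A m"
    moreover have "1 / real (Suc (Suc m)) \<le> 1 / real (Suc m)" by (simp add: frac_le)
    ultimately show "f \<in> ?A (Suc m)" by auto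
  qed
  moreover have "range ?A \<subseteq> sets mut" using A by (auto simp: sets_mut)
  ultimately have "(\<lambda>m. emeasure mut (?A m)) \<longlonglongrightarrow> emeasure mut (\<Union>m. ?A m)"
    by (intro Lim_emeasure_incseq)
  also have "(\<Union>m. ?A m) = {f \<in> C0. f (t i) > 0}"
  proof (intro equalityI subsetI)
    fix f assume "f \<in> (\<Union>m. ?A m)"
    then obtain m where "f \<in> C0" "1 / real (Suc m) < f (t i)" by blast
    moreover have "0 < 1 / real (Suc m)" by simp
    ultimately show "f \<in> {f \<in> C0. f (t i) > 0}" using less_trans by blast
  next
    fix f assume f: "f \<in> {f \<in> C0. f (t i) > 0}"
    then obtain m where "1 / real (Suc m) < f (t i)" by (metis mem_Collect_eq nat_approx_posE)
    then show "f \<in> (\<Union>m. ?A m)" using f by blast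
  qed
  also have "emeasure mut {f \<in> C0. f (t i) > 0} = \<infinity>" by (rule mut_infinite[OF i])
  finally have lim: "(\<lambda>m. emeasure mut (?A m)) \<longlonglongrightarrow> \<infinity>" .
  show ?thesis
    unfolding filterlim_at_top_dense
  proof
    fix r :: real
    have "\<forall>\<^sub>F m in sequentially. ennreal r < emeasure mut (?A m)"
      using order_tendstoD(1)[OF lim, of "ennreal r"] by simp
    then show "\<forall>\<^sub>F m in sequentially. r < measure mut (?A m)"
    proof (rule eventually_mono)
      fix m assume "ennreal r < emeasure mut (?A m)"
      also have "emeasure mut (?A m) = ennreal (measure mut (?A m))"
        using fin[of m] by (intro emeasure_eq_ennreal_measure) simp
      finally show "r < measure mut (?A m)"
        by (meson ennreal_leI leD leI)
    qed
  qed
qed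

text \<open>\<open>U m\<close> is the event of being in the search from some time on, with upper
  level at most \<open>1 / real (Suc m)\<close>. Continuity from below carries the estimate for
  single times over to it, and the bound tends to zero with the level, while the fixed
  \<open>L\<close> keeps the factor \<open>?q\<close> away from zero.\<close>

lemma AE_not_searching_forever:
  assumes i: "i \<in> {1..d} - J"
  shows "AE w in P. \<exists>m. \<not> (\<forall>\<^sub>F n in sequentially. w \<in> searching i L (1 / real (Suc m)) n)"
proof -
  define U where "U m = (\<Union>n0. \<Inter>n\<in>{n0..}. searching i L (1 / real (Suc m)) n)" for m
  have D: "(\<Inter>n\<in>{n0..}. searching i L \<delta> n) \<in> sets P" for n0 \<delta>
    by (rule sets.countable_INT') (use sets_searching in auto)
  have U: "U m \<in> sets P" for m
    unfolding U_def using D by (intro sets.countable_UN) auto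
  let ?q = "exp (- measure mut (exceeding (\<lambda>_. real (Suc L))))"
  have le: "?q * prob (U m) \<le> exp (- measure mut {f \<in> C0. 1 / real (Suc m) < f (t i)})" for m
  proof (rule LIMSEQ_le_const2)
    have "(\<lambda>n0. prob (\<Inter>n\<in>{n0..}. searching i L (1 / real (Suc m)) n)) \<longlonglongrightarrow> prob (U m)"
      unfolding U_def
    proof (rule finite_Lim_measure_incseq)
      show "range (\<lambda>n0. \<Inter>n\<in>{n0..}. searching i L (1 / real (Suc m)) n) \<subseteq> sets P" using D by blast
      show "incseq (\<lambda>n0. \<Inter>n\<in>{n0..}. searching i L (1 / real (Suc m)) n)"
        by (intro incseq_SucI INT_anti_mono) auto
    qed
    then show "(\<lambda>n0. ?q * prob (\<Inter>n\<in>{n0..}. searching i L (1 / real (Suc m)) n)) \<longlonglongrightarrow> ?q * prob (U m)"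
      by (intro tendsto_intros)
    have "?q * prob (\<Inter>n\<in>{n0..}. searching i L (1 / real (Suc m)) n) \<le>
        exp (- measure mut {f \<in> C0. 1 / real (Suc m) < f (t i)})" for n0
    proof -
      have "prob (\<Inter>n\<in>{n0..}. searching i L (1 / real (Suc m)) n) \<le> prob (searching i L (1 / real (Suc m)) n0)"
        by (rule finite_measure_mono) (auto simp: sets_searching)
      then have "?q * prob (\<Inter>n\<in>{n0..}. searching i L (1 / real (Suc m)) n) \<le>
          ?q * prob (searching i L (1 / real (Suc m)) n0)"
        by (intro mult_left_mono) simp_all
      also have "\<dots> \<le> exp (- measure mut {f \<in> C0. 1 / real (Suc m) < f (t i)})"
        using i by (intro prob_searching_le) simp_all
      finally show ?thesis .
    qed
    then show "\<exists>N. \<forall>n\<ge>N. ?q * prob (\<Inter>n\<in>{n..}. searching i L (1 / real (Suc m)) n) \<le>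
        exp (- measure mut {f \<in> C0. 1 / real (Suc m) < f (t i)})" by blast
  qed
  have "(\<lambda>m. exp (- measure mut {f \<in> C0. 1 / real (Suc m) < f (t i)})) \<longlonglongrightarrow> 0"
    using mut_exceed_at_top[OF i]
    by (intro filterlim_compose[OF exp_at_bot] filterlim_compose[OF filterlim_uminus_at_bot_at_top])
  then have "?q * prob (\<Inter>m. U m) \<le> 0"
  proof (rule LIMSEQ_le_const)
    have "?q * prob (\<Inter>m. U m) \<le> exp (- measure mut {f \<in> C0. 1 / real (Suc m) < f (t i)})" for m
    proof -
      have "prob (\<Inter>m. U m) \<le> prob (U m)"
        using U by (intro finite_measure_mono) auto
      then have "?q * prob (\<Inter>m. U m) \<le> ?q * prob (U m)"
        by (intro mult_left_mono) simp_all
      then show ?thesis using le[of m] by (rule order_trans)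
    qed
    then show "\<exists>N. \<forall>m\<ge>N. ?q * prob (\<Inter>m. U m) \<le> exp (- measure mut {f \<in> C0. 1 / real (Suc m) < f (t i)})"
      by blast
  qed
  then have "prob (\<Inter>m. U m) = 0"
    by (metis exp_gt_zero measure_nonneg mult_le_0_iff not_less order_antisym)
  then have "AE w in P. w \<notin> (\<Inter>m. U m)"
    using U by (intro AE_not_in) (auto simp: null_sets_def emeasure_eq_measure)
  then show ?thesis
  proof (rule eventually_mono)
    fix w assume "w \<notin> (\<Inter>m. U m)"
    then obtain m where m: "w \<notin> U m" by blast
    have "\<not> (\<forall>\<^sub>F n in sequentially. w \<in> searching i L (1 / real (Suc m)) n)"
    proof
      assume "\<forall>\<^sub>F n in sequentially. w \<in> searching i L (1 / real (Suc m)) n"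
      then obtain n0 where "\<forall>n\<ge>n0. w \<in> searching i L (1 / real (Suc m)) n"
        unfolding eventually_sequentially by blast
      then have "w \<in> U m" unfolding U_def by (intro UN_I[of n0] INT_I) simp_all
      with m show False ..
    qed
    then show "\<exists>m. \<not> (\<forall>\<^sub>F n in sequentially. w \<in> searching i L (1 / real (Suc m)) n)" ..
  qed
qed

lemma cfg_zeros: "n \<le> d \<Longrightarrow> \<exists>Xh. cfg n w = Zeros (Suc n) Xh"
proof (induction n)
  case (Suc n)
  then obtain Xh where "cfg n w = Zeros (Suc n) Xh" by auto
  then show ?case using Suc.prems by simp
qed simp

lemma cfg_first_outer: "\<exists>Xh. cfg (Suc d) w = Outer 1 Xh (\<lambda>_. 0)"
  using cfg_zeros[of d w] by auto

text \<open>While a search fails only its levels change, so one \<open>L\<close> bounds the values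
  at all points \<open>t l\<close> throughout, and halving brings the levels below every
  \<open>1 / real (Suc m)\<close>.\<close>

lemma search_forever:
  assumes w: "w \<in> space P" and c0: "cfg n0 w = Search i Xh Xt cu cl"
    and forever: "\<And>m. phase (cfg (n0 + m) w) = 2"
  shows "\<exists>L. \<forall>m. \<forall>\<^sub>F n in sequentially. w \<in> searching i L (1 / real (Suc m)) n"
proof -
  have cl: "0 < cl" using valid_cfg[OF w, of n0] by (simp add: c0)
  \<comment> \<open>The upper level is the previous lower level, whence the exponent
    \<open>m - 1\<close>; at the start it is left open.\<close>
  have c: "\<exists>cu. cfg (n0 + m) w = Search i Xh Xt cu (cl / 2 ^ m) \<and> (0 < m \<longrightarrow> cu = ereal (cl / 2 ^ (m - 1)))" for m
  proof (induction m)
    case 0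
    then show ?case by (simp add: c0)
  next
    case (Suc m)
    then obtain cu where cu: "cfg (n0 + m) w = Search i Xh Xt cu (cl / 2 ^ m)" by blast
    then have "cfg (n0 + Suc m) w = Search i Xh Xt (ereal (cl / 2 ^ m)) (cl / 2 ^ m / 2)"
      using forever[of "Suc m"] by (simp split: if_splits)
    then show ?case by (simp add: field_simps)
  qed
  define V where "V = insert 0 ((\<lambda>(k, l). Xh k (t l)) ` (J \<times> {1..d}) \<union> (\<lambda>l. Xt (t l)) ` {1..d})"
  have V: "finite V" unfolding V_def using finite_J by simp
  obtain L :: nat where L: "Max V \<le> real L" using real_arch_simple by blast
  have le: "v \<in> V \<Longrightarrow> v \<le> real (Suc L)" for v
    using Max_ge[OF V, of v] L by linarith
  have "\<forall>\<^sub>F n in sequentially. w \<in> searching i L (1 / real (Suc m)) n" for m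
  proof -
    have "(\<lambda>k. cl * (1 / 2) ^ k) \<longlonglongrightarrow> cl * 0"
      by (intro tendsto_mult tendsto_const LIMSEQ_realpow_zero) auto
    then have "\<forall>\<^sub>F k in sequentially. cl * (1 / 2) ^ k < 1 / real (Suc m)"
      by (rule order_tendstoD) simp
    then obtain k0 where k0: "\<And>k. k0 \<le> k \<Longrightarrow> cl * (1 / 2) ^ k < 1 / real (Suc m)"
      by (auto simp: eventually_sequentially)
    have "w \<in> searching i L (1 / real (Suc m)) n" if n: "n0 + Suc k0 \<le> n" for n
    proof -
      define r where "r = n - n0"
      have r: "n = n0 + r" "0 < r" "k0 \<le> r - 1" using n by (auto simp: r_def)
      obtain cu where cu: "cfg n w = Search i Xh Xt cu (cl / 2 ^ r)" "cu = ereal (cl / 2 ^ (r - 1))"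
        using c[of r] r by auto
      have "cl / 2 ^ (r - 1) \<le> 1 / real (Suc m)"
        using k0[OF r(3)] by (simp add: power_one_over field_simps)
      then have "cu \<le> ereal (1 / real (Suc m))"
        unfolding cu(2) by simp
      moreover have "\<forall>k\<in>J. \<forall>l\<in>{1..d}. Xh k (t l) \<le> real (Suc L)" "\<forall>l\<in>{1..d}. Xt (t l) \<le> real (Suc L)"
        by (intro ballI le; force simp: V_def)+
      ultimately show ?thesis
        using w unfolding searching_def mem_Collect_eq
        unfolding cu(1) phase.simps index.simps zero_part.simps current.simps upper.simps by blast
    qed
    then show ?thesis by (auto simp: eventually_sequentially)
  qed
  then show ?thesis by blast
qed

text \<open>Induction on the number of indices left in step 3: each is passed directly, or after a
  finite search, or causes an endless one. The statement holds at every sample point; probability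
  enters only in excluding endless searches.\<close>

lemma run_alternative:
  assumes w: "w \<in> space P"
  shows "(\<exists>n. is_Stopped (cfg n w)) \<or>
    (\<exists>i\<in>{1..d} - J. \<exists>L. \<forall>m. \<forall>\<^sub>F n in sequentially. w \<in> searching i L (1 / real (Suc m)) n)"
proof -
  have "(\<exists>n. is_Stopped (cfg n w)) \<or>
    (\<exists>i\<in>{1..d} - J. \<exists>L. \<forall>m. \<forall>\<^sub>F n in sequentially. w \<in> searching i L (1 / real (Suc m)) n)" (is ?Q)
    if "cfg n w = Outer i Xh Xt" "i \<le> d + 1" for n i Xh Xt
    using that
  proof (induction "d + 1 - i" arbitrary: n i Xh Xt)
    case 0
    then have "is_Stopped (cfg (Suc n) w)" by simp
    then show ?case by blast
  next
    case (Suc r)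
    then have i: "i \<le> d" "r = d + 1 - Suc i" by auto
    have next_outer: ?Q if "cfg n' w = Outer (Suc i) Xh' Xt'" for n' Xh' Xt'
      using Suc.hyps(1)[OF i(2) that] i(1) by simp
    show ?case
    proof (cases "i \<notin> J \<and> Xt (t i) = 0")
      case False
      then have "\<exists>Xt'. cfg (Suc n) w = Outer (Suc i) Xh Xt'" using Suc.prems i by auto
      then show ?thesis using next_outer by blast
    next
      case True
      then have c: "cfg (Suc n) w = Search i Xh Xt \<infinity> (c i)" using Suc.prems i by simp
      have iJ: "i \<in> {1..d} - J" using valid_cfg[OF w, of "Suc n"] unfolding c by simp
      show ?thesis
      proof (cases "\<forall>m. phase (cfg (Suc n + m) w) = 2")
        case True
        then show ?thesis using search_forever[OF w c] iJ by blast
      next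
        case False
        define m where "m = (LEAST m. phase (cfg (Suc n + m) w) \<noteq> 2)"
        have "\<exists>m. phase (cfg (Suc n + m) w) \<noteq> 2" using False by blast
        then have m: "phase (cfg (Suc n + m) w) \<noteq> 2" unfolding m_def by (rule LeastI_ex)
        then obtain m' where m': "m = Suc m'" using c by (cases m) auto
        have before: "phase (cfg (Suc n + k) w) = 2" if "k \<le> m'" for k
        proof -
          have "k < m" using that m' by simp
          then show ?thesis unfolding m_def using not_less_Least by blast
        qed
        have "\<exists>cu cl. cfg (Suc n + k) w = Search i Xh Xt cu cl" if "k \<le> m'" for k
          using that
        proof (induction k)
          case (Suc k)
          then obtain cu cl where s: "cfg (Suc n + k) w = Search i Xh Xt cu cl" by auto
          have "cfg (Suc n + Suc k) w = Search i Xh Xt (ereal cl) (cl / 2)"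
            using before[OF Suc.prems] s by (simp split: if_splits)
          then show ?case by blast
        qed (use c in simp)
        then obtain cu cl where s: "cfg (Suc n + m') w = Search i Xh Xt cu cl" by blast
        have "\<exists>Xt'. cfg (Suc (Suc n + m')) w = Outer (Suc i) Xh Xt'"
          using m s unfolding m' by (simp split: if_splits)
        then show ?thesis using next_outer by blast
      qed
    qed
  qed
  then show ?thesis using cfg_first_outer[of w] by fastforce
qed

lemma AE_stops: "AE w in P. stops J d t c (\<lambda>m. N m w)"
proof -
  have "AE w in P. \<forall>i\<in>{1..d} - J. \<forall>L. \<exists>m. \<not> (\<forall>\<^sub>F n in sequentially. w \<in> searching i L (1 / real (Suc m)) n)"
    by (intro AE_ball_countable' AE_not_searching_forever AE_all_countable[THEN iffD2] allI) auto
  then show ?thesis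
  proof (rule AE_mp, intro AE_I2 impI)
    fix w assume "w \<in> space P"
      "\<forall>i\<in>{1..d} - J. \<forall>L. \<exists>m. \<not> (\<forall>\<^sub>F n in sequentially. w \<in> searching i L (1 / real (Suc m)) n)"
    then show "stops J d t c (\<lambda>m. N m w)"
      using run_alternative[of w] unfolding stops_def by blast
  qed
qed


section \<open>The returned function\<close>

lemma is_Stopped_iff: "is_Stopped C \<longleftrightarrow> phase C = 3"
  by (cases C) simp_all

lemma returned_Stopped:
  assumes "cfg n w = Stopped X"
  shows "returned J d t c (\<lambda>m. N m w) = X" and "n \<le> m \<Longrightarrow> cfg m w = Stopped X"
proof -
  have after: "cfg (k + r) w = Stopped Y" if "cfg k w = Stopped Y" for k r Y
    using that by (induction r) simp_all
  show "n \<le> m \<Longrightarrow> cfg m w = Stopped X"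
    using after[OF assms, of "m - n"] by simp
  define k where "k = (LEAST n. is_Stopped (cfg n w))"
  have "is_Stopped (cfg k w)" unfolding k_def by (rule LeastI[of _ n]) (simp add: assms)
  then obtain Y where Y: "cfg k w = Stopped Y" by (cases "cfg k w") simp_all
  have "k \<le> n" unfolding k_def by (rule Least_le) (simp add: assms)
  then have "Stopped X = Stopped Y" using after[OF Y, of "n - k"] assms by simp
  moreover have "stops J d t c (\<lambda>m. N m w)"
    unfolding stops_def using Y by (intro exI[of _ k]) simp
  ultimately show "returned J d t c (\<lambda>m. N m w) = X"
    unfolding returned_def k_def[symmetric] Y by simp
qed

lemma returned_eq: "returned J d t c (\<lambda>m. N m w) x =
  (if \<exists>n. phase (cfg n w) = 3 then current (cfg (LEAST n. phase (cfg n w) = 3) w) x else 0)"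
proof (cases "\<exists>n. phase (cfg n w) = 3")
  case True
  then have "phase (cfg (LEAST n. phase (cfg n w) = 3) w) = 3" by (rule LeastI_ex)
  then obtain X where "cfg (LEAST n. phase (cfg n w) = 3) w = Stopped X"
    by (cases "cfg (LEAST n. phase (cfg n w) = 3) w") simp_all
  then show ?thesis
    using True by (simp add: returned_Stopped(1) del: config_at.simps)
next
  case False
  then show ?thesis by (simp add: returned_def stops_def is_Stopped_iff)
qed

lemma returned_measurable: "(\<lambda>w. returned J d t c (\<lambda>m. N m w) x) \<in> borel_measurable P"
proof -
  have [measurable]: "(\<lambda>w. phase (cfg n w)) \<in> measurable P (count_space UNIV)" for n
    by (rule measurable_from_subalg[OF subalgebra_hist phase_measurable])
  have cur: "(\<lambda>w. current (cfg n w) x) \<in> borel_measurable P" for n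
    by (rule measurable_from_subalg[OF subalgebra_hist current_measurable])
  have pred: "Measurable.pred P (\<lambda>w. phase (cfg n w) = 3)" for n
    by measurable
  have "(\<lambda>w. current (cfg (LEAST n. phase (cfg n w) = 3) w) x) \<in> borel_measurable P"
    by (rule measurable_compose_countable[OF cur measurable_Least[OF pred]])
  moreover have "Measurable.pred P (\<lambda>w. \<exists>n. phase (cfg n w) = 3)"
    using pred by measurable
  ultimately show ?thesis
    unfolding returned_eq by (intro measurable_If) (simp_all add: pred_def)
qed

lemma returned_nonneg:
  assumes "w \<in> space P"
  shows "0 \<le> returned J d t c (\<lambda>m. N m w) x"
proof (cases "stops J d t c (\<lambda>m. N m w)")
  case True
  then obtain n where "is_Stopped (cfg n w)" unfolding stops_def by blast
  then obtain X where X: "cfg n w = Stopped X" by (cases "cfg n w") simp_all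
  then show ?thesis using valid_cfg[OF assms, of n] by (simp add: returned_Stopped(1)[OF X])
qed (simp add: returned_def)

text \<open>With equal thresholds the expected potential is constant in time. For a stopped run the
  potential is the indicator of the event, so by almost sure termination and boundedness by one the
  constant equals the probability of the event.\<close>

lemma emeasure_returned_le:
  assumes y: "\<And>l. 0 < y l"
  shows "emeasure P {w \<in> space P. \<forall>l\<in>{1..d}. returned J d t c (\<lambda>m. N m w) (t l) \<le> y l} =
    ennreal (exp (- measure \<mu> (exceeding y)))"
proof -
  let ?V = "{w \<in> space P. \<forall>l\<in>{1..d}. returned J d t c (\<lambda>m. N m w) (t l) \<le> y l}"
  have V: "?V \<in> sets P" using returned_measurable by measurable
  have "(\<lambda>n. \<integral>\<^sup>+w. ennreal (potential y y (cfg n w)) \<partial>P) \<longlonglongrightarrow> (\<integral>\<^sup>+w. indicator ?V w \<partial>P)"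
  proof (rule nn_integral_dominated_convergence[where w = "\<lambda>_. 1"])
    show "(\<lambda>w. ennreal (potential y y (cfg n w))) \<in> borel_measurable P" for n
      using measurable_from_subalg[OF subalgebra_hist potential_measurable[of y y n, OF y]]
      by (rule measurable_compose) simp
    show "(indicator ?V :: 'p \<Rightarrow> ennreal) \<in> borel_measurable P"
      using V by (rule borel_measurable_indicator)
    show "AE w in P. ennreal (potential y y (cfg n w)) \<le> 1" for n
      using potential_le_1 by (intro AE_I2) (simp add: ennreal_le_1)
    show "AE w in P. (\<lambda>n. ennreal (potential y y (cfg n w))) \<longlonglongrightarrow> indicator ?V w"
      using AE_stops
    proof (rule AE_mp, intro AE_I2 impI)
      fix w assume w: "w \<in> space P" "stops J d t c (\<lambda>m. N m w)"
      then obtain n where "is_Stopped (cfg n w)" unfolding stops_def by blast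
      then obtain X where X: "cfg n w = Stopped X" by (cases "cfg n w") simp_all
      have V_iff: "w \<in> ?V \<longleftrightarrow> (\<forall>l\<in>{1..d}. X (t l) \<le> y l)"
        using w(1) returned_Stopped(1)[OF X] by simp
      have "ennreal (potential y y (cfg m w)) = indicator ?V w" if "n \<le> m" for m
      proof -
        have "potential y y (cfg m w) = (if \<forall>l\<in>{1..d}. X (t l) \<le> y l then 1 else 0)"
          unfolding returned_Stopped(2)[OF X that] potential_def by simp
        then show ?thesis unfolding indicator_def V_iff by simp
      qed
      then show "(\<lambda>n. ennreal (potential y y (cfg n w))) \<longlonglongrightarrow> indicator ?V w"
        by (intro tendsto_eventually) (auto simp: eventually_sequentially)
    qed
  qed (simp_all add: emeasure_space_1)
  then have "(\<lambda>n. ennreal (initial_potential y y)) \<longlonglongrightarrow> emeasure P ?V"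
    unfolding integral_potential_eq[of y, OF y] using V by simp
  then have "emeasure P ?V = ennreal (initial_potential y y)"
    by (simp add: LIMSEQ_const_iff)
  then show ?thesis by (simp only: initial_potential_eq[of y, OF y])
qed

end


section \<open>The law of the process\<close>

lemma prm_void:
  assumes "prm Q S N \<mu>" "prob_space Q" "A \<in> sets S"
  shows "emeasure Q {w \<in> space Q. atoms (N w) \<inter> A = {}} = poisson_prob (emeasure \<mu> A) 0"
proof -
  interpret prob_space Q by (rule assms(2))
  have "emeasure Q {w \<in> space Q. atoms (N w) \<inter> A = {}} =
      (\<integral>\<^sup>+w\<in>space Q. poisson_prob (emeasure \<mu> A) 0 \<partial>Q)"
    using assms(1,3) unfolding prm_def
    by (intro prm_given_void) (auto intro: sigma_sets_top)
  also have "\<dots> = (\<integral>\<^sup>+w. poisson_prob (emeasure \<mu> A) 0 \<partial>Q)"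
    by (intro nn_integral_cong) simp
  finally show ?thesis by (simp add: emeasure_space_1)
qed

lemma suminf_poisson_prob:
  assumes "r < \<infinity>"
  shows "(\<Sum>k. poisson_prob r k) = 1"
proof -
  define x where "x = enn2real r"
  have "(\<lambda>k. x ^ k /\<^sub>R fact k) sums exp x" by (rule exp_converges)
  then have "(\<lambda>k. x ^ k /\<^sub>R fact k * exp (- x)) sums (exp x * exp (- x))" by (rule sums_mult2)
  then have "(\<lambda>k. x ^ k / fact k * exp (- x)) sums 1"
    by (simp add: divide_inverse mult.commute exp_add[symmetric])
  then have "(\<Sum>k. ennreal (x ^ k / fact k * exp (- x))) = ennreal 1"
    by (intro suminf_ennreal_eq) (simp_all add: x_def)
  moreover have "poisson_prob r k = ennreal (x ^ k / fact k * exp (- x))" for k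
    using assms by (simp add: poisson_prob_def x_def)
  ultimately show ?thesis by (simp only: ennreal_1)
qed

text \<open>For a finite mean the probabilities of all finite counts sum to one. The finiteness
  clause of \<open>prm_given\<close> does not give this, as it concerns finite total intensity,
  whereas here only the mass of \<open>A\<close> is known to be finite.\<close>

lemma prm_AE_finite:
  assumes N: "prm Q S N \<mu>" and "prob_space Q" and A: "A \<in> sets S" and fin: "emeasure \<mu> A < \<infinity>"
  shows "AE w in Q. emeasure (N w) A < \<infinity>"
proof -
  interpret prob_space Q by (rule assms(2))
  define U where "U k = {w \<in> space Q. emeasure (N w) A = of_nat k}" for k
  have meas[measurable]: "(\<lambda>w. emeasure (N w) A) \<in> borel_measurable Q"
    using N A by (simp add: prm_def prm_given_def)
  have U: "U k \<in> sets Q" for k unfolding U_def by measurable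
  have "emeasure Q (U k) = poisson_prob (emeasure \<mu> A) k" for k
  proof -
    have "\<forall>H\<in>sets (sigma (space Q) {}). \<forall>(k::nat) A n. (\<forall>l<k. A l \<in> sets S) \<longrightarrow> disjoint_family_on A {..<k} \<longrightarrow>
        emeasure Q {\<omega> \<in> H. \<forall>l<k. emeasure (N \<omega>) (A l) = of_nat (n l)} =
        (\<integral>\<^sup>+ \<omega>\<in>H. (\<Prod>l<k. poisson_prob (emeasure \<mu> (A l)) (n l)) \<partial>Q)"
      using N unfolding prm_def prm_given_def by blast
    from this[rule_format, of "space Q" 1 "\<lambda>_. A" "\<lambda>_. k"]
    have "emeasure Q (U k) = (\<integral>\<^sup>+w\<in>space Q. poisson_prob (emeasure \<mu> A) k \<partial>Q)"
      using A sigma_sets_top[of "space Q" "{}"] by (simp add: disjoint_family_on_def U_def)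
    also have "\<dots> = (\<integral>\<^sup>+w. poisson_prob (emeasure \<mu> A) k \<partial>Q)"
      by (intro nn_integral_cong) simp
    finally show ?thesis by (simp add: emeasure_space_1)
  qed
  then have "(\<Sum>k. emeasure Q (U k)) = 1" using suminf_poisson_prob[OF fin] by simp
  moreover have "(\<Sum>k. emeasure Q (U k)) = emeasure Q (\<Union>k. U k)"
  proof (rule suminf_emeasure)
    show "range U \<subseteq> sets Q" using U by blast
    show "disjoint_family U" by (auto simp: disjoint_family_on_def U_def)
  qed
  ultimately have "emeasure Q (\<Union>k. U k) = 1" by simp
  then have "AE w in Q. w \<in> (\<Union>k. U k)"
    using U by (intro AE_in_set_eq_1[THEN iffD2]) (auto simp: measure_def)
  then show ?thesis
    by (rule eventually_mono) (auto simp: U_def of_nat_less_top)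
qed

lemma pmax_le_iff_bdd:
  assumes "A \<subseteq> C0" "bdd_above ((\<lambda>f. f x) ` A)" "0 \<le> r"
  shows "pmax A x \<le> r \<longleftrightarrow> (\<forall>f\<in>A. f x \<le> r)"
  using assms by (auto simp: pmax_def cSUP_le_iff)

lemma pmax_nonneg_bdd:
  assumes "A \<subseteq> C0" "bdd_above ((\<lambda>f. f x) ` A)"
  shows "0 \<le> pmax A x"
proof (cases "A = {}")
  case False
  then obtain f where "f \<in> A" by blast
  then show ?thesis
    using assms False cSUP_upper[OF \<open>f \<in> A\<close> assms(2)] C0_nonneg[of f x] by (auto simp: pmax_def)
qed (simp add: pmax_def)

section \<open>Laws on finite products determined by distribution functions\<close>

lemma measure_eqI_PiM_atMost:
  fixes P Q :: "('i \<Rightarrow> real) measure"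
  assumes I: "finite I" and P: "sets P = sets (\<Pi>\<^sub>M i\<in>I. borel)" and Q: "sets Q = sets (\<Pi>\<^sub>M i\<in>I. borel)"
    and fin: "finite_measure P"
    and eq: "\<And>y. emeasure P (\<Pi>\<^sub>E i\<in>I. {..y i}) = emeasure Q (\<Pi>\<^sub>E i\<in>I. {..y i})"
  shows "P = Q"
proof -
  define \<Omega> where "\<Omega> = (\<Pi>\<^sub>E i\<in>I. (UNIV :: real set))"
  define G where "G = range (\<lambda>y :: 'i \<Rightarrow> real. \<Pi>\<^sub>E i\<in>I. {..y i})"
  have G_Pow: "G \<subseteq> Pow \<Omega>" by (auto simp: G_def \<Omega>_def)
  \<comment> \<open>A half-space in one coordinate is the increasing union of boxes whose other
    sides grow; this is how boxes generate the product \<sigma>-algebra.\<close>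
  have UN: "(\<Union>n::nat. (\<Pi>\<^sub>E j\<in>I. {..if j = i then a else real n})) = {x \<in> \<Omega>. i \<in> I \<longrightarrow> x i \<le> a}" for i a
  proof (intro equalityI subsetI)
    fix x assume x: "x \<in> {x \<in> \<Omega>. i \<in> I \<longrightarrow> x i \<le> a}"
    obtain n :: nat where n: "Max (insert 0 (x ` I)) \<le> real n" using real_arch_simple by blast
    have "x j \<le> real n" if "j \<in> I" for j
      using that I n by simp
    then show "x \<in> (\<Union>n::nat. (\<Pi>\<^sub>E j\<in>I. {..if j = i then a else real n}))"
      using x by (intro UN_I[of n]) (auto simp: \<Omega>_def PiE_iff)
  qed (auto simp: \<Omega>_def PiE_iff)
  have sets: "sets (\<Pi>\<^sub>M i\<in>I. (borel :: real measure)) = sigma_sets \<Omega> G"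
  proof
    have space: "space (sigma \<Omega> G) = (\<Pi>\<^sub>E i\<in>I. space (borel :: real measure))"
      using G_Pow by (simp add: \<Omega>_def space_measure_of_conv)
    have "sets (\<Pi>\<^sub>M i\<in>I. (borel :: real measure)) \<subseteq> sets (sigma \<Omega> G)"
    proof (rule sets_PiM_in_sets[OF space])
      fix i and A :: "real set" assume i: "i \<in> I" and A: "A \<in> sets borel"
      have "(\<lambda>x. x i) \<in> borel_measurable (sigma \<Omega> G)"
        unfolding borel_measurable_iff_le
      proof
        fix a
        have "(\<Union>n::nat. (\<Pi>\<^sub>E j\<in>I. {..if j = i then a else real n})) \<in> sets (sigma \<Omega> G)"
          using G_Pow by (intro sets.countable_UN) (auto simp: G_def intro!: sigma_sets.Basic)
        then show "{x \<in> space (sigma \<Omega> G). x i \<le> a} \<in> sets (sigma \<Omega> G)"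
          unfolding UN using i G_Pow by (simp add: space_measure_of_conv)
      qed
      from measurable_sets[OF this A] show "{x \<in> space (sigma \<Omega> G). x i \<in> A} \<in> sets (sigma \<Omega> G)"
        by (simp add: vimage_def Int_def conj_commute)
    qed
    then show "sets (\<Pi>\<^sub>M i\<in>I. (borel :: real measure)) \<subseteq> sigma_sets \<Omega> G"
      using G_Pow by simp
    have "G \<subseteq> sets (\<Pi>\<^sub>M i\<in>I. (borel :: real measure))"
      using I by (auto simp: G_def intro!: sets_PiM_I_finite)
    moreover have "space (\<Pi>\<^sub>M i\<in>I. (borel :: real measure)) = \<Omega>"
      by (simp add: space_PiM \<Omega>_def)
    ultimately show "sigma_sets \<Omega> G \<subseteq> sets (\<Pi>\<^sub>M i\<in>I. (borel :: real measure))"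
      using sets.sigma_sets_subset by metis
  qed
  show ?thesis
  proof (rule measure_eqI_generator_eq[of G \<Omega> P Q "\<lambda>n. \<Pi>\<^sub>E i\<in>I. {..real n}"])
    show "Int_stable G"
    proof (rule Int_stableI)
      fix a b assume "a \<in> G" "b \<in> G"
      then obtain y z where "a = (\<Pi>\<^sub>E i\<in>I. {..y i})" "b = (\<Pi>\<^sub>E i\<in>I. {..z i})" by (auto simp: G_def)
      then have "a \<inter> b = (\<Pi>\<^sub>E i\<in>I. {..min (y i) (z i)})" by (auto simp: PiE_iff)
      then show "a \<inter> b \<in> G" unfolding G_def by (rule range_eqI[where x = "\<lambda>i. min (y i) (z i)"])
    qed
    show "(\<Union>n. \<Pi>\<^sub>E i\<in>I. {..real n}) = \<Omega>"
    proof (intro equalityI subsetI)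
      fix x assume x: "x \<in> \<Omega>"
      obtain n :: nat where n: "Max (insert 0 (x ` I)) \<le> real n" using real_arch_simple by blast
      have "x j \<le> real n" if "j \<in> I" for j
        using that I n by simp
      then show "x \<in> (\<Union>n. \<Pi>\<^sub>E i\<in>I. {..real n})"
        using x by (intro UN_I[of n]) (auto simp: \<Omega>_def PiE_iff)
    qed (auto simp: \<Omega>_def PiE_iff)
    show "emeasure P (\<Pi>\<^sub>E i\<in>I. {..real n}) \<noteq> \<infinity>" for n
      using finite_measure.emeasure_finite[OF fin] by simp
  qed (use P Q sets eq G_Pow in \<open>auto simp: G_def\<close>)
qed

text \<open>The distribution functions are computed at positive thresholds only, where the mass of
  the exceeding functions is known to be finite. Zero thresholds are reached by decreasing boxes,
  and negative ones have probability zero on both sides.\<close>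

lemma measure_eqI_PiM_atMost_nonneg:
  fixes P Q :: "('i \<Rightarrow> real) measure"
  assumes I: "finite I" and P: "sets P = sets (\<Pi>\<^sub>M i\<in>I. borel)" and Q: "sets Q = sets (\<Pi>\<^sub>M i\<in>I. borel)"
    and fin: "finite_measure P" "finite_measure Q"
    and nonneg: "\<And>i. i \<in> I \<Longrightarrow> AE x in P. 0 \<le> x i" "\<And>i. i \<in> I \<Longrightarrow> AE x in Q. 0 \<le> x i"
    and eq: "\<And>y. (\<And>i. 0 < y i) \<Longrightarrow> emeasure P (\<Pi>\<^sub>E i\<in>I. {..y i}) = emeasure Q (\<Pi>\<^sub>E i\<in>I. {..y i})"
  shows "P = Q"
proof (rule measure_eqI_PiM_atMost[OF I P Q fin(1)])
  fix y :: "'i \<Rightarrow> real"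
  have sets: "(\<Pi>\<^sub>E i\<in>I. {..y i}) \<in> sets (\<Pi>\<^sub>M i\<in>I. (borel :: real measure))" for y :: "'i \<Rightarrow> real"
    using I by (intro sets_PiM_I_finite) auto
  show "emeasure P (\<Pi>\<^sub>E i\<in>I. {..y i}) = emeasure Q (\<Pi>\<^sub>E i\<in>I. {..y i})"
  proof (cases "\<exists>i\<in>I. y i < 0")
    case True
    then obtain i where i: "i \<in> I" "y i < 0" by blast
    have null: "emeasure R (\<Pi>\<^sub>E i\<in>I. {..y i}) = 0"
      if "sets R = sets (\<Pi>\<^sub>M i\<in>I. (borel :: real measure))" "AE x in R. 0 \<le> x i" for R
    proof -
      have "AE x in R. x \<notin> (\<Pi>\<^sub>E i\<in>I. {..y i})"
        using that(2) by (rule eventually_mono) (use i in \<open>force simp: PiE_iff\<close>)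
      then show ?thesis
        using sets[of y] that(1) by (intro AE_iff_measurable[THEN iffD1]) (auto dest: sets.sets_into_space)
    qed
    show ?thesis using null[OF P nonneg(1)] null[OF Q nonneg(2)] i by simp
  next
    case False
    \<comment> \<open>Positivity is required of all thresholds, also outside \<open>I\<close>, where
      nothing is known about the sign of \<open>y i\<close>; hence the \<open>max 0\<close>.\<close>
    define E where "E n = (\<Pi>\<^sub>E i\<in>I. {..max 0 (y i) + 1 / real (Suc n)})" for n
    have Inter: "(\<Inter>n. E n) = (\<Pi>\<^sub>E i\<in>I. {..y i})"
    proof (intro equalityI subsetI)
      fix x assume x: "x \<in> (\<Inter>n. E n)"
      have "x i \<le> y i" if "i \<in> I" for i
      proof (rule field_le_epsilon)
        fix e :: real assume "0 < e"
        then obtain n where "1 / real (Suc n) < e" by (metis nat_approx_posE)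
        moreover have "x i \<le> max 0 (y i) + 1 / real (Suc n)"
          using x that by (auto simp: E_def PiE_iff)
        ultimately show "x i \<le> y i + e" using False that by fastforce
      qed
      then show "x \<in> (\<Pi>\<^sub>E i\<in>I. {..y i})" using x by (auto simp: E_def PiE_iff)
    next
      fix x assume x: "x \<in> (\<Pi>\<^sub>E i\<in>I. {..y i})"
      have "x i \<le> max 0 (y i) + 1 / real (Suc n)" if "i \<in> I" for i n
      proof -
        have "x i \<le> y i" using x that by (auto simp: PiE_iff)
        moreover have "0 < 1 / real (Suc n)" by simp
        ultimately show ?thesis by linarith
      qed
      then show "x \<in> (\<Inter>n. E n)" using x by (auto simp: E_def PiE_iff)
    qed
    have dec: "decseq E"
    proof (rule decseq_SucI, rule subsetI)
      fix n x assume x: "x \<in> E (Suc n)"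
      have "1 / real (Suc (Suc n)) \<le> 1 / real (Suc n)" by (simp add: frac_le)
      then have "x i \<le> max 0 (y i) + 1 / real (Suc n)" if "i \<in> I" for i
        using x that by (fastforce simp: E_def PiE_iff)
      then show "x \<in> E n" using x by (auto simp: E_def PiE_iff)
    qed
    have lim: "(\<lambda>n. emeasure R (E n)) \<longlonglongrightarrow> emeasure R (\<Pi>\<^sub>E i\<in>I. {..y i})"
      if "sets R = sets (\<Pi>\<^sub>M i\<in>I. (borel :: real measure))" "finite_measure R" for R
    proof -
      have "range E \<subseteq> sets R" unfolding that(1) E_def by (intro image_subsetI sets)
      then show ?thesis
        unfolding Inter[symmetric] using dec finite_measure.emeasure_finite[OF that(2)]
        by (intro Lim_emeasure_decseq) simp_all
    qed
    have pos: "0 < max 0 (y i) + 1 / real (Suc n)" for i n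
      by (intro add_nonneg_pos) simp_all
    have "emeasure P (E n) = emeasure Q (E n)" for n
      unfolding E_def by (rule eq) (rule pos)
    then show ?thesis
      using lim[OF P fin(1)] lim[OF Q fin(2)] by (simp add: LIMSEQ_unique)
  qed
qed

section \<open>The law of a process with given exponent measure\<close>

lemma exponent_measure_exceed_finite:
  assumes "exponent_measure M X \<mu>" "0 < e"
  shows "emeasure \<mu> {f \<in> C0. f x > e} < \<infinity>"
proof -
  have "\<forall>K e. compact K \<longrightarrow> K \<noteq> {} \<longrightarrow> 0 < e \<longrightarrow> emeasure \<mu> {f \<in> C0. (SUP x\<in>K. f x) > e} < \<infinity>"
    using assms(1) unfolding exponent_measure_def by (elim conjE)
  from this[rule_format, of "{x}" e] show ?thesis using assms(2) by simp
qed

text \<open>The supremum of an unbounded set of reals is a junk value. The values at a point of \<open>D\<close> are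
  almost surely bounded because only finitely many functions exceed the level \<open>1\<close> there.\<close>

lemma exponent_measure_void:
  fixes X :: "'w \<Rightarrow> 'a::metric_space \<Rightarrow> real"
  assumes exp: "exponent_measure M X \<mu>" and D: "finite D"
    and A: "A \<in> sets C0_borel" and E: "E \<in> sets paths"
    and iff: "\<And>Z. Z \<subseteq> C0 \<Longrightarrow> (\<And>x. x \<in> D \<Longrightarrow> bdd_above ((\<lambda>f. f x) ` Z)) \<Longrightarrow> pmax Z \<in> E \<longleftrightarrow> Z \<inter> A = {}"
  shows "emeasure M {\<omega> \<in> space M. X \<omega> \<in> E} = poisson_prob (emeasure \<mu> A) 0"
proof -
  from exp have "\<exists>(Q :: ('a \<Rightarrow> real) measure measure) N. prob_space Q \<and> prm Q C0_borel N \<mu> \<and>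
      same_law M Q paths X (\<lambda>\<omega>. pmax (atoms (N \<omega>)))"
    unfolding exponent_measure_def by (elim conjE)
  then obtain Q :: "('a \<Rightarrow> real) measure measure" and N where
    Q: "prob_space Q" and N: "prm Q C0_borel N \<mu>" and law: "same_law M Q paths X (\<lambda>\<omega>. pmax (atoms (N \<omega>)))"
    by blast
  have point: "is_point_measure C0_borel (N w)" if "w \<in> space Q" for w
    using N that by (simp add: prm_def prm_given_def)
  have X: "X \<in> measurable M paths" and Y: "(\<lambda>\<omega>. pmax (atoms (N \<omega>))) \<in> measurable Q paths"
    and eq: "distr M paths X = distr Q paths (\<lambda>\<omega>. pmax (atoms (N \<omega>)))"
    using law unfolding same_law_def by simp_all
  have big: "{f \<in> C0. f x > 1} \<in> sets C0_borel" for x :: 'a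
  proof -
    have "{f \<in> space C0_borel. f x > 1} \<in> sets C0_borel" by measurable
    then show ?thesis by (simp add: space_C0_borel)
  qed
  have "AE w in Q. emeasure (N w) {f \<in> C0. f x > 1} < \<infinity>" for x
    by (rule prm_AE_finite[OF N Q big exponent_measure_exceed_finite[OF exp]]) simp
  then have "AE w in Q. \<forall>x\<in>D. emeasure (N w) {f \<in> C0. f x > 1} < \<infinity>"
    by (rule AE_finite_allI[OF D])
  then have AE: "AE w in Q. pmax (atoms (N w)) \<in> E \<longleftrightarrow> atoms (N w) \<inter> A = {}"
  proof (rule AE_mp, intro AE_I2 impI)
    fix w assume w: "w \<in> space Q" and fin: "\<forall>x\<in>D. emeasure (N w) {f \<in> C0. f x > 1} < \<infinity>"
    have sub: "atoms (N w) \<subseteq> C0"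
      using atoms_subset[OF point[OF w]] by (simp add: space_C0_borel)
    show "pmax (atoms (N w)) \<in> E \<longleftrightarrow> atoms (N w) \<inter> A = {}"
    proof (rule iff[OF sub])
      fix x assume "x \<in> D"
      then have fin': "finite (atoms (N w) \<inter> {f \<in> C0. f x > 1})"
        using fin by (intro finite_atoms_Int[OF point[OF w] big]) blast
      have "(\<lambda>f. f x) ` atoms (N w) \<subseteq> {..1} \<union> (\<lambda>f. f x) ` (atoms (N w) \<inter> {f \<in> C0. f x > 1})"
      proof (rule image_subsetI)
        fix f assume "f \<in> atoms (N w)"
        then show "f x \<in> {..1} \<union> (\<lambda>f. f x) ` (atoms (N w) \<inter> {f \<in> C0. f x > 1})"
          using sub by (cases "f x \<le> 1") (auto simp: not_le)
      qed
      moreover have "bdd_above ({..1} \<union> (\<lambda>f. f x) ` (atoms (N w) \<inter> {f \<in> C0. f x > 1}))"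
        using fin' by simp
      ultimately show "bdd_above ((\<lambda>f. f x) ` atoms (N w))"
        by (rule bdd_above_mono[rotated])
    qed
  qed
  have "emeasure M {\<omega> \<in> space M. X \<omega> \<in> E} = emeasure (distr M paths X) E"
    using X E by (simp add: emeasure_distr vimage_def Int_def conj_commute)
  also have "\<dots> = emeasure Q {\<omega> \<in> space Q. pmax (atoms (N \<omega>)) \<in> E}"
    unfolding eq using Y E by (simp add: emeasure_distr vimage_def Int_def conj_commute)
  also have "\<dots> = emeasure Q {\<omega> \<in> space Q. atoms (N \<omega>) \<inter> A = {}}"
  proof (rule emeasure_eq_AE)
    show "AE w in Q. w \<in> {\<omega> \<in> space Q. pmax (atoms (N \<omega>)) \<in> E} \<longleftrightarrow> w \<in> {\<omega> \<in> space Q. atoms (N \<omega>) \<inter> A = {}}"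
      using AE by (rule eventually_mono) blast
    show "{\<omega> \<in> space Q. pmax (atoms (N \<omega>)) \<in> E} \<in> sets Q"
      using measurable_sets[OF Y E] by (simp add: vimage_def Int_def conj_commute)
    have meas: "(\<lambda>w. emeasure (N w) A) \<in> borel_measurable Q"
      using N A by (simp add: prm_def prm_given_def)
    have "{\<omega> \<in> space Q. atoms (N \<omega>) \<inter> A = {}} = {\<omega> \<in> space Q. emeasure (N \<omega>) A = 0}"
      using point_measure_eq_0_iff[OF point A] by auto
    then show "{\<omega> \<in> space Q. atoms (N \<omega>) \<inter> A = {}} \<in> sets Q"
      using meas by simp
  qed
  also have "\<dots> = poisson_prob (emeasure \<mu> A) 0"
    by (rule prm_void[OF N Q A])
  finally show ?thesis .
qed

lemma sets_paths_Collect: "{p. p x \<in> B} \<in> sets paths" if "B \<in> sets borel" for x and B :: "real set"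
proof -
  have "(\<lambda>p. p x) -` B \<inter> space paths \<in> sets paths"
    unfolding paths_def using that by (intro measurable_sets[OF measurable_component_singleton]) simp_all
  then show ?thesis by (simp add: paths_def space_PiM vimage_def)
qed

text \<open>Since an infinite mean gives probability zero to every finite count, this ties the
  probability of the value zero to the finiteness of the mass of functions positive at
  \<open>x\<close>.\<close>

lemma process_zero:
  fixes X :: "'w \<Rightarrow> 'a::metric_space \<Rightarrow> real"
  assumes "exponent_measure M X \<mu>"
  shows "emeasure M {\<omega> \<in> space M. X \<omega> x = 0} = poisson_prob (emeasure \<mu> {f \<in> C0. f x > 0}) 0"
proof -
  have "emeasure M {\<omega> \<in> space M. X \<omega> \<in> {p. p x \<in> {0}}} = poisson_prob (emeasure \<mu> {f \<in> C0. f x > 0}) 0"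
  proof (rule exponent_measure_void[OF assms, of "{x}"])
    have "{f \<in> space C0_borel. f x > 0} \<in> sets C0_borel" by measurable
    then show "{f \<in> C0. f x > 0} \<in> sets C0_borel" by (simp add: space_C0_borel)
    show "{p. p x \<in> {0}} \<in> sets paths" by (rule sets_paths_Collect) simp
    fix Z :: "('a \<Rightarrow> real) set" assume Z: "Z \<subseteq> C0" "\<And>y. y \<in> {x} \<Longrightarrow> bdd_above ((\<lambda>f. f y) ` Z)"
    have "pmax Z x = 0 \<longleftrightarrow> pmax Z x \<le> 0"
      using pmax_nonneg_bdd[OF Z(1) Z(2)[OF singletonI]] by linarith
    also have "\<dots> \<longleftrightarrow> (\<forall>f\<in>Z. f x \<le> 0)"
      using Z by (intro pmax_le_iff_bdd) auto
    also have "\<dots> \<longleftrightarrow> Z \<inter> {f \<in> C0. f x > 0} = {}"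
      using Z(1) by (auto simp: not_less)
    finally show "pmax Z \<in> {p. p x \<in> {0}} \<longleftrightarrow> Z \<inter> {f \<in> C0. f x > 0} = {}" by simp
  qed simp
  then show ?thesis by simp
qed

lemma process_nonneg:
  fixes X :: "'w \<Rightarrow> 'a::metric_space \<Rightarrow> real"
  assumes "exponent_measure M X \<mu>" "prob_space M"
  shows "AE \<omega> in M. 0 \<le> X \<omega> x"
proof -
  interpret prob_space M by (rule assms(2))
  have X: "X \<in> measurable M paths"
    using assms(1) unfolding exponent_measure_def same_law_def by blast
  have E: "{p. p x \<in> {0..}} \<in> sets paths" for x :: 'a by (rule sets_paths_Collect) simp
  have "emeasure M {\<omega> \<in> space M. X \<omega> \<in> {p. p x \<in> {0..}}} = poisson_prob (emeasure \<mu> {}) 0"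
  proof (rule exponent_measure_void[OF assms(1), of "{x}"])
    fix Z :: "('a \<Rightarrow> real) set" assume Z: "Z \<subseteq> C0" "\<And>y. y \<in> {x} \<Longrightarrow> bdd_above ((\<lambda>f. f y) ` Z)"
    then show "pmax Z \<in> {p. p x \<in> {0..}} \<longleftrightarrow> Z \<inter> {} = {}"
      using pmax_nonneg_bdd[OF Z(1), of x] by simp
  qed (use E[of x] in simp_all)
  then have "emeasure M {\<omega> \<in> space M. 0 \<le> X \<omega> x} = 1"
    by (simp add: poisson_prob_def)
  moreover have "{\<omega> \<in> space M. 0 \<le> X \<omega> x} \<in> sets M"
    using measurable_sets[OF X E[of x]] by (simp add: vimage_def Int_def conj_commute)
  ultimately show ?thesis
    by (intro AE_iff_emeasure_eq_1[THEN iffD2]) simp_all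
qed

lemma process_le:
  fixes X :: "'w \<Rightarrow> 'a::metric_space \<Rightarrow> real"
  assumes "exponent_measure M X \<mu>" and I: "finite I" and y: "\<And>l. 0 < y l"
  shows "emeasure M {\<omega> \<in> space M. \<forall>l\<in>I. X \<omega> (t l) \<le> y l} =
    poisson_prob (emeasure \<mu> {f \<in> C0. \<exists>l\<in>I. y l < f (t l)}) 0"
proof -
  have "emeasure M {\<omega> \<in> space M. X \<omega> \<in> {p. \<forall>l\<in>I. p (t l) \<le> y l}} =
      poisson_prob (emeasure \<mu> {f \<in> C0. \<exists>l\<in>I. y l < f (t l)}) 0"
  proof (rule exponent_measure_void[OF assms(1), of "t ` I"])
    have "{f \<in> space C0_borel. \<exists>l\<in>I. y l < f (t l)} \<in> sets C0_borel" using I by measurable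
    then show "{f \<in> C0. \<exists>l\<in>I. y l < f (t l)} \<in> sets C0_borel" by (simp add: space_C0_borel)
    have "{p. \<forall>l\<in>I. p (t l) \<le> y l} = space paths \<inter> (\<Inter>l\<in>I. {p. p (t l) \<in> {..y l}})"
      by (auto simp: paths_def space_PiM)
    also have "\<dots> \<in> sets paths"
    proof (cases "I = {}")
      case False
      then show ?thesis using I by (intro sets.Int sets.top sets.finite_INT sets_paths_Collect) simp_all
    qed simp
    finally show "{p. \<forall>l\<in>I. p (t l) \<le> y l} \<in> sets paths" .
    fix Z :: "('a \<Rightarrow> real) set" assume Z: "Z \<subseteq> C0" "\<And>x. x \<in> t ` I \<Longrightarrow> bdd_above ((\<lambda>f. f x) ` Z)"
    have "pmax Z (t l) \<le> y l \<longleftrightarrow> (\<forall>f\<in>Z. f (t l) \<le> y l)" if "l \<in> I" for l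
      using that Z y[THEN less_imp_le] by (intro pmax_le_iff_bdd) auto
    then have "pmax Z \<in> {p. \<forall>l\<in>I. p (t l) \<le> y l} \<longleftrightarrow> (\<forall>l\<in>I. \<forall>f\<in>Z. f (t l) \<le> y l)" by simp
    also have "\<dots> \<longleftrightarrow> Z \<inter> {f \<in> C0. \<exists>l\<in>I. y l < f (t l)} = {}"
      using Z(1) by (auto simp: disjoint_iff subset_iff not_less[symmetric])
    finally show "pmax Z \<in> {p. \<forall>l\<in>I. p (t l) \<le> y l} \<longleftrightarrow> Z \<inter> {f \<in> C0. \<exists>l\<in>I. y l < f (t l)} = {}" .
  qed (use I in simp)
  then show ?thesis by simp
qed

text \<open>A Poisson variable vanishes with positive probability iff its mean is finite, so
  \<open>J0\<close> collects the indices at whose points the positive functions have finite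
  mass.\<close>

lemma simulation_J0:
  fixes M :: "'w measure" and X :: "'w \<Rightarrow> 'a::metric_space \<Rightarrow> real" and P :: "'p measure"
  assumes M: "prob_space M" and exp: "exponent_measure M X \<mu>" and c: "\<forall>i. 0 < c i"
    and run: "is_run P \<mu> (J0 M X d t) d t c N"
  shows "simulation P \<mu> (J0 M X d t) d t c N"
proof -
  interpret M: prob_space M by (rule M)
  have "emeasure M {\<omega> \<in> space M. X \<omega> (t j) = 0} > 0 \<longleftrightarrow> emeasure \<mu> {f \<in> C0. f (t j) > 0} < \<infinity>" for j
    unfolding process_zero[OF exp] by (simp add: poisson_prob_def top.not_eq_extremum)
  then have J0: "j \<in> J0 M X d t \<longleftrightarrow> j \<in> {1..d} \<and> emeasure \<mu> {f \<in> C0. f (t j) > 0} < \<infinity>" for j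
    by (auto simp: J0_def M.emeasure_eq_measure)
  show ?thesis
  proof (intro simulation.intro simulation_axioms.intro)
    show "prob_space P" using run by (simp add: is_run_def)
    show "sets \<mu> = sets C0_borel" using exp by (simp add: exponent_measure_def)
    show "emeasure \<mu> {f \<in> C0. e < f (t l)} < \<infinity>" if "0 < e" for l e
      using exponent_measure_exceed_finite[OF exp that] .
    show "J0 M X d t \<subseteq> {1..d}" by (auto simp: J0_def)
    show "emeasure \<mu> {f \<in> C0. 0 < f (t j)} < \<infinity>" if "j \<in> J0 M X d t" for j
      using that J0 by blast
    show "emeasure \<mu> {f \<in> C0. 0 < f (t i)} = \<infinity>" if "i \<in> {1..d} - J0 M X d t" for i
    proof -
      have "\<not> emeasure \<mu> {f \<in> C0. 0 < f (t i)} < \<infinity>" using that J0 by blast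
      then show ?thesis unfolding infinity_ennreal_def top.not_eq_extremum[symmetric] by blast
    qed
    show "0 < c i" for i using c by blast
  qed (rule run)
qed

text \<open>The first conjunct expresses that only finite Poisson random measures are ever asked
  for, so that each transition is a finite simulation. The sample spaces of the process and of the
  run are unrelated; only laws are compared.\<close>

theorem theorem2:
  fixes M :: "'w measure" and X :: "'w \<Rightarrow> 'a::metric_space \<Rightarrow> real"
    and \<mu> :: "('a \<Rightarrow> real) measure" and d :: nat and t :: "nat \<Rightarrow> 'a" and c :: "nat \<Rightarrow> real"
    and P :: "'p measure" and N :: "nat \<Rightarrow> 'p \<Rightarrow> ('a \<Rightarrow> real) measure"
  assumes "locally_compact_space (euclidean :: 'a topology)"
    and "prob_space M"
    and "continuous_process M X"
    and "max_id M X"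
    and "\<forall>x. vertex M X x = 0"
    and "exponent_measure M X \<mu>"
    and "1 \<le> d"
    and "\<forall>i. 0 < c i"
    and "is_run P \<mu> (J0 M X d t) d t c N"
  shows "(\<forall>\<omega>\<in>space P. \<forall>n.
            emeasure (intensity \<mu> (J0 M X d t) d t
              (config_at (J0 M X d t) d t c (\<lambda>m. N m \<omega>) n)) (space C0_borel) < \<infinity>) \<and>
         (AE \<omega> in P. stops (J0 M X d t) d t c (\<lambda>m. N m \<omega>)) \<and>
         same_law P M (\<Pi>\<^sub>M i\<in>{1..d}. borel)
           (\<lambda>\<omega>. \<lambda>i\<in>{1..d}. returned (J0 M X d t) d t c (\<lambda>m. N m \<omega>) (t i))
           (\<lambda>\<omega>. \<lambda>i\<in>{1..d}. X \<omega> (t i))"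
proof -
  interpret M: prob_space M by (rule assms(2))
  interpret simulation P \<mu> "J0 M X d t" d t c N
    by (rule simulation_J0[OF assms(2,6,8,9)])
  let ?S = "\<Pi>\<^sub>M i\<in>{1..d}. (borel :: real measure)"
  define Y where "Y \<omega> = (\<lambda>i\<in>{1..d}. returned (J0 M X d t) d t c (\<lambda>m. N m \<omega>) (t i))" for \<omega>
  define V where "V \<omega> = (\<lambda>i\<in>{1..d}. X \<omega> (t i))" for \<omega>
  have X: "(\<lambda>\<omega>. X \<omega> x) \<in> borel_measurable M" for x
    using assms(3) by (simp add: continuous_process_def)
  have Y: "Y \<in> measurable P ?S"
    unfolding Y_def by (rule measurable_restrict) (rule returned_measurable)
  have V: "V \<in> measurable M ?S"
    unfolding V_def by (rule measurable_restrict) (rule X)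
  \<comment> \<open>Both vectors are nonnegative, so it is enough to compare distribution functions
    at positive thresholds, where both equal the probability that a Poisson process of intensity
    \<open>\<mu>\<close> has no function in \<open>exceeding y\<close>.\<close>
  have "distr P ?S Y = distr M ?S V"
  proof (rule measure_eqI_PiM_atMost_nonneg)
    show "finite_measure (distr P ?S Y)" "finite_measure (distr M ?S V)"
      using Y V by (simp_all add: finite_measure_distr M.finite_measure_distr)
    fix i assume i: "i \<in> {1..d}"
    have [measurable]: "(\<lambda>x. x i) \<in> borel_measurable ?S"
      using i by (rule measurable_component_singleton)
    have half: "{x \<in> space ?S. 0 \<le> x i} \<in> sets ?S" by measurable
    have "AE \<omega> in P. 0 \<le> Y \<omega> i"
      using i by (intro AE_I2) (simp add: Y_def returned_nonneg)
    then show "AE x in distr P ?S Y. 0 \<le> x i"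
      by (subst AE_distr_iff[OF Y half])
    have "AE \<omega> in M. 0 \<le> V \<omega> i"
      using i process_nonneg[OF assms(6,2), of "t i"] by (simp add: V_def)
    then show "AE x in distr M ?S V. 0 \<le> x i"
      by (subst AE_distr_iff[OF V half])
  next
    fix y :: "nat \<Rightarrow> real" assume y: "\<And>i. 0 < y i"
    have box: "(\<Pi>\<^sub>E i\<in>{1..d}. {..y i}) \<in> sets ?S"
      by (intro sets_PiM_I_finite) simp_all
    have "emeasure (distr P ?S Y) (\<Pi>\<^sub>E i\<in>{1..d}. {..y i}) =
        emeasure P {\<omega> \<in> space P. \<forall>l\<in>{1..d}. returned (J0 M X d t) d t c (\<lambda>m. N m \<omega>) (t l) \<le> y l}"
      using Y box by (simp add: emeasure_distr) (auto simp: Y_def PiE_iff intro!: arg_cong2[where f = emeasure])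
    also have "\<dots> = ennreal (exp (- measure \<mu> (exceeding y)))"
      by (rule emeasure_returned_le[of y, OF y])
    also have "\<dots> = poisson_prob (emeasure \<mu> (exceeding y)) 0"
      by (rule poisson_prob_0[symmetric]) (rule exceeding_finite[of y, OF y])
    also have "\<dots> = emeasure M {\<omega> \<in> space M. \<forall>l\<in>{1..d}. X \<omega> (t l) \<le> y l}"
      unfolding exceeding_def by (rule process_le[OF assms(6) _ y, symmetric]) simp
    also have "\<dots> = emeasure (distr M ?S V) (\<Pi>\<^sub>E i\<in>{1..d}. {..y i})"
      using V box by (simp add: emeasure_distr) (auto simp: V_def PiE_iff intro!: arg_cong2[where f = emeasure])
    finally show "emeasure (distr P ?S Y) (\<Pi>\<^sub>E i\<in>{1..d}. {..y i}) =
      emeasure (distr M ?S V) (\<Pi>\<^sub>E i\<in>{1..d}. {..y i})" .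
  qed simp_all
  then have "same_law P M ?S Y V"
    using Y V by (simp add: same_law_def)
  then show ?thesis
    using intensity_cfg_finite AE_stops unfolding Y_def V_def by blast
qed

end
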